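(* Let $b>1$ be an integer, and assume that number representations are written in base $b$ with the least significant digit first. Given as input a deterministic finite automaton $\mathcal{A}$ over the alphabet $\{0,1,\ldots,b-1\}$ with $n$ states, it is decidable in time $O((b\,n)\log n)$ whether $\mathcal{A}$ accepts an ultimately periodic set of nonnegative integers.
   Context: For a word $u=a_0a_1\cdots a_m$ over $A_b=\{0,1,\ldots,b-1\}$, its value (least significant digit first) is $\overline{u}=\sum_{i=0}^{m}a_i b^i$; the empty word has value $0$. An automaton $\mathcal{A}$ over $A_b$ accepts the set $S\subseteq\mathbb{N}$ if the language of $\mathcal{A}$ is exactly $\{u\in A_b^*\mid \overline{u}\in S\}$ (acceptance by value: either all words with a given value are accepted, or none of them). A set $S\subseteq\mathbb{N}$ is ultimately periodic if there are a finite set $I\subseteq\mathbb{N}$, a positive integer $p$ and $R\subseteq\{0,\ldots,p-1\}$ such that $S$ is the symmetric difference of $I$ and $R+p\mathbb{N}$. Time is measured in the usual sense (unit-cost RAM), uniformly in $b$ and $n$. *)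

theory Defs
  imports Complex_Main
begin

section \<open>Sets of numbers and their representations\<close>

definition word_value :: "nat \<Rightarrow> nat list \<Rightarrow> nat" where
  "word_value b u = (\<Sum>i<length u. u ! i * b ^ i)"

definition ultimately_periodic :: "nat set \<Rightarrow> bool" where
  "ultimately_periodic S \<longleftrightarrow>
     (\<exists>I p R. finite I \<and> p > 0 \<and> R \<subseteq> {..<p} \<and>
        S = (let E = {r + p * k | r k. r \<in> R} in (I - E) \<union> (E - I)))"


section \<open>Deterministic finite automata\<close>

text \<open>
  The states of an automaton with \<open>n\<close> states are \<open>0, \<dots>, n - 1\<close>; over the alphabet of the digits
  \<open>0, \<dots>, b - 1\<close> only the transitions from these states by these letters are meaningful.
  Transition functions may be partial; complete automata are the case without \<open>None\<close>.
\<close>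

record dfa =
  nstates :: nat
  initial :: nat
  trans :: "nat \<Rightarrow> nat \<Rightarrow> nat option"
  final :: "nat set"

definition is_dfa :: "nat \<Rightarrow> dfa \<Rightarrow> bool" where
  "is_dfa b A \<longleftrightarrow>
     initial A < nstates A \<and> final A \<subseteq> {..<nstates A} \<and>
     (\<forall>q<nstates A. \<forall>a<b. \<forall>q'. trans A q a = Some q' \<longrightarrow> q' < nstates A)"

primrec trans_word :: "dfa \<Rightarrow> nat \<Rightarrow> nat list \<Rightarrow> nat option" where
  "trans_word A q [] = Some q"
| "trans_word A q (a # u) = Option.bind (trans A q a) (\<lambda>q'. trans_word A q' u)"

definition language :: "nat \<Rightarrow> dfa \<Rightarrow> nat list set" where
  "language b A = {u \<in> lists {..<b}. \<exists>q\<in>final A. trans_word A (initial A) u = Some q}"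

definition accepts_set :: "nat \<Rightarrow> dfa \<Rightarrow> nat set \<Rightarrow> bool" where
  "accepts_set b A S \<longleftrightarrow> language b A = {u \<in> lists {..<b}. word_value b u \<in> S}"


section \<open>Unit-cost random access machines\<close>

text \<open>
  This is the machine of Cook and Reckhow with registers holding natural numbers, so that \<open>Sub\<close>
  truncates at \<open>0\<close>. There is no multiplication or division.
\<close>

datatype instr =
    Const nat nat
  | Add nat nat nat
  | Sub nat nat nat
  | Load nat nat
  | Store nat nat
  | Read nat
  | Jump_pos nat nat

text \<open>A configuration consists of program counter, registers and the unread part of the input.\<close>

type_synonym config = "nat \<times> (nat \<Rightarrow> nat) \<times> nat list"

fun exec :: "instr \<Rightarrow> config \<Rightarrow> config" where
  "exec (Const i c) (pc, X, xs) = (Suc pc, X(i := c), xs)"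
| "exec (Add i j k) (pc, X, xs) = (Suc pc, X(i := X j + X k), xs)"
| "exec (Sub i j k) (pc, X, xs) = (Suc pc, X(i := X j - X k), xs)"
| "exec (Load i j) (pc, X, xs) = (Suc pc, X(i := X (X j)), xs)"
| "exec (Store i j) (pc, X, xs) = (Suc pc, X(X i := X j), xs)"
| "exec (Read i) (pc, X, xs) = (Suc pc, X(i := (case xs of [] \<Rightarrow> 0 | x # _ \<Rightarrow> x)), tl xs)"
| "exec (Jump_pos j m) (pc, X, xs) = ((if X j > 0 then m else Suc pc), X, xs)"

definition step :: "instr list \<Rightarrow> config \<Rightarrow> config" where
  "step P c = (if fst c < length P then exec (P ! fst c) c else c)"

text \<open>
  A program halts by leaving its range of instructions; its result is then in register \<open>0\<close>.
  All registers are \<open>0\<close> at the start. Every instruction takes one unit of time.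
\<close>

definition outputs_within :: "instr list \<Rightarrow> nat list \<Rightarrow> real \<Rightarrow> nat \<Rightarrow> bool" where
  "outputs_within P xs T y \<longleftrightarrow>
     (\<exists>t pc X ys. real t \<le> T \<and> (step P ^^ t) (0, \<lambda>_. 0, xs) = (pc, X, ys) \<and>
        pc \<ge> length P \<and> X 0 = y)"

text \<open>
  An automaton is presented by its numbers of letters and of states, the initial state, the
  transition table state by state, and the characteristic sequence of the final states.
  The number of states stands for a missing transition.
\<close>

definition encode_dfa :: "nat \<Rightarrow> dfa \<Rightarrow> nat list" where
  "encode_dfa b A =
     [b, nstates A, initial A] @
     concat (map (\<lambda>q. map (\<lambda>a. case trans A q a of None \<Rightarrow> nstates A | Some q' \<Rightarrow> q') [0..<b])
       [0..<nstates A]) @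
     map (\<lambda>q. if q \<in> final A then 1 else 0) [0..<nstates A]"

end

theory Submission
  imports Defs
begin

text \<open>
  The automaton is completed, and a set is accepted by value iff reading a zero does not change
  acceptance at the reachable states. Every state \<open>q\<close> then stands for a set of numbers, and an
  ultimately periodic set makes the sets at the states reached by arbitrarily long words periodic
  from \<open>1\<close> on, with a common period that is coprime to \<open>b\<close>. Correcting these sets at \<open>0\<close> makes them
  purely periodic, and on such sets \<open>S \<mapsto> {m. b * m + a \<in> S}\<close> is injective. Hence the identifications
  \<open>q \<sim> q' \<Longleftrightarrow> q a \<sim> q' a\<close> are forced in both directions, also after the addition of states for the
  translated sets \<open>{m. m + 1 \<in> S}\<close>. Conversely, if this two-sided closure identifies no accepting
  with a rejecting state among those where a number has just been completed, then the letters act as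
  permutations on the finitely many classes, so each class of an added state also contains an original
  one: finitely many sets are closed under translation, which makes them ultimately periodic.

  So no minimisation is needed. The states reached by arbitrarily long words are found by repeatedly
  removing states without incoming edges, and the closure takes \<open>O(b * n)\<close> operations of a union-find
  structure that links by size, each in time \<open>O(log n)\<close>.
\<close>

section \<open>A structured language compiled to the random access machine\<close>

text \<open>Reading a digit \<open>a\<close> replaces a set \<open>S\<close> by
  \<open>{m. b * m + a \<in> S}\<close>. If the period is coprime to \<open>b\<close>, then
  \<open>m\<close> to \<open>b * m + a\<close> is a bijection on residues, whence the injectivity.
  What obstructs it is membership of 0, which stays arbitrary at recurrent states. So classes cannot
  be split by acceptance as in a minimisation: the closure only merges, and acceptance is compared
  once, after nonzero digits, where corrected and actual sets agree at 0.

  Two-sided compatibility on the original states does not relate \<open>m\<close> to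
  \<open>m + 1\<close>. Adding 1 causes a carry exactly at the digit \<open>b - 1\<close>, so the
  translated sets form an automaton with just as many further states.

  One stored predecessor per class and letter suffices, since any two are forced to be equivalent. A
  merge adds at most \<open>2 * b\<close> pairs and removes a root, which bounds the number of pairs
  by \<open>O(b * n)\<close>; only the search for roots costs a logarithm. The machine has neither
  multiplication nor an unconditional jump, which dictates the memory layout and the table
  \<open>rowA\<close> of multiples of \<open>b\<close>.\<close>

datatype binop = Plus_op | Minus_op

datatype exp = Num nat | Arr nat exp | Bin binop exp exp

abbreviation Plus :: "exp \<Rightarrow> exp \<Rightarrow> exp" where
  "Plus \<equiv> Bin Plus_op"

abbreviation Minus :: "exp \<Rightarrow> exp \<Rightarrow> exp" where
  "Minus \<equiv> Bin Minus_op"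

datatype com =
    Skip
  | Put nat exp exp
  | Get nat exp
  | Seq com com (infixr ";;" 60)
  | Cond exp com com
  | Loop exp com

text \<open>
  The memory is a family of infinite arrays; a scalar variable is an array of which only the entry
  at index \<open>0\<close> is used. Entry \<open>i\<close> of array \<open>j < 63\<close> is kept in register \<open>64 * i + j\<close>, and the
  registers \<open>64 * d + 63\<close> form the evaluation stack.
\<close>

type_synonym mem = "nat \<Rightarrow> nat \<Rightarrow> nat"

primrec op_val :: "binop \<Rightarrow> nat \<Rightarrow> nat \<Rightarrow> nat" where
  "op_val Plus_op = (+)"
| "op_val Minus_op = (-)"

primrec op_instr :: "binop \<Rightarrow> nat \<Rightarrow> nat \<Rightarrow> nat \<Rightarrow> instr" where
  "op_instr Plus_op = Add"
| "op_instr Minus_op = Sub"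

primrec aval :: "mem \<Rightarrow> exp \<Rightarrow> nat" where
  "aval M (Num c) = c"
| "aval M (Arr j e) = M j (aval M e)"
| "aval M (Bin op e f) = op_val op (aval M e) (aval M f)"

definition upd :: "mem \<Rightarrow> nat \<Rightarrow> nat \<Rightarrow> nat \<Rightarrow> mem" where
  "upd M j i x = M(j := (M j)(i := x))"

definition next_input :: "nat list \<Rightarrow> nat" where
  "next_input xs = (case xs of [] \<Rightarrow> 0 | x # _ \<Rightarrow> x)"

inductive big :: "com \<Rightarrow> mem \<Rightarrow> nat list \<Rightarrow> nat \<Rightarrow> mem \<Rightarrow> nat list \<Rightarrow> bool" where
  Skip: "big Skip M xs 0 M xs"
| Put: "big (Put j e f) M xs 1 (upd M j (aval M e) (aval M f)) xs"
| Get: "big (Get j e) M xs 1 (upd M j (aval M e) (next_input xs)) (tl xs)"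
| Seq: "big c M xs k M' xs' \<Longrightarrow> big d M' xs' l M'' xs'' \<Longrightarrow> big (c ;; d) M xs (k + l) M'' xs''"
| Cond_pos: "aval M e > 0 \<Longrightarrow> big c M xs k M' xs' \<Longrightarrow> big (Cond e c d) M xs (Suc k) M' xs'"
| Cond_zero: "aval M e = 0 \<Longrightarrow> big d M xs k M' xs' \<Longrightarrow> big (Cond e c d) M xs (Suc k) M' xs'"
| Loop_zero: "aval M e = 0 \<Longrightarrow> big (Loop e c) M xs 1 M xs"
| Loop_pos: "aval M e > 0 \<Longrightarrow> big c M xs k M' xs' \<Longrightarrow> big (Loop e c) M' xs' l M'' xs'' \<Longrightarrow>
    big (Loop e c) M xs (Suc (k + l)) M'' xs''"

inductive_cases big_SkipE: "big Skip M xs k M' xs'"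
inductive_cases big_PutE: "big (Put j e f) M xs k M' xs'"
inductive_cases big_GetE: "big (Get j e) M xs k M' xs'"
inductive_cases big_SeqE: "big (c ;; d) M xs k M' xs'"
inductive_cases big_CondE: "big (Cond e c d) M xs k M' xs'"

definition tmp :: "nat \<Rightarrow> nat" where
  "tmp d = 64 * d + 63"

text \<open>Six doublings multiply the index by 64 without a multiplication instruction, which is
  why the arrays are interleaved with a power of two as stride. The cell \<open>tmp (Suc d)\<close>
  above the index is free as scratch space.\<close>

definition locate :: "nat \<Rightarrow> nat \<Rightarrow> instr list" where
  "locate j d = (let D = Add (tmp d) (tmp d) (tmp d) in
     [D, D, D, D, D, D, Const (tmp (Suc d)) j, Add (tmp d) (tmp d) (tmp (Suc d))])"

primrec exp_code :: "exp \<Rightarrow> nat \<Rightarrow> instr list" where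
  "exp_code (Num c) d = [Const (tmp d) c]"
| "exp_code (Arr j e) d = exp_code e d @ locate j d @ [Load (tmp d) (tmp d)]"
| "exp_code (Bin op e f) d =
     exp_code e d @ exp_code f (Suc d) @ [op_instr op (tmp d) (tmp d) (tmp (Suc d))]"

text \<open>Jump targets are absolute, so the code depends on its start address \<open>p\<close>. An
  unconditional jump is a \<open>Jump_pos\<close> on a stack cell that was just set to 1.\<close>

primrec com_code :: "com \<Rightarrow> nat \<Rightarrow> instr list" where
  "com_code Skip p = []"
| "com_code (Put j e f) p =
     exp_code e 0 @ locate j 0 @ exp_code f 1 @ [Store (tmp 0) (tmp 1)]"
| "com_code (Get j e) p = exp_code e 0 @ locate j 0 @ [Read (tmp 1), Store (tmp 0) (tmp 1)]"
| "com_code (c ;; d) p = (let C = com_code c p in C @ com_code d (p + length C))"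
| "com_code (Cond e c d) p =
     (let E = exp_code e 0; D = com_code d (Suc (p + length E));
          q = Suc (Suc (Suc (p + length E + length D))); C = com_code c q
      in E @ [Jump_pos (tmp 0) q] @ D @ [Const (tmp 0) 1, Jump_pos (tmp 0) (q + length C)] @ C)"
| "com_code (Loop e c) p =
     (let E = exp_code e 0; q = Suc (Suc (Suc (p + length E))); C = com_code c q
      in E @ [Jump_pos (tmp 0) q, Const (tmp 0) 1, Jump_pos (tmp 0) (Suc (Suc (q + length C)))] @ C @
         [Const (tmp 0) 1, Jump_pos (tmp 0) p])"

primrec wf_exp :: "exp \<Rightarrow> bool" where
  "wf_exp (Num c) = True"
| "wf_exp (Arr j e) = (j < 63 \<and> wf_exp e)"
| "wf_exp (Bin op e f) = (wf_exp e \<and> wf_exp f)"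

primrec wf_com :: "com \<Rightarrow> bool" where
  "wf_com Skip = True"
| "wf_com (Put j e f) = (j < 63 \<and> wf_exp e \<and> wf_exp f)"
| "wf_com (Get j e) = (j < 63 \<and> wf_exp e)"
| "wf_com (c ;; d) = (wf_com c \<and> wf_com d)"
| "wf_com (Cond e c d) = (wf_exp e \<and> wf_com c \<and> wf_com d)"
| "wf_com (Loop e c) = (wf_exp e \<and> wf_com c)"

text \<open>Bounds the machine steps per time unit of \<open>big\<close>. It depends on the program
  text only and so disappears in the constant of the final bound. The 3 covers the conditional jump
  and the two instructions of an unconditional one.\<close>

primrec tick_cost :: "com \<Rightarrow> nat" where
  "tick_cost Skip = 0"
| "tick_cost (Put j e f) = length (com_code (Put j e f) 0)"
| "tick_cost (Get j e) = length (com_code (Get j e) 0)"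
| "tick_cost (c ;; d) = max (tick_cost c) (tick_cost d)"
| "tick_cost (Cond e c d) = max (length (exp_code e 0) + 3) (max (tick_cost c) (tick_cost d))"
| "tick_cost (Loop e c) = max (length (exp_code e 0) + 3) (tick_cost c)"

section \<open>Simulation of the structured language by machine code\<close>

definition represents :: "(nat \<Rightarrow> nat) \<Rightarrow> mem \<Rightarrow> bool" where
  "represents X M \<longleftrightarrow> (\<forall>j<63. \<forall>i. X (64 * i + j) = M j i)"

definition code_at :: "instr list \<Rightarrow> nat \<Rightarrow> instr list \<Rightarrow> bool" where
  "code_at P p C \<longleftrightarrow> (\<forall>i<length C. p + i < length P \<and> P ! (p + i) = C ! i)"

lemma code_at_Nil [simp]: "code_at P p []"
  by (simp add: code_at_def)

lemma code_at_Cons [simp]: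
  "code_at P p (i # C) \<longleftrightarrow> p < length P \<and> P ! p = i \<and> code_at P (Suc p) C"
  unfolding code_at_def by (auto simp: less_Suc_eq_0_disj)

lemma code_at_append [simp]:
  "code_at P p (C @ D) \<longleftrightarrow> code_at P p C \<and> code_at P (p + length C) D"
  by (induction C arbitrary: p) auto

lemma code_at_self: "code_at P 0 P"
  by (simp add: code_at_def)

definition goes :: "instr list \<Rightarrow> config \<Rightarrow> nat \<Rightarrow> config \<Rightarrow> bool" where
  "goes P c l c' \<longleftrightarrow> (step P ^^ l) c = c'"

lemma goes_0 [simp]: "goes P c 0 c' \<longleftrightarrow> c = c'"
  by (simp add: goes_def)

lemma goes_Suc: "goes P c (Suc l) c' \<longleftrightarrow> goes P (step P c) l c'"
  by (simp add: goes_def funpow_Suc_right del: funpow.simps)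

lemma goes_trans: "goes P c l c' \<Longrightarrow> goes P c' m c'' \<Longrightarrow> goes P c (l + m) c''"
  by (simp add: goes_def funpow_add add.commute[of l])

lemma step_at: "p < length P \<Longrightarrow> step P (p, X, xs) = exec (P ! p) (p, X, xs)"
  by (simp add: step_def)

lemma tmp_eq_iff [simp]: "tmp d = tmp d' \<longleftrightarrow> d = d'"
  by (simp add: tmp_def)

lemma address_neq_tmp: "j < 63 \<Longrightarrow> 64 * i + j \<noteq> tmp d"
  unfolding tmp_def by presburger

lemma address_eq_iff:
  fixes i i' j j' :: nat
  assumes "j < 63" "j' < 63"
  shows "64 * i + j = 64 * i' + j' \<longleftrightarrow> i = i' \<and> j = j'"
proof
  assume eq: "64 * i + j = 64 * i' + j'"
  have "i = (64 * i + j) div 64" "i' = (64 * i' + j') div 64"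
    using assms by simp_all
  with eq show "i = i' \<and> j = j'"
    by simp
qed simp

lemma represents_tmp [simp]: "represents (X(tmp d := x)) M \<longleftrightarrow> represents X M"
  by (simp add: represents_def address_neq_tmp)

lemma represents_upd:
  "represents X M \<Longrightarrow> j < 63 \<Longrightarrow> represents (X(64 * i + j := x)) (upd M j i x)"
  by (auto simp: represents_def upd_def address_eq_iff)

lemma length_locate [simp]: "length (locate j d) = 8"
  by (simp add: locate_def Let_def)

lemma goes_locate:
  assumes "code_at P p (locate j d)"
  shows "\<exists>x. goes P (p, X, xs) 8 (p + 8, X(tmp d := 64 * X (tmp d) + j, tmp (Suc d) := x), xs)"
proof -
  have "goes P (p, X, xs) (Suc (Suc (Suc (Suc (Suc (Suc (Suc (Suc 0))))))))
     (p + 8, X(tmp d := 64 * X (tmp d) + j, tmp (Suc d) := j), xs)"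
    using assms
    by (simp add: locate_def Let_def goes_Suc step_at fun_upd_twist mult_2[symmetric]
        mult.assoc[symmetric])
  then show ?thesis
    by (auto simp: numeral_eq_Suc)
qed

text \<open>That the stack cells below \<open>d\<close> survive is needed for binary operators: the
  first operand waits there while the second one is evaluated.\<close>

lemma goes_exp:
  "code_at P p (exp_code e d) \<Longrightarrow> wf_exp e \<Longrightarrow> represents X M \<Longrightarrow>
    \<exists>X'. goes P (p, X, xs) (length (exp_code e d)) (p + length (exp_code e d), X', xs) \<and>
      represents X' M \<and> X' (tmp d) = aval M e \<and> (\<forall>d'<d. X' (tmp d') = X (tmp d'))"
proof (induction e arbitrary: p d X)
  case (Num c)
  let ?X = "X(tmp d := c)"
  have "goes P (p, X, xs) (length (exp_code (Num c) d)) (p + length (exp_code (Num c) d), ?X, xs)"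
    using Num by (simp add: goes_Suc step_at)
  moreover have "represents ?X M" "?X (tmp d) = aval M (Num c)" "\<forall>d'<d. ?X (tmp d') = X (tmp d')"
    using Num by auto
  ultimately show ?case by blast
next
  case (Arr j e)
  let ?l = "length (exp_code e d)"
  obtain X1 where 1: "goes P (p, X, xs) ?l (p + ?l, X1, xs)" "represents X1 M"
     "X1 (tmp d) = aval M e" "\<forall>d'<d. X1 (tmp d') = X (tmp d')"
    using Arr.IH[of p d X] Arr.prems by auto
  obtain x where 2: "goes P (p + ?l, X1, xs) 8
      (p + ?l + 8, X1(tmp d := 64 * X1 (tmp d) + j, tmp (Suc d) := x), xs)"
    using goes_locate[of P "p + ?l" j d X1 xs] Arr.prems by auto
  let ?X2 = "X1(tmp d := 64 * X1 (tmp d) + j, tmp (Suc d) := x)"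
  let ?X3 = "?X2(tmp d := ?X2 (?X2 (tmp d)))"
  have 3: "goes P (p + ?l + 8, ?X2, xs) 1 (Suc (p + ?l + 8), ?X3, xs)"
    using Arr.prems by (simp add: goes_Suc step_at)
  have X2: "?X2 (?X2 (tmp d)) = M j (aval M e)"
    using 1 Arr.prems by (auto simp: address_neq_tmp represents_def)
  then have "represents ?X3 M" "?X3 (tmp d) = aval M (Arr j e)" "\<forall>d'<d. ?X3 (tmp d') = X (tmp d')"
    using 1 by auto
  moreover have "goes P (p, X, xs) (length (exp_code (Arr j e) d))
      (p + length (exp_code (Arr j e) d), ?X3, xs)"
    using goes_trans[OF goes_trans[OF 1(1) 2] 3[unfolded X2]] unfolding X2 by (simp add: ac_simps)
  ultimately show ?case by blast
next
  case (Bin op e f)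
  let ?l = "length (exp_code e d)"
  let ?m = "length (exp_code f (Suc d))"
  obtain X1 where 1: "goes P (p, X, xs) ?l (p + ?l, X1, xs)" "represents X1 M"
     "X1 (tmp d) = aval M e" "\<forall>d'<d. X1 (tmp d') = X (tmp d')"
    using Bin.IH(1)[of p d X] Bin.prems by auto
  obtain X2 where 2: "goes P (p + ?l, X1, xs) ?m (p + ?l + ?m, X2, xs)" "represents X2 M"
     "X2 (tmp (Suc d)) = aval M f" "\<forall>d'<Suc d. X2 (tmp d') = X1 (tmp d')"
    using Bin.IH(2)[of "p + ?l" "Suc d" X1] Bin.prems 1 by auto
  let ?X3 = "X2(tmp d := op_val op (X2 (tmp d)) (X2 (tmp (Suc d))))"
  have 3: "goes P (p + ?l + ?m, X2, xs) 1 (Suc (p + ?l + ?m), ?X3, xs)"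
    using Bin.prems by (cases op) (simp_all add: goes_Suc step_at add.assoc)
  have "represents ?X3 M" "?X3 (tmp d) = aval M (Bin op e f)" "\<forall>d'<d. ?X3 (tmp d') = X (tmp d')"
    using 1 2 by auto
  moreover have "goes P (p, X, xs) (length (exp_code (Bin op e f) d))
      (p + length (exp_code (Bin op e f) d), ?X3, xs)"
    using goes_trans[OF goes_trans[OF 1(1) 2(1)] 3] by (simp add: add.assoc)
  ultimately show ?case by blast
qed

lemma goes_com:
  "big c M xs k M' xs' \<Longrightarrow> code_at P p (com_code c p) \<Longrightarrow> wf_com c \<Longrightarrow> represents X M \<Longrightarrow>
   tick_cost c \<le> K \<Longrightarrow>
   \<exists>l X'. l \<le> K * k \<and> goes P (p, X, xs) l (p + length (com_code c p), X', xs') \<and> represents X' M'"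
proof (induction arbitrary: p X rule: big.induct)
  case (Skip M xs)
  then show ?case by (intro exI[of _ 0]) auto
next
  case (Put j e f M xs)
  let ?l = "length (exp_code e 0)"
  let ?m = "length (exp_code f 1)"
  have code: "code_at P p (exp_code e 0)" "code_at P (p + ?l) (locate j 0)"
      "code_at P (p + ?l + 8) (exp_code f 1)" "code_at P (p + ?l + 8 + ?m) [Store (tmp 0) (tmp 1)]"
    and wf: "j < 63" "wf_exp e" "wf_exp f"
    using Put.prems by (simp_all add: add.assoc)
  obtain X1 where 1: "goes P (p, X, xs) ?l (p + ?l, X1, xs)" "represents X1 M"
     "X1 (tmp 0) = aval M e"
    using goes_exp[OF code(1) wf(2) Put.prems(3)] by blast
  obtain x where 2: "goes P (p + ?l, X1, xs) 8
      (p + ?l + 8, X1(tmp 0 := 64 * X1 (tmp 0) + j, tmp (Suc 0) := x), xs)"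
    using goes_locate[OF code(2)] by blast
  define X2 where "X2 = X1(tmp 0 := 64 * X1 (tmp 0) + j, tmp (Suc 0) := x)"
  have X2: "represents X2 M" "X2 (tmp 0) = 64 * aval M e + j"
    using 1 by (simp_all add: X2_def)
  obtain X3 where 3: "goes P (p + ?l + 8, X2, xs) ?m (p + ?l + 8 + ?m, X3, xs)"
     "represents X3 M" "X3 (tmp 1) = aval M f" "X3 (tmp 0) = X2 (tmp 0)"
    using goes_exp[OF code(3) wf(3) X2(1), of xs] zero_less_one by blast
  define X4 where "X4 = X3(64 * aval M e + j := aval M f)"
  have 4: "goes P (p + ?l + 8 + ?m, X3, xs) 1 (Suc (p + ?l + 8 + ?m), X4, xs)"
    using code(4) unfolding X4_def One_nat_def goes_Suc goes_0
    by (simp add: step_at X2(2) 3(3,4)[unfolded One_nat_def])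
  have "represents X4 (upd M j (aval M e) (aval M f))"
    unfolding X4_def by (rule represents_upd) (use 3 wf in auto)
  moreover have "?l + 8 + ?m + 1 \<le> K * 1"
    using Put.prems by simp
  moreover have "goes P (p, X, xs) (?l + 8 + ?m + 1) (p + length (com_code (Put j e f) p), X4, xs)"
    using goes_trans[OF goes_trans[OF goes_trans[OF 1(1) 2[folded X2_def]] 3(1)] 4]
    by (simp add: ac_simps)
  ultimately show ?case by blast
next
  case (Get j e M xs)
  let ?l = "length (exp_code e 0)"
  have code: "code_at P p (exp_code e 0)" "code_at P (p + ?l) (locate j 0)"
      "code_at P (p + ?l + 8) [Read (tmp 1), Store (tmp 0) (tmp 1)]"
    and wf: "j < 63" "wf_exp e"
    using Get.prems by (simp_all add: add.assoc)
  obtain X1 where 1: "goes P (p, X, xs) ?l (p + ?l, X1, xs)" "represents X1 M"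
     "X1 (tmp 0) = aval M e"
    using goes_exp[OF code(1) wf(2) Get.prems(3)] by blast
  obtain x where 2: "goes P (p + ?l, X1, xs) 8
      (p + ?l + 8, X1(tmp 0 := 64 * X1 (tmp 0) + j, tmp (Suc 0) := x), xs)"
    using goes_locate[OF code(2)] by blast
  define X2 where "X2 = X1(tmp 0 := 64 * X1 (tmp 0) + j, tmp (Suc 0) := x)"
  have X2: "represents X2 M" "X2 (tmp 0) = 64 * aval M e + j"
    using 1 by (simp_all add: X2_def)
  define X4 where "X4 = X2(tmp 1 := next_input xs, 64 * aval M e + j := next_input xs)"
  have 4: "goes P (p + ?l + 8, X2, xs) 2 (Suc (Suc (p + ?l + 8)), X4, tl xs)"
    using code(3) X2 by (simp add: numeral_2_eq_2 goes_Suc step_at next_input_def X4_def)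
  have "represents X4 (upd M j (aval M e) (next_input xs))"
    unfolding X4_def by (rule represents_upd) (use X2 wf in auto)
  moreover have "?l + 8 + 2 \<le> K * 1"
    using Get.prems by simp
  moreover have "goes P (p, X, xs) (?l + 8 + 2) (p + length (com_code (Get j e) p), X4, tl xs)"
    using goes_trans[OF goes_trans[OF 1(1) 2[folded X2_def]] 4] by (simp add: ac_simps)
  ultimately show ?case by blast
next
  case (Seq c M xs k M' xs' d l M'' xs'')
  let ?p = "p + length (com_code c p)"
  obtain l1 X1 where 1: "l1 \<le> K * k" "goes P (p, X, xs) l1 (?p, X1, xs')" "represents X1 M'"
    using Seq.IH(1)[of p X] Seq.prems by (auto simp: Let_def)
  obtain l2 X2 where 2: "l2 \<le> K * l" "goes P (?p, X1, xs') l2 (?p + length (com_code d ?p), X2, xs'')"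
      "represents X2 M''"
    using Seq.IH(2)[of ?p X1] Seq.prems 1 by (auto simp: Let_def)
  have "l1 + l2 \<le> K * (k + l)"
    using 1 2 by (simp add: algebra_simps)
  moreover have "goes P (p, X, xs) (l1 + l2) (p + length (com_code (c ;; d) p), X2, xs'')"
    using goes_trans[OF 1(2) 2(2)] by (simp add: Let_def add.assoc)
  ultimately show ?case using 2 by blast
next
  case (Cond_pos M e c xs k M' xs' d)
  let ?l = "length (exp_code e 0)"
  define m where "m = length (com_code d (Suc (p + ?l)))"
  define q where "q = Suc (Suc (Suc (p + ?l + m)))"
  have code: "code_at P p (exp_code e 0)" "p + ?l < length P" "P ! (p + ?l) = Jump_pos (tmp 0) q"
      "code_at P q (com_code c q)"
    and wf: "wf_exp e" "wf_com c" "tick_cost c \<le> K" "?l + 3 \<le> K"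
    using Cond_pos.prems by (simp_all add: Let_def m_def q_def)
  obtain X1 where 1: "goes P (p, X, xs) ?l (p + ?l, X1, xs)" "represents X1 M"
     "X1 (tmp 0) = aval M e"
    using goes_exp[OF code(1) wf(1) Cond_pos.prems(3)] by blast
  have 2: "goes P (p + ?l, X1, xs) 1 (q, X1, xs)"
    using code(2,3) Cond_pos.hyps(1) 1(3) by (simp add: goes_Suc step_at)
  obtain l X' where 3: "l \<le> K * k" "goes P (q, X1, xs) l (q + length (com_code c q), X', xs')"
     "represents X' M'"
    using Cond_pos.IH[OF code(4) wf(2) 1(2) wf(3)] by blast
  have "p + length (com_code (Cond e c d) p) = q + length (com_code c q)"
    by (simp add: Let_def m_def q_def)
  moreover have "?l + 1 + l \<le> K * Suc k"
    using 3(1) wf(4) by simp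
  ultimately show ?case
    using goes_trans[OF goes_trans[OF 1(1) 2] 3(2)] 3(3) by metis
next
  case (Cond_zero M e d xs k M' xs' c)
  let ?l = "length (exp_code e 0)"
  let ?p = "Suc (p + ?l)"
  define m where "m = length (com_code d ?p)"
  define q where "q = Suc (Suc (Suc (p + ?l + m)))"
  define r where "r = q + length (com_code c q)"
  have code: "code_at P p (exp_code e 0)" "p + ?l < length P" "P ! (p + ?l) = Jump_pos (tmp 0) q"
      "code_at P ?p (com_code d ?p)"
      "code_at P (?p + m) [Const (tmp 0) 1, Jump_pos (tmp 0) r]"
    and wf: "wf_exp e" "wf_com d" "tick_cost d \<le> K" "?l + 3 \<le> K"
    using Cond_zero.prems by (simp_all add: Let_def m_def q_def r_def)
  obtain X1 where 1: "goes P (p, X, xs) ?l (p + ?l, X1, xs)" "represents X1 M"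
     "X1 (tmp 0) = aval M e"
    using goes_exp[OF code(1) wf(1) Cond_zero.prems(3)] by blast
  have 2: "goes P (p + ?l, X1, xs) 1 (?p, X1, xs)"
    using code(2,3) Cond_zero.hyps(1) 1(3) by (simp add: goes_Suc step_at)
  obtain l X' where 3: "l \<le> K * k" "goes P (?p, X1, xs) l (?p + m, X', xs')"
     "represents X' M'"
    using Cond_zero.IH[OF code(4) wf(2) 1(2) wf(3)] unfolding m_def by blast
  have 4: "goes P (?p + m, X', xs') 2 (r, X'(tmp 0 := 1), xs')"
    using code(5) by (simp add: numeral_2_eq_2 goes_Suc step_at)
  have "p + length (com_code (Cond e c d) p) = r"
    by (simp add: Let_def m_def q_def r_def)
  moreover have "?l + 1 + l + 2 \<le> K * Suc k"
    using 3(1) wf(4) by simp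
  ultimately show ?case
    using goes_trans[OF goes_trans[OF goes_trans[OF 1(1) 2] 3(2)] 4] 3(3) represents_tmp[of X'] by metis
next
  case (Loop_zero M e c xs)
  let ?l = "length (exp_code e 0)"
  define q where "q = Suc (Suc (Suc (p + ?l)))"
  define r where "r = Suc (Suc (q + length (com_code c q)))"
  have code: "code_at P p (exp_code e 0)"
      "code_at P (p + ?l) [Jump_pos (tmp 0) q, Const (tmp 0) 1, Jump_pos (tmp 0) r]"
    and wf: "wf_exp e" "?l + 3 \<le> K"
    using Loop_zero.prems by (simp_all add: Let_def q_def r_def)
  obtain X1 where 1: "goes P (p, X, xs) ?l (p + ?l, X1, xs)" "represents X1 M"
     "X1 (tmp 0) = aval M e"
    using goes_exp[OF code(1) wf(1) Loop_zero.prems(3)] by blast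
  have 2: "goes P (p + ?l, X1, xs) 3 (r, X1(tmp 0 := 1), xs)"
    using code(2) Loop_zero.hyps 1(3) by (simp add: numeral_3_eq_3 goes_Suc step_at)
  have "p + length (com_code (Loop e c) p) = r"
    by (simp add: Let_def q_def r_def)
  moreover have "?l + 3 \<le> K * 1"
    using wf(2) by simp
  moreover have "represents (X1(tmp 0 := 1)) M"
    using 1(2) by simp
  ultimately show ?case
    using goes_trans[OF 1(1) 2] by metis
next
  case (Loop_pos M e c xs k M' xs' l M'' xs'')
  let ?l = "length (exp_code e 0)"
  define q where "q = Suc (Suc (Suc (p + ?l)))"
  define s where "s = q + length (com_code c q)"
  have code: "code_at P p (exp_code e 0)"
      "p + ?l < length P" "P ! (p + ?l) = Jump_pos (tmp 0) q"
      "code_at P q (com_code c q)"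
      "code_at P s [Const (tmp 0) 1, Jump_pos (tmp 0) p]"
    and wf: "wf_exp e" "wf_com c" "tick_cost c \<le> K" "?l + 3 \<le> K"
    using Loop_pos.prems by (simp_all add: Let_def q_def s_def)
  obtain X1 where 1: "goes P (p, X, xs) ?l (p + ?l, X1, xs)" "represents X1 M"
     "X1 (tmp 0) = aval M e"
    using goes_exp[OF code(1) wf(1) Loop_pos.prems(3)] by blast
  have 2: "goes P (p + ?l, X1, xs) 1 (q, X1, xs)"
    using code(2,3) Loop_pos.hyps(1) 1(3) by (simp add: goes_Suc step_at)
  obtain l1 X2 where 3: "l1 \<le> K * k" "goes P (q, X1, xs) l1 (s, X2, xs')" "represents X2 M'"
    using Loop_pos.IH(1)[OF code(4) wf(2) 1(2) wf(3)] unfolding s_def by blast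
  have 4: "goes P (s, X2, xs') 2 (p, X2(tmp 0 := 1), xs')"
    using code(5) by (simp add: numeral_2_eq_2 goes_Suc step_at)
  obtain l2 X3 where 5: "l2 \<le> K * l"
      "goes P (p, X2(tmp 0 := 1), xs') l2 (p + length (com_code (Loop e c) p), X3, xs'')"
      "represents X3 M''"
    using Loop_pos.IH(2)[OF Loop_pos.prems(1,2) _ Loop_pos.prems(4), of "X2(tmp 0 := 1)"] 3(3)
      represents_tmp[of X2] by blast
  have "?l + 1 + l1 + 2 + l2 \<le> K * Suc (k + l)"
    using 3(1) 5(1) wf(4) by (simp add: algebra_simps)
  then show ?case
    using goes_trans[OF goes_trans[OF goes_trans[OF goes_trans[OF 1(1) 2] 3(2)] 4] 5(2)] 5(3)
    by blast
qed

lemma outputs_within_com_code: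
  assumes "big c (\<lambda>_ _. 0) xs k M' xs'" "wf_com c" "real (tick_cost c * k) \<le> T" "M' 0 0 = y"
  shows "outputs_within (com_code c 0) xs T y"
proof -
  obtain l X' where 1: "l \<le> tick_cost c * k"
    "goes (com_code c 0) (0, \<lambda>_. 0, xs) l (length (com_code c 0), X', xs')" "represents X' M'"
    using goes_com[OF assms(1) code_at_self assms(2), of "\<lambda>_. 0" "tick_cost c"]
    by (auto simp: represents_def)
  \<comment> \<open>Register 0 is entry 0 of array 0, so this is where the program must leave its
    verdict.\<close>
  have "X' (64 * 0 + 0) = M' 0 0"
    using 1(3) unfolding represents_def by (meson zero_less_numeral)
  then have "X' 0 = y"
    using assms(4) by simp
  moreover have "real l \<le> T"
    using 1(1) assms(3) by linarith
  ultimately show ?thesis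
    using 1(2) unfolding outputs_within_def goes_def by auto
qed

section \<open>Weakest preconditions with time credits\<close>

abbreviation Var :: "nat \<Rightarrow> exp" where
  "Var v \<equiv> Arr v (Num 0)"

abbreviation Assign :: "nat \<Rightarrow> exp \<Rightarrow> com" (infix "::=" 65) where
  "v ::= e \<equiv> Put v (Num 0) e"

text \<open>Truncated subtraction turns the guard into the comparison of \<open>v\<close> with
  \<open>e\<close>.\<close>

definition For :: "nat \<Rightarrow> exp \<Rightarrow> com \<Rightarrow> com" where
  "For v e c = (v ::= Num 0 ;; Loop (Minus e (Var v)) (c ;; v ::= Plus (Var v) (Num 1)))"

primrec writes :: "com \<Rightarrow> nat set" where
  "writes Skip = {}"
| "writes (Put j e f) = {j}"
| "writes (Get j e) = {j}"
| "writes (c ;; d) = writes c \<union> writes d"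
| "writes (Cond e c d) = writes c \<union> writes d"
| "writes (Loop e c) = writes c"

abbreviation unchanged :: "nat set \<Rightarrow> mem \<Rightarrow> mem \<Rightarrow> bool" where
  "unchanged W M M' \<equiv> \<forall>j. j \<notin> W \<longrightarrow> M' j = M j"

text \<open>The third argument of the postcondition is the number of time units that are left.\<close>

definition wp :: "com \<Rightarrow> (mem \<Rightarrow> nat list \<Rightarrow> nat \<Rightarrow> bool) \<Rightarrow> mem \<Rightarrow> nat list \<Rightarrow> nat \<Rightarrow> bool" where
  "wp c Q M xs T \<longleftrightarrow> (\<exists>k M' xs'. big c M xs k M' xs' \<and> k \<le> T \<and> Q M' xs' (T - k))"

lemma upd_same [simp]: "upd M j i x j = (M j)(i := x)"
  by (simp add: upd_def)

lemma upd_other [simp]: "k \<noteq> j \<Longrightarrow> upd M j i x k = M k"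
  by (simp add: upd_def)

lemma writes_For [simp]: "writes (For v e c) = insert v (writes c)"
  by (auto simp: For_def)

lemma big_unchanged: "big c M xs k M' xs' \<Longrightarrow> unchanged (writes c) M M'"
  by (induction rule: big.induct) auto

lemma wp_Skip [simp]: "wp Skip Q M xs T \<longleftrightarrow> Q M xs T"
  unfolding wp_def using big.Skip by (fastforce elim: big_SkipE)

lemma wp_Put [simp]:
  "wp (Put j e f) Q M xs T \<longleftrightarrow> 0 < T \<and> Q (upd M j (aval M e) (aval M f)) xs (T - 1)"
  unfolding wp_def
proof safe
  fix k M' xs' assume "big (Put j e f) M xs k M' xs'" "k \<le> T" "Q M' xs' (T - k)"
  then show "0 < T" "Q (upd M j (aval M e) (aval M f)) xs (T - 1)"
    by (auto elim: big_PutE)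
next
  assume "0 < T" "Q (upd M j (aval M e) (aval M f)) xs (T - 1)"
  then show "\<exists>k M' xs'. big (Put j e f) M xs k M' xs' \<and> k \<le> T \<and> Q M' xs' (T - k)"
    using big.Put[of j e f M xs] by (metis One_nat_def Suc_leI)
qed

lemma wp_Get [simp]:
  "wp (Get j e) Q M xs T \<longleftrightarrow>
     0 < T \<and> Q (upd M j (aval M e) (next_input xs)) (tl xs) (T - 1)"
  unfolding wp_def
proof safe
  fix k M' xs' assume "big (Get j e) M xs k M' xs'" "k \<le> T" "Q M' xs' (T - k)"
  then show "0 < T" "Q (upd M j (aval M e) (next_input xs)) (tl xs) (T - 1)"
    by (auto elim: big_GetE)
next
  assume "0 < T" "Q (upd M j (aval M e) (next_input xs)) (tl xs) (T - 1)"
  then show "\<exists>k M' xs'. big (Get j e) M xs k M' xs' \<and> k \<le> T \<and> Q M' xs' (T - k)"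
    using big.Get[of j e M xs] by (metis One_nat_def Suc_leI)
qed

lemma wp_Seq [simp]: "wp (c ;; d) Q M xs T \<longleftrightarrow> wp c (wp d Q) M xs T"
proof
  assume "wp (c ;; d) Q M xs T"
  then show "wp c (wp d Q) M xs T"
    unfolding wp_def
    by (elim exE conjE big_SeqE) (metis add_le_imp_le_diff add_leD1 diff_diff_left add.commute)
next
  assume "wp c (wp d Q) M xs T"
  then obtain k M' xs' l M'' xs'' where "big c M xs k M' xs'" "k \<le> T"
    "big d M' xs' l M'' xs''" "l \<le> T - k" "Q M'' xs'' (T - k - l)"
    unfolding wp_def by blast
  then have "big (c ;; d) M xs (k + l) M'' xs''" "k + l \<le> T" "Q M'' xs'' (T - (k + l))"
    by (auto intro: big.Seq)
  then show "wp (c ;; d) Q M xs T"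
    unfolding wp_def by blast
qed

lemma wp_Seq_fun: "wp (c ;; d) Q = wp c (wp d Q)"
  by (intro ext) simp

lemma wp_Cond [simp]:
  "wp (Cond e c d) Q M xs T \<longleftrightarrow>
     0 < T \<and> (if 0 < aval M e then wp c Q M xs (T - 1) else wp d Q M xs (T - 1))"
proof
  assume "wp (Cond e c d) Q M xs T"
  then obtain k M' xs' where k: "big (Cond e c d) M xs k M' xs'" "k \<le> T" "Q M' xs' (T - k)"
    unfolding wp_def by blast
  then obtain l where l: "k = Suc l"
      "if 0 < aval M e then big c M xs l M' xs' else big d M xs l M' xs'"
    by (auto elim: big_CondE split: if_splits)
  then have "l \<le> T - 1" "Q M' xs' (T - 1 - l)" "0 < T"
    using k by auto
  then show "0 < T \<and> (if 0 < aval M e then wp c Q M xs (T - 1) else wp d Q M xs (T - 1))"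
    using l(2) unfolding wp_def by (metis (full_types))
next
  assume *: "0 < T \<and> (if 0 < aval M e then wp c Q M xs (T - 1) else wp d Q M xs (T - 1))"
  then obtain k M' xs' where k: "k \<le> T - 1" "Q M' xs' (T - 1 - k)"
      "if 0 < aval M e then big c M xs k M' xs' else big d M xs k M' xs'"
    unfolding wp_def by (auto split: if_splits)
  have "big (Cond e c d) M xs (Suc k) M' xs'"
    using k(3) by (auto intro: big.Cond_pos big.Cond_zero split: if_splits)
  moreover have "Suc k \<le> T" "Q M' xs' (T - Suc k)"
    using * k by auto
  ultimately show "wp (Cond e c d) Q M xs T"
    unfolding wp_def by blast
qed

text \<open>Frame rule. A block is specified with its own budget \<open>K\<close> and without a
  claim about the credits left; placed into a larger budget it leaves at least \<open>T - K\<close>,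
  and arrays it does not write keep their contents.\<close>

lemma wp_weaken:
  assumes "wp c (\<lambda>M xs _. R M xs) M xs K" "K \<le> T"
    and "\<And>M' xs' T'. R M' xs' \<Longrightarrow> unchanged (writes c) M M' \<Longrightarrow> T - K \<le> T' \<Longrightarrow> Q M' xs' T'"
  shows "wp c Q M xs T"
proof -
  obtain k M' xs' where k: "big c M xs k M' xs'" "k \<le> K" "R M' xs'"
    using assms(1) unfolding wp_def by blast
  then have "Q M' xs' (T - k)"
    using assms(3)[OF k(3) big_unchanged[OF k(1)]] assms(2) by simp
  then show ?thesis
    unfolding wp_def using k assms(2) order_trans by blast
qed

lemma wp_mono:
  assumes "wp c R M xs T"
    and "\<And>M' xs' T'. R M' xs' T' \<Longrightarrow> unchanged (writes c) M M' \<Longrightarrow> Q M' xs' T'"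
  shows "wp c Q M xs T"
  using assms big_unchanged unfolding wp_def by blast

text \<open>Forward counterpart of \<open>wp\<close>: it names the memory after a block. Long
  sequences are verified block by block, and \<open>runs_Seq\<close> adds up the budgets.\<close>

definition runs :: "com \<Rightarrow> nat \<Rightarrow> mem \<Rightarrow> nat list \<Rightarrow> mem \<Rightarrow> nat list \<Rightarrow> bool" where
  "runs c K M xs M' xs' \<longleftrightarrow> (\<exists>k\<le>K. big c M xs k M' xs')"

lemma wpE:
  assumes "wp c (\<lambda>M xs _. R M xs) M xs K"
  obtains M' xs' where "runs c K M xs M' xs'" "R M' xs'" "unchanged (writes c) M M'"
  using assms big_unchanged unfolding wp_def runs_def by blast

lemma wpI: "runs c K M xs M' xs' \<Longrightarrow> R M' xs' \<Longrightarrow> wp c (\<lambda>M xs _. R M xs) M xs K"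
  unfolding wp_def runs_def by blast

lemma runs_Seq: "runs c K M xs M' xs' \<Longrightarrow> runs d L M' xs' M'' xs'' \<Longrightarrow> runs (c ;; d) (K + L) M xs M'' xs''"
  unfolding runs_def by (blast intro: big.Seq add_mono)

lemma runs_mono: "runs c K M xs M' xs' \<Longrightarrow> K \<le> L \<Longrightarrow> runs c L M xs M' xs'"
  unfolding runs_def using order_trans by blast

text \<open>The invariant may speak of the remaining credits. Each pass consumes at least one of
  them, so they also serve as the variant, and amortised bounds are stated as invariants.\<close>

lemma wp_Loop:
  assumes "I M xs T"
    and step: "\<And>M' xs' T'. I M' xs' T' \<Longrightarrow> unchanged (writes c) M M' \<Longrightarrow> 0 < aval M' e \<Longrightarrow>
        0 < T' \<and> wp c I M' xs' (T' - 1)"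
    and exit: "\<And>M' xs' T'. I M' xs' T' \<Longrightarrow> unchanged (writes c) M M' \<Longrightarrow> aval M' e = 0 \<Longrightarrow>
        0 < T' \<and> Q M' xs' (T' - 1)"
  shows "wp (Loop e c) Q M xs T"
proof -
  have "wp (Loop e c) Q M' xs' T'" if "I M' xs' T'" "unchanged (writes c) M M'" for M' xs' T'
    using that
  proof (induction T' arbitrary: M' xs' rule: less_induct)
    case (less T')
    show ?case
    proof (cases "0 < aval M' e")
      case True
      obtain k N ys where k: "0 < T'" "big c M' xs' k N ys" "k \<le> T' - 1" "I N ys (T' - 1 - k)"
        using step[OF less.prems True] unfolding wp_def by blast
      have "unchanged (writes c) M N"
        using big_unchanged[OF k(2)] less.prems(2) by simp
      then have "wp (Loop e c) Q N ys (T' - 1 - k)"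
        using less.IH[of "T' - 1 - k"] k by simp
      then obtain l N' zs where l: "big (Loop e c) N ys l N' zs" "l \<le> T' - 1 - k"
          "Q N' zs (T' - 1 - k - l)"
        unfolding wp_def by blast
      have "big (Loop e c) M' xs' (Suc (k + l)) N' zs"
        using True k(2) l(1) by (rule big.Loop_pos)
      moreover have "Suc (k + l) \<le> T'" "Q N' zs (T' - Suc (k + l))"
        using k l by auto
      ultimately show ?thesis
        unfolding wp_def by blast
    next
      case False
      then have "0 < T'" "Q M' xs' (T' - 1)" "big (Loop e c) M' xs' 1 M' xs'"
        using exit[OF less.prems] big.Loop_zero by simp_all
      then show ?thesis
        unfolding wp_def by (metis One_nat_def Suc_leI)
    qed
  qed
  then show ?thesis
    using assms(1) by simp
qed

text \<open>Each pass costs \<open>C\<close> for the body and 2 for test and increment; the final 2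
  pays for the initialisation and the last test.\<close>

lemma wp_For:
  assumes v: "v \<notin> writes c"
    and bound: "\<And>M'. unchanged (insert v (writes c)) M M' \<Longrightarrow> aval M' e = K"
    and init: "I 0 (upd M v 0 0) xs"
    and step: "\<And>i M' xs'. i < K \<Longrightarrow> I i M' xs' \<Longrightarrow> unchanged (insert v (writes c)) M M' \<Longrightarrow>
        M' v 0 = i \<Longrightarrow> wp c (\<lambda>M'' xs'' _. I (Suc i) (upd M'' v 0 (Suc i)) xs'') M' xs' C"
    and T: "K * (C + 2) + 2 \<le> T"
    and post: "\<And>M' xs' T'. I K M' xs' \<Longrightarrow> unchanged (insert v (writes c)) M M' \<Longrightarrow>
        M' v 0 = K \<Longrightarrow> T - (K * (C + 2) + 2) \<le> T' \<Longrightarrow> Q M' xs' T'"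
  shows "wp (For v e c) Q M xs T"
proof -
  let ?J = "\<lambda>M' xs' T'. unchanged (insert v (writes c)) M M' \<and> M' v 0 \<le> K \<and> I (M' v 0) M' xs' \<and>
     T - (M' v 0 * (C + 2) + 1) \<le> T'"
  have "wp (Loop (Minus e (Var v)) (c ;; v ::= Plus (Var v) (Num 1))) Q (upd M v 0 0) xs (T - 1)"
  proof (rule wp_Loop[where I = ?J])
    show "?J (upd M v 0 0) xs (T - 1)"
      using init by simp
  next
    fix M' xs' T'
    assume J: "?J M' xs' T'" and "0 < aval M' (Minus e (Var v))"
    define i where "i = M' v 0"
    have i: "i < K" "I i M' xs'" "T - (i * (C + 2) + 1) \<le> T'"
      using \<open>0 < aval M' _\<close> J bound[of M'] by (auto simp: i_def)
    obtain d where d: "K = Suc i + d"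
      using i(1) less_iff_Suc_add by auto
    have T': "C + 3 \<le> T'"
      using T i(3) by (simp add: d algebra_simps)
    have le: "T - (Suc i * (C + 2) + 1) \<le> T' - (C + 2)"
      using i(3) by (simp add: algebra_simps)
    have "wp c (wp (v ::= Plus (Var v) (Num 1)) ?J) M' xs' (T' - 1)"
    proof (rule wp_weaken[OF step])
      fix M'' xs'' T''
      assume *: "I (Suc i) (upd M'' v 0 (Suc i)) xs''" "unchanged (writes c) M' M''"
        "T' - 1 - C \<le> T''"
      have "M'' v 0 = i"
        using * v by (simp add: i_def)
      moreover have "0 < T''" "T - (Suc i * (C + 2) + 1) \<le> T'' - 1"
        using *(3) T' le by linarith+
      ultimately show "wp (v ::= Plus (Var v) (Num 1)) ?J M'' xs'' T''"
        using * J i(1) by simp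
    qed (use i J T' in \<open>auto simp: i_def\<close>)
    then show "0 < T' \<and> wp (c ;; v ::= Plus (Var v) (Num 1)) ?J M' xs' (T' - 1)"
      using T' by simp
  next
    fix M' xs' T'
    assume J: "?J M' xs' T'" and "aval M' (Minus e (Var v)) = 0"
    then have K: "M' v 0 = K"
      using bound[of M'] by simp
    then show "0 < T' \<and> Q M' xs' (T' - 1)"
      using J post[of M' xs' "T' - 1"] T by auto
  qed
  then show ?thesis
    using T by (simp add: For_def)
qed

section \<open>Ultimately periodic sets\<close>

lemma periodic_add_mult:
  fixes p M :: nat
  assumes "\<forall>m\<ge>M. P m \<longleftrightarrow> P (m + p)" "m \<ge> M"
  shows "P (m + p * c) \<longleftrightarrow> P m"
proof (induction c)
  case (Suc c)
  have "P (m + p * Suc c) \<longleftrightarrow> P (m + p * c)"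
    using assms(1)[rule_format, of "m + p * c"] assms(2) by (simp add: algebra_simps)
  with Suc show ?case by simp
qed simp

lemma ultimately_periodic_iff:
  "ultimately_periodic S \<longleftrightarrow> (\<exists>M p. p > 0 \<and> (\<forall>m\<ge>M. m \<in> S \<longleftrightarrow> m + p \<in> S))"
proof
  assume "ultimately_periodic S"
  then obtain I p R where *: "finite I" "p > 0" "R \<subseteq> {..<p}"
      "S = (I - {r + p * k | r k. r \<in> R}) \<union> ({r + p * k | r k. r \<in> R} - I)"
    unfolding ultimately_periodic_def by (auto simp: Let_def)
  define E where "E = {r + p * k | r k. r \<in> R}"
  \<comment> \<open>Beyond \<open>M\<close> there is no element of \<open>I\<close>; the inserted 0
    keeps \<open>Max\<close> meaningful when \<open>I\<close> is empty.\<close>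
  define M where "M = Suc (Max (insert 0 I))"
  have "m \<in> S \<longleftrightarrow> m \<in> E" if "m \<ge> M" for m
  proof -
    have "m \<notin> I"
      using Max_ge[of "insert 0 I" m] *(1) that unfolding M_def by fastforce
    then show ?thesis
      unfolding *(4) E_def[symmetric] by blast
  qed
  moreover have "m \<in> E \<longleftrightarrow> m + p \<in> E" for m
  proof
    assume "m \<in> E"
    then obtain r k where "r \<in> R" "m = r + p * k"
      unfolding E_def by blast
    then have "r \<in> R" "m + p = r + p * Suc k"
      by auto
    then show "m + p \<in> E"
      unfolding E_def by blast
  next
    assume "m + p \<in> E"
    then obtain r k where rk: "r \<in> R" "m + p = r + p * k"
      unfolding E_def by blast
    then have "k \<noteq> 0"
      using *(3) by (intro notI) auto
    then obtain k' where "k = Suc k'"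
      by (auto simp: gr0_conv_Suc)
    then have "m = r + p * k'"
      using rk by simp
    then show "m \<in> E"
      unfolding E_def using rk by blast
  qed
  ultimately have "\<forall>m\<ge>M. m \<in> S \<longleftrightarrow> m + p \<in> S"
    by simp
  then show "\<exists>M p. p > 0 \<and> (\<forall>m\<ge>M. m \<in> S \<longleftrightarrow> m + p \<in> S)"
    using *(2) by blast
next
  assume "\<exists>M p. p > 0 \<and> (\<forall>m\<ge>M. m \<in> S \<longleftrightarrow> m + p \<in> S)"
  then obtain M p where *: "p > 0" "\<forall>m\<ge>M. m \<in> S \<longleftrightarrow> m + p \<in> S"
    by blast
  \<comment> \<open>The residues are read off at \<open>r + p * M\<close>, which is past the
    threshold because \<open>p > 0\<close>. The finite exceptional set is then the symmetric
    difference of \<open>S\<close> and \<open>E\<close>.\<close>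
  define R where "R = {r. r < p \<and> r + p * M \<in> S}"
  define E where "E = {r + p * k | r k. r \<in> R}"
  have E: "m \<in> E \<longleftrightarrow> m mod p + p * M \<in> S" for m
  proof
    assume "m \<in> E"
    then show "m mod p + p * M \<in> S"
      unfolding E_def R_def by auto
  next
    assume "m mod p + p * M \<in> S"
    then have "m mod p \<in> R" "m = m mod p + p * (m div p)"
      using *(1) by (auto simp: R_def)
    then show "m \<in> E"
      unfolding E_def by blast
  qed
  have "m \<in> E \<longleftrightarrow> m \<in> S" if "m \<ge> M" for m
  proof -
    have "M \<le> p * M"
      using *(1) by simp
    then have "m mod p + p * M + p * (m div p) \<in> S \<longleftrightarrow> m mod p + p * M \<in> S"
      by (intro periodic_add_mult[OF *(2)]) linarith
    moreover have "m mod p + p * M + p * (m div p) = m + p * M"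
      using mod_mult_div_eq[of m p] by linarith
    moreover have "m + p * M \<in> S \<longleftrightarrow> m \<in> S"
      using periodic_add_mult[OF *(2) that] .
    ultimately show ?thesis
      using E by simp
  qed
  then have "(S - E) \<union> (E - S) \<subseteq> {..<M}"
    by (auto simp: not_less[symmetric])
  then have "finite ((S - E) \<union> (E - S))"
    using finite_subset by blast
  moreover have "R \<subseteq> {..<p}"
    by (auto simp: R_def)
  moreover have "S = ((S - E) \<union> (E - S) - E) \<union> (E - ((S - E) \<union> (E - S)))"
    by blast
  ultimately show "ultimately_periodic S"
    unfolding ultimately_periodic_def Let_def using *(1) E_def
    by (intro exI[of _ "(S - E) \<union> (E - S)"] exI[of _ p] exI[of _ R]) simp
qed

lemma ultimately_periodic_cong:
  assumes "\<And>m. m \<ge> M \<Longrightarrow> m \<in> S \<longleftrightarrow> m \<in> S'" "ultimately_periodic S'"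
  shows "ultimately_periodic S"
proof -
  obtain M' p where "p > 0" "\<forall>m\<ge>M'. m \<in> S' \<longleftrightarrow> m + p \<in> S'"
    using assms(2) ultimately_periodic_iff by blast
  then have "\<forall>m\<ge>max M M'. m \<in> S \<longleftrightarrow> m + p \<in> S"
    using assms(1) by (meson max.boundedE trans_le_add1)
  then show ?thesis
    using \<open>p > 0\<close> unfolding ultimately_periodic_iff by blast
qed

text \<open>Dividing by \<open>gcd p b\<close> again and again moves all prime factors shared with
  \<open>b\<close> into a power of \<open>b\<close>. Enough digits absorb that power, and only the
  coprime part \<open>k\<close> of a period remains.\<close>

lemma coprime_part:
  fixes p b :: nat
  assumes "p > 0"
  shows "\<exists>k j. k > 0 \<and> coprime k b \<and> p dvd k * b ^ j"
  using assms
proof (induction p rule: less_induct)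
  case (less p)
  show ?case
  proof (cases "coprime p b")
    case True
    then show ?thesis
      using less.prems by (metis dvd_triv_left)
  next
    case False
    define g where "g = gcd p b"
    have g: "g > 1" "g dvd p" "g dvd b"
      using False less.prems unfolding g_def coprime_iff_gcd_eq_1
      by (metis One_nat_def Suc_lessI gcd_pos_nat not_gr0, auto)
    then obtain p' where p': "p = g * p'"
      by blast
    then obtain k j where kj: "k > 0" "coprime k b" "p' dvd k * b ^ j"
      using less.IH[of p'] less.prems g(1) by auto
    then have "p dvd b * (k * b ^ j)"
      using p' g(3) mult_dvd_mono by blast
    then have "p dvd k * b ^ Suc j"
      by (simp add: ac_simps)
    then show ?thesis
      using kj by blast
  qed
qed

section \<open>Automata reading digits\<close>

lemma word_value_Nil [simp]: "word_value b [] = 0"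
  by (simp add: word_value_def)

lemma word_value_Cons [simp]: "word_value b (a # u) = a + b * word_value b u"
proof -
  have "word_value b (a # u) = (\<Sum>i<Suc (length u). (a # u) ! i * b ^ i)"
    by (simp add: word_value_def)
  also have "\<dots> = a + (\<Sum>i<length u. u ! i * b ^ Suc i)"
    by (subst sum.lessThan_Suc_shift) simp
  also have "(\<Sum>i<length u. u ! i * b ^ Suc i) = b * word_value b u"
    unfolding word_value_def sum_distrib_left by (intro sum.cong) auto
  finally show ?thesis .
qed

lemma word_value_append: "word_value b (u @ v) = word_value b u + b ^ length u * word_value b v"
  by (induction u) (simp_all add: distrib_left mult.assoc)

type_synonym sets = "nat \<Rightarrow> nat \<Rightarrow> bool"

fun accepts_num :: "nat \<Rightarrow> (nat \<Rightarrow> nat \<Rightarrow> nat) \<Rightarrow> (nat \<Rightarrow> bool) \<Rightarrow> nat \<Rightarrow> nat \<Rightarrow> bool" where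
  "accepts_num b \<delta> fin q m =
     (if m = 0 \<or> b \<le> 1 then fin q else accepts_num b \<delta> fin (\<delta> q (m mod b)) (m div b))"

declare accepts_num.simps [simp del]

locale digit_automaton =
  fixes b N :: nat and \<delta> :: "nat \<Rightarrow> nat \<Rightarrow> nat" and fin :: "nat \<Rightarrow> bool" and i0 :: nat
  assumes b: "b > 1" and \<delta>: "q < N \<Longrightarrow> a < b \<Longrightarrow> \<delta> q a < N" and i0: "i0 < N"
begin

definition acc :: "nat \<Rightarrow> nat \<Rightarrow> bool" where
  "acc = accepts_num b \<delta> fin"

text \<open>After this substitution the time bounds compare polynomials with nonnegative
  coefficients, which simplification settles.\<close>

lemma sizes_cases:
  obtains c d where "b = Suc (Suc c)" "N = Suc d"
  using that[of "b - 2" "N - 1"] b i0 by auto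

lemma acc_0 [simp]: "acc q 0 = fin q"
  by (simp add: acc_def accepts_num.simps)

lemma acc_pos:
  assumes "a + b * m > 0" "a < b"
  shows "acc q (a + b * m) = acc (\<delta> q a) m"
proof -
  have "(a + b * m) mod b = a" "(a + b * m) div b = m"
    using assms(2) by auto
  then show ?thesis
    using assms(1) b accepts_num.simps[of b \<delta> fin q "a + b * m"] unfolding acc_def
    by (auto split: if_splits)
qed

definition reachable :: "nat set" where
  "reachable = {foldl \<delta> i0 w | w. w \<in> lists {..<b}}"

definition zero_closed :: bool where
  "zero_closed \<longleftrightarrow> (\<forall>q\<in>reachable. fin (\<delta> q 0) = fin q)"

lemma i0_reachable: "i0 \<in> reachable"
  unfolding reachable_def by (auto intro!: exI[of _ "[]"])

lemma reachable_step:
  assumes "q \<in> reachable" "a < b"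
  shows "\<delta> q a \<in> reachable"
proof -
  obtain w where "w \<in> lists {..<b}" "q = foldl \<delta> i0 w"
    using assms(1) unfolding reachable_def by blast
  then have "w @ [a] \<in> lists {..<b}" "\<delta> q a = foldl \<delta> i0 (w @ [a])"
    using assms(2) by auto
  then show ?thesis
    unfolding reachable_def by blast
qed

lemma reachable_less:
  assumes "q \<in> reachable"
  shows "q < N"
proof -
  have "foldl \<delta> q w < N" if "w \<in> lists {..<b}" "q < N" for w q
    using that by (induction w arbitrary: q) (auto simp: \<delta>)
  then show ?thesis
    using i0 assms by (auto simp: reachable_def)
qed

lemma reachable_least:
  assumes "i0 \<in> A" "\<And>q a. q \<in> A \<Longrightarrow> a < b \<Longrightarrow> \<delta> q a \<in> A"
  shows "reachable \<subseteq> A"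
proof -
  have "foldl \<delta> q w \<in> A" if "w \<in> lists {..<b}" "q \<in> A" for w q
    using that by (induction w arbitrary: q) (auto simp: assms(2))
  then show ?thesis
    using assms(1) by (auto simp: reachable_def)
qed

text \<open>Zero closure supplies the one case that \<open>acc_pos\<close> excludes: for
  \<open>a = m = 0\<close> no digit is read on the left, but a zero on the right.\<close>

lemma acc_step:
  assumes zero_closed "q \<in> reachable" "a < b"
  shows "acc q (a + b * m) = acc (\<delta> q a) m"
proof (cases "a + b * m > 0")
  case True
  then show ?thesis
    using acc_pos[OF True assms(3)] by blast
next
  case False
  then have "a = 0" "m = 0"
    using b by auto
  then show ?thesis
    using assms(1,2) unfolding zero_closed_def by simp
qed

lemma acc_foldl:
  assumes zero_closed "q \<in> reachable" "w \<in> lists {..<b}"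
  shows "acc (foldl \<delta> q w) m = acc q (word_value b w + b ^ length w * m)"
  using assms(2,3)
proof (induction w arbitrary: q)
  case (Cons a w)
  have "acc (foldl \<delta> q (a # w)) m = acc (\<delta> q a) (word_value b w + b ^ length w * m)"
    using Cons reachable_step by simp
  also have "\<dots> = acc q (a + b * (word_value b w + b ^ length w * m))"
    using acc_step[OF assms(1)] Cons.prems by simp
  finally show ?case
    by (simp add: algebra_simps)
qed simp

lemma ex_word: "\<exists>w\<in>lists {..<b}. word_value b w = m"
proof (induction m rule: less_induct)
  case (less m)
  show ?case
  proof (cases "m = 0")
    case True
    then show ?thesis by (intro bexI[of _ "[]"]) auto
  next
    case False
    then obtain w where "w \<in> lists {..<b}" "word_value b w = m div b"
      using less.IH[of "m div b"] b by auto
    then show ?thesis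
      using b by (intro bexI[of _ "m mod b # w"]) auto
  qed
qed

text \<open>Appending a zero keeps the value of a word, which forces zero closure; and every number
  has a word, which determines the set. So the search for some accepted set becomes a question about
  one concrete set.\<close>

lemma acceptance_by_value_iff:
  assumes L: "\<And>u. u \<in> L \<longleftrightarrow> u \<in> lists {..<b} \<and> fin (foldl \<delta> i0 u)"
  shows "L = {u \<in> lists {..<b}. word_value b u \<in> S} \<longleftrightarrow> zero_closed \<and> S = {m. acc i0 m}"
proof
  assume eq: "L = {u \<in> lists {..<b}. word_value b u \<in> S}"
  have S: "fin (foldl \<delta> i0 u) \<longleftrightarrow> word_value b u \<in> S" if "u \<in> lists {..<b}" for u
    using eq L that by blast
  have zc: zero_closed
    unfolding zero_closed_def
  proof
    fix q assume "q \<in> reachable"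
    then obtain w where w: "q = foldl \<delta> i0 w" "w \<in> lists {..<b}"
      unfolding reachable_def by blast
    then show "fin (\<delta> q 0) = fin q"
      using S[of w] S[of "w @ [0]"] b by (simp add: word_value_append)
  qed
  moreover have "m \<in> S \<longleftrightarrow> acc i0 m" for m
  proof -
    obtain w where "w \<in> lists {..<b}" "word_value b w = m"
      using ex_word by blast
    then show ?thesis
      using S[of w] acc_foldl[OF zc i0_reachable, of w 0] by simp
  qed
  ultimately show "zero_closed \<and> S = {m. acc i0 m}"
    by blast
next
  assume *: "zero_closed \<and> S = {m. acc i0 m}"
  then have "fin (foldl \<delta> i0 u) \<longleftrightarrow> word_value b u \<in> S" if "u \<in> lists {..<b}" for u
    using acc_foldl[of i0 u 0] i0_reachable that by simp
  then show "L = {u \<in> lists {..<b}. word_value b u \<in> S}"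
    using L by blast
qed

text \<open>The set of \<open>q\<close> interleaves the sets of its \<open>b\<close> successors. A
  common period of these, multiplied by \<open>b\<close>, is a period of the interleaving.\<close>

lemma ultimately_periodic_pred:
  assumes "\<And>a. a < b \<Longrightarrow> ultimately_periodic {m. acc (\<delta> q a) m}"
  shows "ultimately_periodic {m. acc q m}"
proof -
  have "\<forall>a. \<exists>M p. a < b \<longrightarrow> p > 0 \<and> (\<forall>m\<ge>M. acc (\<delta> q a) m \<longleftrightarrow> acc (\<delta> q a) (m + p))"
    using assms unfolding ultimately_periodic_iff by auto
  then obtain M p where *: "\<And>a. a < b \<Longrightarrow> p a > 0"
      "\<And>a. a < b \<Longrightarrow> \<forall>m\<ge>M a. acc (\<delta> q a) m \<longleftrightarrow> acc (\<delta> q a) (m + p a)"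
    by metis
  \<comment> \<open>The \<open>Suc\<close> makes all quotients in question positive, so
    \<open>acc_pos\<close> applies and zero closure is not assumed.\<close>
  define M' where "M' = Suc (\<Sum>a<b. M a)"
  define p' where "p' = (\<Prod>a<b. p a)"
  have per: "acc (\<delta> q a) (m + p') \<longleftrightarrow> acc (\<delta> q a) m" if "a < b" "m \<ge> M'" for a m
  proof -
    have "p a dvd p'"
      unfolding p'_def using that by (intro dvd_prodI) auto
    moreover have "M a \<le> (\<Sum>a<b. M a)"
      using that by (intro member_le_sum) auto
    ultimately show ?thesis
      using periodic_add_mult[OF *(2)[OF that(1)], of m] that(2) by (auto simp: M'_def)
  qed
  have "acc q m \<longleftrightarrow> acc q (m + b * p')" if "m \<ge> b * M'" for m
  proof -
    define a m' where "a = m mod b" "m' = m div b"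
    have m: "m = a + b * m'" "a < b" "m' \<ge> M'"
      using b that by (auto simp: a_m'_def less_eq_div_iff_mult_less_eq mult.commute)
    have "acc q (a + b * m') = acc (\<delta> q a) m'" "acc q (a + b * (m' + p')) = acc (\<delta> q a) (m' + p')"
      using m b by (auto intro!: acc_pos simp: M'_def)
    then show ?thesis
      using per[OF m(2,3)] by (simp add: m(1) algebra_simps)
  qed
  moreover have "b * p' > 0"
    using b *(1) by (auto simp: p'_def)
  ultimately show ?thesis
    unfolding ultimately_periodic_iff by blast
qed

text \<open>
  The state \<open>N + q\<close> of the doubled automaton stands for the set of the numbers whose successor is
  accepted from \<open>q\<close>.
\<close>

definition doubled :: "nat \<Rightarrow> nat \<Rightarrow> nat" where
  "doubled x a = (if x < N then \<delta> x a else if Suc a < b then \<delta> (x - N) (Suc a) else N + \<delta> (x - N) 0)"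

end

text \<open>An abstract account of what the peeling computes. \<open>R_long\<close> pushes a set
  past its threshold; \<open>R_attracting\<close> is an induction principle against the direction of
  the edges, which carries ultimate periodicity from \<open>R\<close> back to the initial
  state.\<close>

locale recurrent_states = digit_automaton +
  fixes R :: "nat set"
  assumes R_reachable: "R \<subseteq> reachable"
    and R_step: "q \<in> R \<Longrightarrow> a < b \<Longrightarrow> \<delta> q a \<in> R"
    and R_long: "q \<in> R \<Longrightarrow> \<exists>w\<in>lists {..<b}. length w \<ge> l \<and> foldl \<delta> i0 w = q"
    and R_attracting: "(\<And>q. q \<in> reachable \<Longrightarrow> (\<And>a. a < b \<Longrightarrow> \<delta> q a \<in> Z) \<Longrightarrow> q \<in> Z) \<Longrightarrow>
      R \<subseteq> Z \<Longrightarrow> reachable \<subseteq> Z"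
begin

definition active :: "nat set" where
  "active = R \<union> {N + q | q. q \<in> R}"

text \<open>The states at which a number was just completed, possibly with one more leading zero digit.\<close>

definition marks :: "nat set" where
  "marks = {\<delta> q a | q a. q \<in> R \<and> 0 < a \<and> a < b} \<union> {\<delta> (\<delta> q a) 0 | q a. q \<in> R \<and> 0 < a \<and> a < b}"

text \<open>From left to right, letters act on the classes of \<open>f\<close>; from right to left,
  they act injectively. The codomain is general because \<open>f\<close> is either a family of sets,
  as a semantic witness, or the root function of the computed partition.\<close>

definition bicompatible :: "(nat \<Rightarrow> 'a) \<Rightarrow> bool" where
  "bicompatible f \<longleftrightarrow>
     (\<forall>x\<in>active. \<forall>y\<in>active. \<forall>a<b. f x = f y \<longleftrightarrow> f (doubled x a) = f (doubled y a))"

lemma R_less: "q \<in> R \<Longrightarrow> q < N"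
  using R_reachable reachable_less by blast

lemma R_active: "q \<in> R \<Longrightarrow> q \<in> active" "q \<in> R \<Longrightarrow> N + q \<in> active"
  by (auto simp: active_def)

lemma doubled_R: "q \<in> R \<Longrightarrow> doubled q a = \<delta> q a"
  using R_less by (simp add: doubled_def)

lemma doubled_shifted: "doubled (N + q) a = (if Suc a < b then \<delta> q (Suc a) else N + \<delta> q 0)"
  by (simp add: doubled_def)

lemma active_less:
  assumes "x \<in> active"
  shows "x < 2 * N"
proof -
  obtain q where "q \<in> R" "x = q \<or> x = N + q"
    using assms by (auto simp: active_def)
  then show ?thesis
    using R_less[of q] by auto
qed

lemma doubled_active: "x \<in> active \<Longrightarrow> a < b \<Longrightarrow> doubled x a \<in> active"
  using R_step[of _ a] R_step[of _ 0] R_step[of _ "Suc a"] b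
  by (auto simp: active_def doubled_R doubled_shifted)

lemma marks_R: "y \<in> marks \<Longrightarrow> y \<in> R"
  using R_step b by (auto simp: marks_def)

section \<open>Necessity: the corrected sets form a bicompatible family\<close>

lemma recurrent_necessary:
  assumes zc: zero_closed and up: "ultimately_periodic {m. acc i0 m}"
  shows "\<exists>V :: sets. bicompatible V \<and> (\<forall>y\<in>marks. V y 0 = fin y)"
proof -
  obtain M p where Mp: "p > 0" "\<forall>m\<ge>M. acc i0 m \<longleftrightarrow> acc i0 (m + p)"
    using up unfolding ultimately_periodic_iff by auto
  \<comment> \<open>\<open>k\<close> becomes the common period of all recurrent states.\<close>
  obtain k j where kj: "k > 0" "coprime k b" "p dvd k * b ^ j"
    using coprime_part[OF Mp(1)] by blast
  have per: "acc q (m + k) = acc q m" if q: "q \<in> R" and m: "m > 0" for q m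
  proof -
    \<comment> \<open>At least \<open>j\<close> digits absorb the part of \<open>p\<close> not in
      \<open>k\<close>; at least \<open>M\<close> digits lift every positive \<open>m\<close> above
      the threshold, as \<open>b ^ length w\<close> exceeds \<open>length w\<close>.\<close>
    obtain w where w: "w \<in> lists {..<b}" "length w \<ge> max j M" "foldl \<delta> i0 w = q"
      using R_long[OF q] by blast
    let ?l = "length w"
    have "p dvd k * b ^ ?l"
      using kj(3) w(2) by (meson dvd_trans le_imp_power_dvd max.boundedE mult_dvd_mono dvd_refl)
    then obtain c where c: "b ^ ?l * k = p * c"
      by (metis dvdE mult.commute)
    have "?l < b ^ ?l"
      using b by (simp add: power_gt_expt)
    then have "M \<le> b ^ ?l * 1"
      using w(2) by simp
    also have "\<dots> \<le> b ^ ?l * m"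
      using m by (intro mult_le_mono) auto
    finally have "M \<le> word_value b w + b ^ ?l * m"
      by simp
    then have "acc i0 (word_value b w + b ^ ?l * m + p * c) = acc i0 (word_value b w + b ^ ?l * m)"
      by (rule periodic_add_mult[OF Mp(2)])
    then show ?thesis
      using acc_foldl[OF zc i0_reachable w(1)] by (simp add: w(3) add_mult_distrib2 c add.assoc)
  qed
  \<comment> \<open>The correction at 0: reading \<open>m\<close> as \<open>m + k\<close> changes
    nothing for positive \<open>m\<close> and gives 0 the value dictated by the period.\<close>
  define U where "U q m = acc q (m + k)" for q m
  have U_acc: "U q m = acc q m" if "q \<in> R" "m > 0" for q m
    using per[OF that] by (simp add: U_def)
  have U_per: "U q (m + k * c) = U q m" if "q \<in> R" for q m c
    unfolding U_def using periodic_add_mult[of "Suc 0" "acc q" k "m + k" c] per[OF that] kj(1)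
    by (simp add: ac_simps)
  have U_step: "U (\<delta> q a) m = U q (a + b * m)" if "q \<in> R" "a < b" for q a m
  proof -
    have "U (\<delta> q a) m = acc q (a + b * (m + k))"
      unfolding U_def using acc_step[OF zc _ that(2)] R_reachable that(1) by auto
    \<comment> \<open>Scaling the shift by \<open>b\<close> adds \<open>b - 1\<close> surplus
      periods, which \<open>U_per\<close> removes.\<close>
    also have "a + b * (m + k) = a + b * m + k * (b - 1) + k"
      using b by (cases b) (simp_all add: algebra_simps)
    also have "acc q \<dots> = U q (a + b * m)"
      using U_per[OF that(1), of "a + b * m" "b - 1"] by (simp add: U_def)
    finally show ?thesis .
  qed
  define V where "V x = (if x < N then U x else (\<lambda>m. U (x - N) (Suc m)))" for x
  have V_R: "V q = U q" if "q \<in> R" for q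
    using that R_less by (simp add: V_def)
  have V_shift: "V (N + q) m = U q (Suc m)" for q m
    by (simp add: V_def)
  have V_per: "V x (m + k * c) = V x m" if "x \<in> active" for x m c
    using that U_per V_R V_shift by (auto simp: active_def simp flip: add_Suc)
  have V_step: "V (doubled x a) m = V x (a + b * m)" if x: "x \<in> active" and a: "a < b" for x a m
  proof (cases "x \<in> R")
    case True
    then show ?thesis
      using U_step a R_step by (simp add: V_R doubled_R)
  next
    case False
    then obtain q where q: "x = N + q" "q \<in> R"
      using x by (auto simp: active_def)
    show ?thesis
    proof (cases "Suc a < b")
      case True
      then show ?thesis
        using q R_step[OF q(2) True] U_step[OF q(2) True]
        by (simp add: doubled_shifted V_R V_shift)
    next
      case False
      \<comment> \<open>The carry: incrementing the last digit \<open>b - 1\<close> gives the digit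
        0 and increments the quotient, so the translated state is kept.\<close>
      then have "Suc (a + b * m) = 0 + b * Suc m"
        using a by simp
      then show ?thesis
        using q False U_step[OF q(2), of 0 "Suc m"] b
        by (simp add: doubled_shifted V_shift del: mult_Suc_right)
    qed
  qed
  have "bicompatible V"
    unfolding bicompatible_def
  proof (intro ballI allI impI iffI)
    fix x y a
    assume xy: "x \<in> active" "y \<in> active" and a: "a < b"
    {
      assume "V x = V y"
      then show "V (doubled x a) = V (doubled y a)"
        using V_step[OF xy(1) a] V_step[OF xy(2) a] by (intro ext) simp
    }
    assume eq: "V (doubled x a) = V (doubled y a)"
    have "gcd b k = 1"
      using kj(2) by (simp add: coprime_iff_gcd_eq_1 gcd.commute)
    then obtain c d where cd: "b * c = k * d + 1"
      using bezout_nat[of b k] b by auto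
    show "V x = V y"
    proof (rule ext)
      fix m
      \<comment> \<open>\<open>c\<close> inverts \<open>b\<close> modulo \<open>k\<close>, and
        \<open>(k - 1) * a\<close> stands for the negative of \<open>a\<close>. So
        \<open>a + b * m'\<close> is congruent to \<open>m\<close>, and the set of a state can be
        recovered from that of its successor.\<close>
      define m' where "m' = c * (m + (k - 1) * a)"
      have "a + b * m' = a + (k * d + 1) * (m + (k - 1) * a)"
        by (simp only: m'_def cd[symmetric] mult.assoc)
      also have "\<dots> = m + k * (d * (m + (k - 1) * a) + a)"
        using kj(1) by (cases k) (simp_all add: algebra_simps)
      finally have m': "a + b * m' = m + k * (d * (m + (k - 1) * a) + a)" .
      have "V x m = V (doubled x a) m'"
        using V_step[OF xy(1) a] V_per[OF xy(1)] by (simp add: m')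
      also have "\<dots> = V (doubled y a) m'"
        using eq by simp
      also have "\<dots> = V y m"
        using V_step[OF xy(2) a] V_per[OF xy(2)] by (simp add: m')
      finally show "V x m = V y m" .
    qed
  qed
  moreover have "V y 0 = fin y" if "y \<in> marks" for y
  proof -
    \<comment> \<open>After a nonzero digit \<open>a\<close>, membership of 0 is membership of the
      positive number \<open>a\<close> before it, where no correction took place.\<close>
    have *: "U (\<delta> q a) 0 = fin (\<delta> q a)" if "q \<in> R" "0 < a" "a < b" for q a
      using U_step[OF that(1,3), of 0] U_acc[OF that(1,2)] acc_pos[of a 0 q] that by simp
    obtain q a where qa: "q \<in> R" "0 < a" "a < b" and y: "y = \<delta> q a \<or> y = \<delta> (\<delta> q a) 0"
      using \<open>y \<in> marks\<close> unfolding marks_def by blast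
    have R: "\<delta> q a \<in> R" "\<delta> (\<delta> q a) 0 \<in> R"
      using R_step qa b by auto
    have "U (\<delta> (\<delta> q a) 0) 0 = U (\<delta> q a) 0"
      using U_step[OF R(1), of 0 0] b by simp
    moreover have "fin (\<delta> (\<delta> q a) 0) = fin (\<delta> q a)"
      using zc R_reachable R(1) unfolding zero_closed_def by blast
    ultimately show ?thesis
      using y *[OF qa] V_R R by auto
  qed
  ultimately show ?thesis
    by blast
qed

section \<open>Sufficiency: a partition without conflicts yields a period\<close>

lemma recurrent_sufficient:
  fixes r :: "nat \<Rightarrow> nat"
  assumes zc: zero_closed and bi: "bicompatible r"
    and fin: "\<And>y y'. y \<in> marks \<Longrightarrow> y' \<in> marks \<Longrightarrow> r y = r y' \<Longrightarrow> fin y = fin y'"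
  shows "ultimately_periodic {m. acc i0 m}"
proof -
  have finite_R: "finite R"
    using R_less by (meson bounded_nat_set_is_finite)
  have congr: "r (doubled x a) = r (doubled y a) \<longleftrightarrow> r x = r y" if "x \<in> active" "y \<in> active" "a < b" for x y a
    using bi that unfolding bicompatible_def by blast
  have congr_R: "r (\<delta> x a) = r (\<delta> y a) \<longleftrightarrow> r x = r y" if "x \<in> R" "y \<in> R" "a < b" for x y a
    using congr[of x y a] that R_active doubled_R by simp
  \<comment> \<open>\<open>f\<close> is the action of the letter \<open>a\<close> on the classes. It
    is injective on a finite set, hence surjective, so every class has a predecessor for every
    letter.\<close>
  have pre: "\<exists>q\<in>R. r (\<delta> q a) = r x" if x: "x \<in> R" and a: "a < b" for x a
  proof -
    define f where "f c = r (\<delta> (SOME q. q \<in> R \<and> r q = c) a)" for c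
    have f: "f (r q) = r (\<delta> q a)" if "q \<in> R" for q
    proof -
      have "\<exists>q'. q' \<in> R \<and> r q' = r q"
        using that by blast
      from someI_ex[OF this] show ?thesis
        unfolding f_def using congr_R[of _ q a] that a by blast
    qed
    have "inj_on f (r ` R)"
      using f congr_R a by (auto simp: inj_on_def)
    moreover have "f ` r ` R \<subseteq> r ` R"
      using f R_step a by auto
    ultimately have surj: "f ` r ` R = r ` R"
      using finite_R by (intro endo_inj_surj) auto
    have "r x \<in> f ` r ` R"
      unfolding surj using x by (rule imageI)
    then obtain q where "q \<in> R" "r x = f (r q)"
      by (elim imageE) simp
    then show ?thesis
      using f by force
  qed
  \<comment> \<open>Acceptance is redefined per class by means of the marks in it. By
    \<open>pre\<close> for the letter 1 every class contains one, which is how \<open>lab_0\<close>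
    transfers zero closure.\<close>
  define lab where "lab q \<longleftrightarrow> (\<exists>y\<in>marks. r y = r q \<and> fin y)" for q
  have lab_mark: "lab y = fin y" if "y \<in> marks" for y
    unfolding lab_def using fin that by blast
  have mark1: "\<delta> q a \<in> marks" "\<delta> (\<delta> q a) 0 \<in> marks" if "q \<in> R" "0 < a" "a < b" for q a
    using that unfolding marks_def by blast+
  have lab_0: "lab (\<delta> q 0) = lab q" if q: "q \<in> R" for q
  proof -
    obtain q' where q': "q' \<in> R" "r (\<delta> q' 1) = r q"
      using pre[OF q b] by blast
    let ?y = "\<delta> q' 1"
    have y: "?y \<in> marks" "\<delta> ?y 0 \<in> marks" "?y \<in> R"
      using mark1[OF q'(1)] R_step[OF q'(1)] b by auto
    have "r (\<delta> ?y 0) = r (\<delta> q 0)"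
      using congr_R[OF y(3) q, of 0] q'(2) b by simp
    then have "lab (\<delta> q 0) = fin (\<delta> ?y 0)"
      using lab_mark[OF y(2)] unfolding lab_def by simp
    also have "\<dots> = fin ?y"
      using zc y(3) R_reachable unfolding zero_closed_def by blast
    also have "\<dots> = lab q"
      using lab_mark[OF y(1)] q'(2) unfolding lab_def by simp
    finally show ?thesis .
  qed
  \<comment> \<open>\<open>W\<close> depends on the class of a state only, unlike
    \<open>acc\<close>. The two agree on positive numbers, because the last digit read is nonzero
    and so leads to a mark.\<close>
  define W where "W = accepts_num b \<delta> lab"
  have W_0: "W q 0 = lab q" for q
    by (simp add: W_def accepts_num.simps)
  have W_step: "W q (a + b * m) = W (\<delta> q a) m" if q: "q \<in> R" and a: "a < b" for q a m
  proof (cases "a + b * m = 0")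
    case True
    then have "a = 0" "m = 0"
      using b by auto
    then show ?thesis
      using W_0 lab_0[OF q] by simp
  next
    case False
    then show ?thesis
      unfolding W_def using a b by (subst accepts_num.simps) auto
  qed
  have W_class: "W q m = W q' m" if "q \<in> R" "q' \<in> R" "r q = r q'" for q q' m
    using that
  proof (induction m arbitrary: q q' rule: less_induct)
    case (less m)
    show ?case
    proof (cases "m = 0")
      case True
      then show ?thesis
        using less.prems by (simp add: W_0 lab_def)
    next
      case False
      have "W (\<delta> q (m mod b)) (m div b) = W (\<delta> q' (m mod b)) (m div b)"
        using less.IH[of "m div b" "\<delta> q (m mod b)" "\<delta> q' (m mod b)"] less.prems False b R_step congr_R
        by simp
      then show ?thesis
        using W_step[OF less.prems(1), of "m mod b" "m div b"] b
          W_step[OF less.prems(2), of "m mod b" "m div b"] by simp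
    qed
  qed
  have W_acc: "W q m = acc q m" if "q \<in> R" "m > 0" for q m
    using that
  proof (induction m arbitrary: q rule: less_induct)
    case (less m)
    define a m' where "a = m mod b" "m' = m div b"
    have m: "m = a + b * m'" "a < b"
      using b by (auto simp: a_m'_def)
    show ?case
    proof (cases "m' = 0")
      case True
      then have "W q m = fin (\<delta> q a)" "acc q m = fin (\<delta> q a)"
        using W_step[OF less.prems(1) m(2), of 0] acc_pos[of a 0 q] mark1[OF less.prems(1)]
          lab_mark less.prems m W_0 by auto
      then show ?thesis by simp
    next
      case False
      have "m' < m"
        using b less.prems(2) by (simp add: a_m'_def)
      then have "W (\<delta> q a) m' = acc (\<delta> q a) m'"
        using less.IH False R_step[OF less.prems(1) m(2)] by simp
      then show ?thesis
        using W_step[OF less.prems(1) m(2)] acc_pos[of a m' q] less.prems m by simp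
    qed
  qed
  \<comment> \<open>An original state in the class of \<open>N + q\<close> stands for the translated
    set. The induction follows the digits of \<open>m\<close>; only a digit \<open>b - 1\<close>
    keeps the translation alive, now for the smaller quotient.\<close>
  have shift: "W z m = W q (Suc m)" if "z \<in> R" "q \<in> R" "r z = r (N + q)" for z q m
    using that
  proof (induction m arbitrary: z q rule: less_induct)
    case (less m)
    define a m' where "a = m mod b" "m' = m div b"
    have m: "m = a + b * m'" "a < b"
      using b by (auto simp: a_m'_def)
    have d: "r (\<delta> z a) = r (doubled (N + q) a)"
      using congr[of z "N + q" a] less.prems m(2) R_active doubled_R by simp
    show ?case
    proof (cases "Suc a < b")
      case True
      have "W z m = W (\<delta> z a) m'"
        using W_step[OF less.prems(1) m(2)] m(1) by simp
      also have "\<dots> = W (\<delta> q (Suc a)) m'"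
        using W_class R_step less.prems True m(2) d by (simp add: doubled_shifted)
      also have "\<dots> = W q (Suc m)"
        using W_step[OF less.prems(2) True, of m'] m(1) by simp
      finally show ?thesis .
    next
      case False
      then have a: "Suc a = b"
        using m(2) by simp
      then have "m > 0"
        using m(1) b by simp
      then have "m' < m"
        using b by (simp add: a_m'_def)
      then have "W (\<delta> z a) m' = W (\<delta> q 0) (Suc m')"
        using less.IH[of m' "\<delta> z a" "\<delta> q 0"] R_step less.prems m(2) b d False
        by (simp add: doubled_shifted)
      moreover have "Suc m = 0 + b * Suc m'"
        using m(1) a by simp
      ultimately show ?thesis
        using W_step[OF less.prems(1) m(2), of m'] W_step[OF less.prems(2), of 0 "Suc m'"] b m(1)
        by (simp del: mult_Suc_right)
    qed
  qed
  \<comment> \<open>The letter 0 leads from \<open>N + q\<close> to an original state without a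
    carry. By surjectivity an original state \<open>z\<close> has its 0-successor in the same class,
    and injectivity puts \<open>z\<close> into the class of \<open>N + q\<close>.\<close>
  have shifted_state: "\<exists>z\<in>R. r z = r (N + q)" if q: "q \<in> R" for q
  proof -
    have "doubled (N + q) 0 = \<delta> q 1"
      using b by (simp add: doubled_shifted)
    moreover obtain z where "z \<in> R" "r (\<delta> z 0) = r (\<delta> q 1)"
      using pre[of "\<delta> q 1" 0] R_step[OF q b] b by auto
    ultimately show ?thesis
      using congr[of z "N + q" 0] R_active q b doubled_R by auto
  qed
  have R_up: "ultimately_periodic {m. acc q m}" if q: "q \<in> R" for q
  proof -
    \<comment> \<open>All translates of the set of \<open>q\<close> occur among finitely many
      states, so two of them coincide; their difference is a period.\<close>
    have "\<exists>z\<in>R. \<forall>m. W z m = W q (m + i)" for i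
    proof (induction i)
      case (Suc i)
      then obtain z where "z \<in> R" "\<forall>m. W z m = W q (m + i)"
        by blast
      moreover obtain z' where "z' \<in> R" "r z' = r (N + z)"
        using shifted_state[OF \<open>z \<in> R\<close>] by blast
      ultimately show ?case
        using shift[of z' z] by auto
    qed (use q in auto)
    then obtain z where z: "\<And>i. z i \<in> R" "\<And>i m. W (z i) m = W q (m + i)"
      by metis
    have "\<not> inj_on z UNIV"
      using finite_R z(1) finite_imageD finite_subset[of "range z" R] infinite_UNIV_nat by blast
    then obtain i j where "i < j" "z i = z j"
      unfolding inj_on_def by (metis linorder_neqE_nat)
    then have eq: "W q (m + i) = W q (m + j)" for m
      using z(2)[of i m] z(2)[of j m] by metis
    have "W q m = W q (m + (j - i))" if "m \<ge> i" for m
    proof -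
      have "m - i + i = m" "m - i + j = m + (j - i)"
        using that \<open>i < j\<close> by auto
      then show ?thesis
        using eq[of "m - i"] by metis
    qed
    then have "ultimately_periodic {m. W q m}"
      unfolding ultimately_periodic_iff mem_Collect_eq using \<open>i < j\<close> zero_less_diff by blast
    then show ?thesis
      \<comment> \<open>The threshold 1 leaves out 0, where \<open>W\<close> and \<open>acc\<close>
        may differ.\<close>
      by (rule ultimately_periodic_cong[rotated, where M = 1]) (use W_acc[OF q] in simp)
  qed
  have "reachable \<subseteq> {q. ultimately_periodic {m. acc q m}}"
    by (rule R_attracting) (use R_up ultimately_periodic_pred in auto)
  then show ?thesis
    using i0_reachable by blast
qed

end

section \<open>Loading the automaton\<close>

abbreviation (input) "resV \<equiv> 0 :: nat"
abbreviation (input) "bV \<equiv> 15 :: nat"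
abbreviation (input) "nV \<equiv> 2 :: nat"
abbreviation (input) "iV \<equiv> 3 :: nat"
abbreviation (input) "NV \<equiv> 4 :: nat"
abbreviation (input) "DV \<equiv> 5 :: nat"
abbreviation (input) "xV \<equiv> 6 :: nat"
abbreviation (input) "aV \<equiv> 7 :: nat"
abbreviation (input) "yV \<equiv> 8 :: nat"
abbreviation (input) "spV \<equiv> 9 :: nat"
abbreviation (input) "uV \<equiv> 10 :: nat"
abbreviation (input) "vV \<equiv> 11 :: nat"
abbreviation (input) "kV \<equiv> 12 :: nat"
abbreviation (input) "pV \<equiv> 13 :: nat"
abbreviation (input) "qV \<equiv> 14 :: nat"

text \<open>The arrays from \<open>accA\<close> on are not written while the automaton is loaded.
  Later phases rely on their initial zeros.\<close>

abbreviation (input) "rowA \<equiv> 20 :: nat"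
abbreviation (input) "deltaA \<equiv> 21 :: nat"
abbreviation (input) "finA \<equiv> 22 :: nat"
abbreviation (input) "accA \<equiv> 23 :: nat"
abbreviation (input) "degA \<equiv> 24 :: nat"
abbreviation (input) "stackA \<equiv> 25 :: nat"
abbreviation (input) "liveA \<equiv> 26 :: nat"
abbreviation (input) "parA \<equiv> 27 :: nat"
abbreviation (input) "sizeA \<equiv> 28 :: nat"
abbreviation (input) "inA \<equiv> 29 :: nat"
abbreviation (input) "leftA \<equiv> 30 :: nat"
abbreviation (input) "rightA \<equiv> 31 :: nat"
abbreviation (input) "markA \<equiv> 32 :: nat"
abbreviation (input) "labA \<equiv> 33 :: nat"

text \<open>Tabulates the multiples of \<open>b\<close> by repeated addition, so that a table entry
  is addressed in constant time without multiplication.\<close>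

definition load_rows :: com where
  "load_rows = For xV (Var DV) (Put rowA (Plus (Var xV) (Num 1)) (Plus (Arr rowA (Var xV)) (Var bV)))"

text \<open>The input already writes the number of states for a missing transition, so completing
  the automaton takes no more than a row for that number.\<close>

definition load_sink :: com where
  "load_sink = For kV (Var bV) (Put deltaA (Plus (Arr rowA (Var nV)) (Var kV)) (Var nV))"

text \<open>The row of \<open>N + q\<close> is the row of \<open>q\<close> moved by one letter, so a
  copy of the whole table with offset 1 fills all rows at once. Only the last entry of each row is
  wrong.\<close>

definition load_shifted :: com where
  "load_shifted = For kV (Arr rowA (Var NV))
     (Put deltaA (Plus (Arr rowA (Var NV)) (Var kV)) (Arr deltaA (Plus (Var kV) (Num 1))))"

text \<open>Repairs these last entries, which belong to the carry. The entry before the beginning of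
  the next row is the one to be changed.\<close>

definition load_carry :: com where
  "load_carry = For xV (Var NV)
     (Put deltaA (Minus (Arr rowA (Plus (Plus (Var NV) (Var xV)) (Num 1))) (Num 1))
        (Plus (Var NV) (Arr deltaA (Arr rowA (Var xV)))))"

definition load :: com where
  "load = Get bV (Num 0) ;; Get nV (Num 0) ;; Get iV (Num 0) ;;
     NV ::= Plus (Var nV) (Num 1) ;; DV ::= Plus (Var NV) (Var NV) ;;
     load_rows ;;
     For kV (Arr rowA (Var nV)) (Get deltaA (Var kV)) ;;
     load_sink ;;
     For xV (Var nV) (Get finA (Var xV)) ;;
     load_shifted ;;
     load_carry"

section \<open>Correctness of the loading phase\<close>

lemma next_input_drop: "i < length xs \<Longrightarrow> next_input (drop i xs) = xs ! i"
  by (simp add: next_input_def Cons_nth_drop_Suc[symmetric])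

lemma wp_read_array:
  assumes "j \<noteq> v" "K \<le> length xs"
    "\<And>M'. unchanged {v, j} M M' \<Longrightarrow> aval M' e = K"
  shows "wp (For v e (Get j (Var v)))
     (\<lambda>M' xs' _. xs' = drop K xs \<and> (\<forall>k. M' j k = (if k < K then xs ! k else M j k))) M xs (3 * K + 2)"
proof (rule wp_For[where K = K and C = 1 and
      I = "\<lambda>i M' xs'. xs' = drop i xs \<and> (\<forall>k. M' j k = (if k < i then xs ! k else M j k))"])
qed (use assms in \<open>auto simp: next_input_drop less_Suc_eq drop_Suc tl_drop\<close>)

lemma wp_load_rows:
  assumes "M rowA 0 = 0"
  shows "wp load_rows (\<lambda>M' xs' _. xs' = xs \<and> (\<forall>x\<le>M DV 0. M' rowA x = x * M bV 0)) M xs (3 * M DV 0 + 2)"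
  unfolding load_rows_def
proof (rule wp_For[where K = "M DV 0" and C = 1 and
      I = "\<lambda>i M' xs'. xs' = xs \<and> (\<forall>x\<le>i. M' rowA x = x * M bV 0)"])
qed (use assms in \<open>auto simp: le_Suc_eq\<close>)

lemma wp_load_sink:
  "wp load_sink (\<lambda>M' xs' _. xs' = xs \<and> (\<forall>k. M' deltaA k =
       (if M rowA (M nV 0) \<le> k \<and> k < M rowA (M nV 0) + M bV 0 then M nV 0 else M deltaA k)))
     M xs (3 * M bV 0 + 2)"
  unfolding load_sink_def
proof (rule wp_For[where K = "M bV 0" and C = 1 and
      I = "\<lambda>i M' xs'. xs' = xs \<and> (\<forall>k. M' deltaA k =
       (if M rowA (M nV 0) \<le> k \<and> k < M rowA (M nV 0) + i then M nV 0 else M deltaA k))"])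
qed auto

lemma wp_load_shifted:
  assumes "K = M rowA (M NV 0)" "K > 0"
  shows "wp load_shifted (\<lambda>M' xs' _. xs' = xs \<and> (\<forall>k<K. M' deltaA k = M deltaA k) \<and>
       (\<forall>k<K-1. M' deltaA (K + k) = M deltaA (k + 1))) M xs (3 * K + 2)"
  unfolding load_shifted_def
proof (rule wp_For[where K = K and C = 1 and
      I = "\<lambda>i M' xs'. xs' = xs \<and> (\<forall>k<K. M' deltaA k = M deltaA k) \<and>
       (\<forall>k<i. k < K - 1 \<longrightarrow> M' deltaA (K + k) = M deltaA (k + 1))"])
qed (use assms in \<open>auto simp: less_Suc_eq\<close>)

lemma index_eq_iff:
  fixes x x' a a' B :: nat
  assumes "a < B" "a' < B"
  shows "x * B + a = x' * B + a' \<longleftrightarrow> x = x' \<and> a = a'"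
proof
  assume eq: "x * B + a = x' * B + a'"
  have "(x * B + a) div B = x" "(x' * B + a') div B = x'"
    using assms by simp_all
  then have "x = x'"
    using eq by simp
  then show "x = x' \<and> a = a'"
    using eq by simp
qed simp

lemma index_less:
  fixes x n a B :: nat
  assumes "x < n" "a < B"
  shows "x * B + a < n * B"
proof -
  have "x * B + a < Suc x * B"
    using assms(2) by simp
  also have "\<dots> \<le> n * B"
    using assms(1) by (intro mult_le_mono1) simp
  finally show ?thesis .
qed

lemma wp_load_carry:
  assumes N: "N = M NV 0" and row: "\<forall>x\<le>2 * N. M rowA x = x * B" and B: "B > 1"
  shows "wp load_carry (\<lambda>M' xs' _. xs' = xs \<and> (\<forall>x<2 * N. \<forall>a<B. M' deltaA (x * B + a) =
       (if N \<le> x \<and> Suc a = B then N + M deltaA ((x - N) * B) else M deltaA (x * B + a))))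
     M xs (3 * N + 2)"
  unfolding load_carry_def
proof (rule wp_For[where K = N and C = 1 and
      I = "\<lambda>i M' xs'. xs' = xs \<and> (\<forall>x<2 * N. \<forall>a<B. M' deltaA (x * B + a) =
       (if N \<le> x \<and> x < N + i \<and> Suc a = B then N + M deltaA ((x - N) * B)
        else M deltaA (x * B + a)))"])
  let ?I = "\<lambda>i M' xs'. xs' = xs \<and> (\<forall>x<2 * N. \<forall>a<B. M' deltaA (x * B + a) =
       (if N \<le> x \<and> x < N + i \<and> Suc a = B then N + M deltaA ((x - N) * B)
        else M deltaA (x * B + a)))"
  let ?body = "Put deltaA (Minus (Arr rowA (Plus (Plus (Var NV) (Var xV)) (Num 1))) (Num 1))
      (Plus (Var NV) (Arr deltaA (Arr rowA (Var xV))))"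
  fix i M' xs'
  assume i: "i < N" "M' xV 0 = i"
    and I: "?I i M' xs'"
    and un: "unchanged (insert xV (writes ?body)) M M'"
  have "(N + i + 1) * B - 1 = (N + i) * B + (B - 1)"
    using B by (cases B) simp_all
  then have row': "M rowA (Suc (N + i)) - Suc 0 = (N + i) * B + (B - 1)"
    using row i by simp
  have D: "M' deltaA (i * B) = M deltaA (i * B)"
    using I[THEN conjunct2, rule_format, of i 0] i B by simp
  have "x * B + a = (N + i) * B + (B - 1) \<longleftrightarrow> x = N + i \<and> Suc a = B" if "a < B" for x a
    using index_eq_iff[of a B "B - 1" x "N + i"] that B by auto
  then show "wp ?body (\<lambda>M'' xs'' _. ?I (Suc i) (upd M'' xV 0 (Suc i)) xs'') M' xs' 1"
    using un i I N row row' D by (auto simp: less_Suc_eq)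
qed (use assms in auto)

lemma table_length: "length (concat (map (\<lambda>q. map (f q) [0..<b]) [0..<n])) = n * b"
  by (induction n) auto

lemma table_nth:
  "q < n \<Longrightarrow> a < b \<Longrightarrow> concat (map (\<lambda>q. map (f q) [0..<b]) [0..<n]) ! (q * b + a) = f q a"
proof (induction n)
  case (Suc n)
  then show ?case
    using table_length[of f b n] index_less[of q n a b]
    by (cases "q = n") (auto simp: nth_append)
qed simp

context digit_automaton
begin

definition loaded :: "mem \<Rightarrow> bool" where
  "loaded M \<longleftrightarrow> M bV 0 = b \<and> M iV 0 = i0 \<and> M NV 0 = N \<and> M DV 0 = 2 * N \<and>
     (\<forall>x\<le>2 * N. M rowA x = x * b) \<and>
     (\<forall>x<2 * N. \<forall>a<b. M deltaA (x * b + a) = doubled x a) \<and>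
     (\<forall>q<N. M finA q = of_bool (fin q))"

lemma loaded_cong:
  assumes "loaded M" "unchanged W M M'" "W \<inter> {bV, iV, NV, DV, rowA, deltaA, finA} = {}"
  shows "loaded M'"
proof -
  have "M' j = M j" if "j \<in> {bV, iV, NV, DV, rowA, deltaA, finA}" for j
    using assms(2,3) that by blast
  then show ?thesis
    using assms(1) unfolding loaded_def by simp
qed

lemma wp_load:
  assumes xs: "xs = [b, n, i0] @ concat (map (\<lambda>q. map (\<delta> q) [0..<b]) [0..<n]) @
      map (\<lambda>q. if fin q then 1 else 0) [0..<n]"
    and n: "N = Suc n" and sink: "\<And>a. a < b \<Longrightarrow> \<delta> n a = n" "\<not> fin n"
  shows "wp load (\<lambda>M' _ _. loaded M' \<and> (\<forall>j. j = resV \<or> j = spV \<or> j \<ge> accA \<longrightarrow> M' j = (\<lambda>_. 0)))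
      (\<lambda>_ _. 0) xs (30 * b * N)"
proof -
  let ?tab = "concat (map (\<lambda>q. map (\<delta> q) [0..<b]) [0..<n])"
  let ?fin = "map (\<lambda>q. if fin q then 1 else 0 :: nat) [0..<n]"
  let ?head = "Get bV (Num 0) ;; Get nV (Num 0) ;; Get iV (Num 0) ;;
     NV ::= Plus (Var nV) (Num 1) ;; DV ::= Plus (Var NV) (Var NV)"
  have "wp ?head (\<lambda>M' xs' _. xs' = ?tab @ ?fin \<and> M' bV 0 = b \<and> M' nV 0 = n \<and> M' iV 0 = i0 \<and>
      M' NV 0 = N \<and> M' DV 0 = 2 * N) (\<lambda>_ _. 0) xs 5"
    by (simp add: xs n next_input_def)
  then obtain M1 xs1 where r1: "runs ?head 5 (\<lambda>_ _. 0) xs M1 xs1"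
    and p1: "xs1 = ?tab @ ?fin" "M1 bV 0 = b" "M1 nV 0 = n" "M1 iV 0 = i0" "M1 NV 0 = N" "M1 DV 0 = 2 * N"
    and u1: "unchanged (writes ?head) (\<lambda>_ _. 0) M1"
    by (rule wpE) blast
  have z1: "M1 rowA 0 = 0"
    using u1 by simp
  obtain M2 xs2 where r2: "runs load_rows (3 * (2 * N) + 2) M1 xs1 M2 xs2"
    and p2: "xs2 = xs1" "\<forall>x\<le>2 * N. M2 rowA x = x * b"
    and u2: "unchanged (writes load_rows) M1 M2"
    by (rule wpE[OF wp_load_rows[of M1 xs1, OF z1, unfolded p1(2,6)]]) blast
  have e2: "M2 rowA n = n * b" "M2 nV 0 = n" "M2 NV 0 = N" "M2 bV 0 = b"
    using p1 p2 u2 n by (simp_all add: load_rows_def)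
  have "wp (For kV (Arr rowA (Var nV)) (Get deltaA (Var kV))) (\<lambda>M' xs' _. xs' = drop (n * b) xs2 \<and>
      (\<forall>k. M' deltaA k = (if k < n * b then xs2 ! k else M2 deltaA k))) M2 xs2 (3 * (n * b) + 2)"
    by (rule wp_read_array) (use e2 p1 p2 in \<open>simp_all add: table_length\<close>)
  then obtain M3 xs3 where r3: "runs (For kV (Arr rowA (Var nV)) (Get deltaA (Var kV))) (3 * (n * b) + 2) M2 xs2 M3 xs3"
    and p3: "xs3 = ?fin" "\<forall>k<n * b. M3 deltaA k = ?tab ! k"
    and u3: "unchanged {kV, deltaA} M2 M3"
    by (rule wpE) (simp add: p2 p1 table_length nth_append)
  have e3: "M3 rowA n = n * b" "M3 nV 0 = n" "M3 bV 0 = b"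
    using e2 u3 by simp_all
  obtain M4 xs4 where r4: "runs load_sink (3 * b + 2) M3 xs3 M4 xs4"
    and p4: "xs4 = xs3" "\<forall>k. M4 deltaA k = (if n * b \<le> k \<and> k < n * b + b then n else M3 deltaA k)"
    and u4: "unchanged (writes load_sink) M3 M4"
    by (rule wpE[OF wp_load_sink[of xs3 M3, unfolded e3]]) blast
  have e4: "M4 nV 0 = n" "M4 NV 0 = N" "M4 rowA N = N * b"
    using e2 u3 u4 p2 n by (simp_all add: load_sink_def)
  have d4: "M4 deltaA (q * b + a) = \<delta> q a" if "q < N" "a < b" for q a
  proof (cases "q = n")
    case True
    then show ?thesis
      using p4 that sink by simp
  next
    case False
    then have "q < n"
      using that n by simp
    then show ?thesis
      using p4(2) p3(2) index_less[of q n a b] table_nth[of q n a b \<delta>] that by simp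
  qed
  have "wp (For xV (Var nV) (Get finA (Var xV))) (\<lambda>M' xs' _. xs' = drop n xs4 \<and>
      (\<forall>k. M' finA k = (if k < n then xs4 ! k else M4 finA k))) M4 xs4 (3 * n + 2)"
    by (rule wp_read_array) (use e4 p3 p4 in simp_all)
  then obtain M5 xs5 where r5: "runs (For xV (Var nV) (Get finA (Var xV))) (3 * n + 2) M4 xs4 M5 xs5"
    and p5: "\<forall>k. M5 finA k = (if k < n then ?fin ! k else M4 finA k)"
    and u5: "unchanged {xV, finA} M4 M5"
    by (rule wpE) (simp add: p3 p4)
  have e5: "M5 rowA (M5 NV 0) = N * b" "M5 NV 0 = N"
    using e4 u5 by simp_all
  have Nb: "N * b > 0"
    using n b by simp
  obtain M6 xs6 where r6: "runs load_shifted (3 * (N * b) + 2) M5 xs5 M6 xs6"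
    and p6: "\<forall>k<N * b. M6 deltaA k = M5 deltaA k" "\<forall>k<N * b-1. M6 deltaA (N * b + k) = M5 deltaA (k + 1)"
    and u6: "unchanged (writes load_shifted) M5 M6"
    by (rule wpE[OF wp_load_shifted[of "N * b" M5, OF e5(1)[symmetric] Nb]]) blast
  have e6: "N = M6 NV 0" "\<forall>x\<le>2 * N. M6 rowA x = x * b"
    using e5 p2 u3 u4 u5 u6 by (simp_all add: load_shifted_def load_sink_def)
  obtain M7 xs7 where r7: "runs load_carry (3 * N + 2) M6 xs6 M7 xs7"
    and p7: "\<forall>x<2 * N. \<forall>a<b. M7 deltaA (x * b + a) =
       (if N \<le> x \<and> Suc a = b then N + M6 deltaA ((x - N) * b) else M6 deltaA (x * b + a))"
    and u7: "unchanged (writes load_carry) M6 M7"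
    by (rule wpE[OF wp_load_carry[of N M6, OF e6 b]]) blast
  have D: "M6 deltaA (q * b + a) = \<delta> q a" if "q < N" "a < b" for q a
    using p6(1) d4[OF that] u5 index_less[OF that] by simp
  have "M7 deltaA (x * b + a) = doubled x a" if x: "x < 2 * N" and a: "a < b" for x a
  proof (cases "x < N")
    case True
    then show ?thesis
      using p7 D x a by (simp add: doubled_def)
  next
    case False
    then have xN: "x - N < N" and x_eq: "x = N + (x - N)"
      using x by auto
    show ?thesis
    proof (cases "Suc a < b")
      case True
      have "(x - N) * b + a < N * b - 1"
        using index_less[OF xN True] by simp
      then have "M6 deltaA (N * b + ((x - N) * b + a)) = M5 deltaA ((x - N) * b + a + 1)"
        using p6(2) by blast
      moreover have "x * b + a = N * b + ((x - N) * b + a)"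
        by (subst x_eq) (simp add: add_mult_distrib)
      ultimately have "M6 deltaA (x * b + a) = M5 deltaA ((x - N) * b + Suc a)"
        by (simp add: add.assoc)
      also have "\<dots> = \<delta> (x - N) (Suc a)"
        using d4[OF xN True] u5 by simp
      finally show ?thesis
        using p7 x a False True by (simp add: doubled_def)
    next
      case False
      then show ?thesis
        using p7 x a \<open>\<not> x < N\<close> D[OF xN, of 0] b by (simp add: doubled_def)
    qed
  qed
  moreover have "M7 finA q = of_bool (fin q)" if "q < N" for q
  proof -
    have "M7 finA q = M5 finA q"
      using u6 u7 by (simp add: load_shifted_def load_carry_def)
    moreover have "M4 finA = (\<lambda>_. 0)"
      using u1 u2 u3 u4 by (simp add: load_rows_def load_sink_def)
    ultimately show ?thesis
      using p5 that sink(2) n by (cases "q = n") auto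
  qed
  moreover have "M7 bV 0 = b" "M7 iV 0 = i0" "M7 NV 0 = N" "M7 DV 0 = 2 * N"
      "\<forall>x\<le>2 * N. M7 rowA x = x * b"
    using p1 p2 u2 u3 u4 u5 u6 u7
    by (simp_all add: load_rows_def load_sink_def load_shifted_def load_carry_def)
  moreover have "M7 j = (\<lambda>_. 0)" if "j = resV \<or> j = spV \<or> j \<ge> accA" for j
  proof -
    have "j \<noteq> bV" "j \<noteq> nV" "j \<noteq> iV" "j \<noteq> NV" "j \<noteq> DV" "j \<noteq> xV" "j \<noteq> kV" "j \<noteq> rowA" "j \<noteq> deltaA" "j \<noteq> finA"
      using that by auto
    then show ?thesis
      using u1 u2 u3 u4 u5 u6 u7
      by (simp add: load_rows_def load_sink_def load_shifted_def load_carry_def)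
  qed
  ultimately have post: "loaded M7 \<and> (\<forall>j. j = resV \<or> j = spV \<or> j \<ge> accA \<longrightarrow> M7 j = (\<lambda>_. 0))"
    unfolding loaded_def by blast
  have "runs (?head ;; load_rows ;; For kV (Arr rowA (Var nV)) (Get deltaA (Var kV)) ;; load_sink ;;
     For xV (Var nV) (Get finA (Var xV)) ;; load_shifted ;; load_carry)
     (5 + ((3 * (2 * N) + 2) + ((3 * (n * b) + 2) + ((3 * b + 2) + ((3 * n + 2) +
       ((3 * (N * b) + 2) + (3 * N + 2))))))) (\<lambda>_ _. 0) xs M7 xs7"
    by (intro runs_Seq[OF r1] runs_Seq[OF r2] runs_Seq[OF r3] runs_Seq[OF r4] runs_Seq[OF r5]
        runs_Seq[OF r6] r7)
  moreover have "5 + ((3 * (2 * N) + 2) + ((3 * (n * b) + 2) + ((3 * b + 2) + ((3 * n + 2) +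
       ((3 * (N * b) + 2) + (3 * N + 2)))))) \<le> 30 * b * N"
  proof -
    obtain c d where "b = Suc (Suc c)" "N = Suc d"
      by (rule sizes_cases)
    then show ?thesis
      by (simp add: n algebra_simps)
  qed
  ultimately have "wp (?head ;; load_rows ;; For kV (Arr rowA (Var nV)) (Get deltaA (Var kV)) ;; load_sink ;;
     For xV (Var nV) (Get finA (Var xV)) ;; load_shifted ;; load_carry)
     (\<lambda>M' _ _. loaded M' \<and> (\<forall>j. j = resV \<or> j = spV \<or> j \<ge> accA \<longrightarrow> M' j = (\<lambda>_. 0))) (\<lambda>_ _. 0) xs (30 * b * N)"
    using post by (intro wpI) (rule runs_mono)
  then show ?thesis
    unfolding load_def by simp
qed

end

section \<open>Accessible and recurrent states\<close>

abbreviation deltaE :: "exp \<Rightarrow> exp \<Rightarrow> exp" where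
  "deltaE x a \<equiv> Arr deltaA (Plus (Arr rowA x) a)"

text \<open>The sum of both truncated differences is positive exactly when the values
  differ.\<close>

abbreviation distE :: "exp \<Rightarrow> exp \<Rightarrow> exp" where
  "distE e f \<equiv> Plus (Minus e f) (Minus f e)"

abbreviation push :: "nat \<Rightarrow> com" where
  "push v \<equiv> Put stackA (Var spV) (Var v) ;; spV ::= Plus (Var spV) (Num 1)"

definition visit :: com where
  "visit = yV ::= deltaE (Var xV) (Var aV) ;;
     Cond (Arr accA (Var yV)) Skip (Put accA (Var yV) (Num 1) ;; push yV)"

definition search :: com where
  "search = Put accA (Var iV) (Num 1) ;; Put stackA (Num 0) (Var iV) ;; spV ::= Num 1 ;;
     Loop (Var spV)
       (spV ::= Minus (Var spV) (Num 1) ;; xV ::= Arr stackA (Var spV) ;; For aV (Var bV) visit)"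

definition check_zeros :: com where
  "check_zeros = For xV (Var NV)
     (Cond (Arr accA (Var xV))
       (Cond (distE (Arr finA (Var xV)) (Arr finA (deltaE (Var xV) (Num 0)))) (resV ::= Num 1) Skip)
       Skip)"

definition count_edges :: com where
  "count_edges = For aV (Var bV)
     (yV ::= deltaE (Var xV) (Var aV) ;; Put degA (Var yV) (Plus (Arr degA (Var yV)) (Num 1)))"

definition degrees :: com where
  "degrees = For xV (Var NV) (Cond (Arr accA (Var xV)) (Put liveA (Var xV) (Num 1) ;; count_edges) Skip)"

definition remove_edge :: com where
  "remove_edge = yV ::= deltaE (Var xV) (Var aV) ;;
     Put degA (Var yV) (Minus (Arr degA (Var yV)) (Num 1)) ;;
     Cond (Arr degA (Var yV)) Skip (push yV)"

text \<open>The initial state is the only reachable state that can lack incoming edges at the start,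
  so it is the only candidate for the initial stack.\<close>

definition peel :: com where
  "peel = Cond (Arr degA (Var iV)) Skip (Put stackA (Num 0) (Var iV) ;; spV ::= Num 1) ;;
     Loop (Var spV)
       (spV ::= Minus (Var spV) (Num 1) ;; xV ::= Arr stackA (Var spV) ;;
        Put liveA (Var xV) (Num 0) ;; For aV (Var bV) remove_edge)"

text \<open>Otherwise the simplifier turns updated arrays into abstractions, which no rule matches.\<close>

declare fun_upd_apply [simp del] fun_upd_same [simp] fun_upd_other [simp]

definition stack_of :: "(nat \<Rightarrow> nat) \<Rightarrow> nat \<Rightarrow> nat list" where
  "stack_of f n = map f [0..<n]"

lemma stack_of_0 [simp]: "stack_of f 0 = []"
  by (simp add: stack_of_def)

lemma stack_of_push [simp]: "stack_of (f(n := y)) (Suc n) = stack_of f n @ [y]"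
  by (simp add: stack_of_def)

lemma stack_of_pop: "n > 0 \<Longrightarrow> stack_of f n = stack_of f (n - 1) @ [f (n - 1)]"
  by (cases n) (simp_all add: stack_of_def)

abbreviation stack :: "mem \<Rightarrow> nat list" where
  "stack M \<equiv> stack_of (M stackA) (M spV 0)"

definition support :: "(nat \<Rightarrow> nat) \<Rightarrow> nat set" where
  "support f = {q. 0 < f q}"

lemma support_zero [simp]: "support (\<lambda>_. 0) = {}"
  by (simp add: support_def)

lemma support_upd [simp]:
  "support (f(y := c)) = (if c > 0 then insert y (support f) else support f - {y})"
  by (auto simp: support_def fun_upd_apply)

lemma support_pos [simp]:
  "0 < M accA q \<longleftrightarrow> q \<in> support (M accA)"
  "0 < M liveA q \<longleftrightarrow> q \<in> support (M liveA)"
  "0 < M markA q \<longleftrightarrow> q \<in> support (M markA)"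
  by (simp_all add: support_def)

section \<open>Correctness of the search and of the test for zero closure\<close>

context digit_automaton
begin

lemma loaded_delta: "loaded M \<Longrightarrow> x < N \<Longrightarrow> a < b \<Longrightarrow> M deltaA (M rowA x + a) = \<delta> x a"
  by (simp add: loaded_def doubled_def)

lemma loaded_simps:
  assumes "loaded M"
  shows "M bV 0 = b" "M iV 0 = i0" "M NV 0 = N" "M DV 0 = 2 * N" "q < N \<Longrightarrow> M finA q = of_bool (fin q)"
  using assms by (simp_all add: loaded_def)

lemma finite_reachable: "finite reachable"
  using reachable_less by (meson bounded_nat_set_is_finite)

text \<open>\<open>A\<close> holds the discovered states and \<open>s\<close> those still to be
  expanded. \<open>P\<close> are the popped ones including the current \<open>x\<close>, of whose
  edges only those with letters below \<open>i\<close> have been followed.\<close>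

definition visited :: "nat set \<Rightarrow> nat \<Rightarrow> nat \<Rightarrow> nat set \<Rightarrow> nat list \<Rightarrow> bool" where
  "visited P x i A s \<longleftrightarrow> distinct s \<and> set s \<subseteq> A \<and> A \<subseteq> reachable \<and> i0 \<in> A \<and> A - set s = P \<and> x \<in> P \<and>
     (\<forall>q\<in>P - {x}. \<forall>a<b. \<delta> q a \<in> A) \<and> (\<forall>a<i. \<delta> x a \<in> A)"

lemma visited_skip: "visited P x i A s \<Longrightarrow> \<delta> x i \<in> A \<Longrightarrow> visited P x (Suc i) A s"
  unfolding visited_def by (auto simp: less_Suc_eq)

lemma visited_push:
  assumes "visited P x i A s" "\<delta> x i \<notin> A" "i < b"
  shows "visited P x (Suc i) (insert (\<delta> x i) A) (s @ [\<delta> x i])"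
proof -
  have "\<delta> x i \<in> reachable"
    using assms unfolding visited_def by (blast intro: reachable_step)
  then show ?thesis
    using assms unfolding visited_def by (auto simp: less_Suc_eq)
qed

lemma wp_visits:
  assumes M: "loaded M" and x: "M xV 0 = x" "x < N" and v: "visited P x 0 (support (M accA)) (stack M)"
  shows "wp (For aV (Var bV) visit)
     (\<lambda>M' xs' _. visited P x b (support (M' accA)) (stack M')) M xs (7 * b + 2)"
proof (rule wp_For[where K = b and C = 5 and
      I = "\<lambda>i M' xs'. visited P x i (support (M' accA)) (stack M')"])
  fix i M' xs'
  assume i: "i < b" "M' aV 0 = i" and I: "visited P x i (support (M' accA)) (stack M')"
    and un: "unchanged (insert aV (writes visit)) M M'"
  have y: "M deltaA (M rowA x + i) = \<delta> x i"
    using loaded_delta[OF M x(2) i(1)] .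
  show "wp visit (\<lambda>M'' xs'' _. visited P x (Suc i) (support (upd M'' aV 0 (Suc i) accA))
      (stack (upd M'' aV 0 (Suc i)))) M' xs' 5"
    using un i x y visited_skip[OF I] visited_push[OF I _ i(1)]
    by (auto simp: visit_def)
qed (use assms in \<open>auto simp: visit_def loaded_simps\<close>)

lemma wp_search:
  assumes M: "loaded M" "M accA = (\<lambda>_. 0)"
  shows "wp search (\<lambda>M' _ _. loaded M' \<and> support (M' accA) = reachable \<and> M' spV 0 = 0) M xs (20 * b * N)"
proof -
  let ?body = "spV ::= Minus (Var spV) (Num 1) ;; xV ::= Arr stackA (Var spV) ;; For aV (Var bV) visit"
  let ?inv = "\<lambda>A s. distinct s \<and> set s \<subseteq> A \<and> A \<subseteq> reachable \<and> i0 \<in> A \<and>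
     (\<forall>q\<in>A - set s. \<forall>a<b. \<delta> q a \<in> A)"
  \<comment> \<open>Credits of \<open>7 * b + 5\<close> are reserved for each state not yet popped.
    The popped states are the discovered ones off the stack, and none of them returns to it.\<close>
  let ?I = "\<lambda>M' xs' T'. ?inv (support (M' accA)) (stack M') \<and>
     (N - card (support (M' accA) - set (stack M'))) * (7 * b + 5) + 1 \<le> T'"
  define M1 where "M1 = upd (upd (upd M accA i0 1) stackA 0 i0) spV 0 1"
  have M1: "loaded M1"
    using loaded_cong[OF M(1), of "{accA, stackA, spV}" M1] by (simp add: M1_def)
  have "wp (Loop (Var spV) ?body)
      (\<lambda>M' _ _. loaded M' \<and> support (M' accA) = reachable \<and> M' spV 0 = 0) M1 xs (20 * b * N - Suc (Suc (Suc 0)))"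
  proof (rule wp_Loop[where I = ?I])
    have "support (M1 accA) = {i0}" "stack M1 = [i0]"
      using M(2) stack_of_push[of "M stackA" 0 i0] by (simp_all add: M1_def)
    moreover have "N * (7 * b + 5) + 1 \<le> 20 * b * N - Suc (Suc (Suc 0))"
    proof -
      obtain c d where "b = Suc (Suc c)" "N = Suc d"
        by (rule sizes_cases)
      then show ?thesis
        by (simp add: algebra_simps)
    qed
    ultimately show "?I M1 xs (20 * b * N - Suc (Suc (Suc 0)))"
      using i0_reachable by simp
  next
    fix M' xs' T'
    assume I: "?I M' xs' T'" and un: "unchanged (writes ?body) M1 M'" and "0 < aval M' (Var spV)"
    then have sp: "M' spV 0 > 0"
      by simp
    have M': "loaded M'"
      by (rule loaded_cong[OF M1 un]) (simp add: visit_def)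
    define x where "x = M' stackA (M' spV 0 - 1)"
    define A where "A = support (M' accA)"
    define s where "s = stack_of (M' stackA) (M' spV 0 - 1)"
    have s: "stack M' = s @ [x]"
      using stack_of_pop[OF sp] by (simp add: s_def x_def)
    define P where "P = A - set s"
    have P: "P = insert x (A - set (stack M'))" "x \<notin> A - set (stack M')"
      using I by (auto simp: P_def s A_def[symmetric])
    have PN: "P \<subseteq> {..<N}" "finite P"
      using I reachable_less finite_reachable finite_subset unfolding P_def A_def by blast+
    have x: "x < N"
      using PN P by auto
    have card: "card P = Suc (card (A - set (stack M')))" "card P \<le> N"
      using P PN card_mono[of "{..<N}" P] by simp_all
    define M2 where "M2 = upd (upd M' spV 0 (M' spV 0 - 1)) xV 0 x"
    have M2: "loaded M2"
      using loaded_cong[OF M', of "{spV, xV}" M2] by (simp add: M2_def)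
    have "visited P x 0 (support (M2 accA)) (stack M2)"
      using I unfolding visited_def A_def[symmetric] P_def s by (auto simp: M2_def A_def s_def)
    then have wp: "wp (For aV (Var bV) visit)
        (\<lambda>M' xs' _. visited P x b (support (M' accA)) (stack M')) M2 xs' (7 * b + 2)"
      using M2 x by (intro wp_visits) (simp_all add: M2_def)
    have T: "(N - card P) * (7 * b + 5) + 1 + (7 * b + 5) \<le> T'"
    proof -
      have "N - card (A - set (stack M')) = Suc (N - card P)"
        using card by simp
      then show ?thesis
        using I by (simp add: A_def)
    qed
    have "wp (For aV (Var bV) visit) ?I M2 xs' (T' - Suc (Suc (Suc 0)))"
    proof (rule wp_weaken[OF wp])
      fix M3 xs3 T3
      assume v: "visited P x b (support (M3 accA)) (stack M3)" and T3: "T' - Suc (Suc (Suc 0)) - (7 * b + 2) \<le> T3"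
      have "?inv (support (M3 accA)) (stack M3)" "support (M3 accA) - set (stack M3) = P"
        using v unfolding visited_def by auto
      then show "?I M3 xs3 T3"
        using T T3 by simp
    qed (use T in simp)
    then show "0 < T' \<and> wp ?body ?I M' xs' (T' - 1)"
      using T by (simp add: M2_def x_def)
  next
    fix M' xs' T'
    assume I: "?I M' xs' T'" and un: "unchanged (writes ?body) M1 M'" and "aval M' (Var spV) = 0"
    then have sp: "M' spV 0 = 0"
      by simp
    have "loaded M'"
      by (rule loaded_cong[OF M1 un]) (simp add: visit_def)
    moreover have "reachable \<subseteq> support (M' accA)"
      using I sp by (intro reachable_least) auto
    ultimately show "0 < T' \<and> loaded M' \<and> support (M' accA) = reachable \<and> M' spV 0 = 0"
      using I sp by auto
  qed
  moreover have "3 < 20 * b * N"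
    using b i0 by (cases N) auto
  ultimately show ?thesis
    using loaded_simps[OF M(1)] b i0 by (simp add: search_def M1_def)
qed

lemma wp_check_zeros:
  assumes M: "loaded M" "support (M accA) = reachable" "M resV 0 = 0"
  shows "wp check_zeros (\<lambda>M' _ _. M' resV 0 = 0 \<longleftrightarrow> zero_closed) M xs (5 * N + 2)"
  unfolding check_zeros_def
proof (rule wp_For[where K = N and C = 3 and
      I = "\<lambda>i M' xs'. M' resV 0 = 0 \<longleftrightarrow> (\<forall>q\<in>reachable. q < i \<longrightarrow> fin (\<delta> q 0) = fin q)"])
  let ?body = "Cond (Arr accA (Var xV))
       (Cond (distE (Arr finA (Var xV)) (Arr finA (deltaE (Var xV) (Num 0)))) (resV ::= Num 1) Skip)
       Skip"
  fix i M' xs'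
  assume i: "i < N" "M' xV 0 = i"
    and I: "M' resV 0 = 0 \<longleftrightarrow> (\<forall>q\<in>reachable. q < i \<longrightarrow> fin (\<delta> q 0) = fin q)"
    and un: "unchanged (insert xV (writes ?body)) M M'"
  have y: "M deltaA (M rowA i) = \<delta> i 0" "\<delta> i 0 < N"
    using loaded_delta[OF M(1) i(1), of 0] \<delta>[OF i(1), of 0] b by simp_all
  show "wp ?body (\<lambda>M'' xs'' _. upd M'' xV 0 (Suc i) resV 0 = 0 \<longleftrightarrow>
      (\<forall>q\<in>reachable. q < Suc i \<longrightarrow> fin (\<delta> q 0) = fin q)) M' xs' 3"
    using un i y I M by (auto simp: less_Suc_eq loaded_simps)
next
  fix M' assume "M' resV 0 = 0 \<longleftrightarrow> (\<forall>q\<in>reachable. q < N \<longrightarrow> fin (\<delta> q 0) = fin q)"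
  then show "M' resV 0 = 0 \<longleftrightarrow> zero_closed"
    using reachable_less unfolding zero_closed_def by blast
qed (use M in \<open>auto simp: loaded_simps\<close>)

section \<open>Peeling off states without incoming edges\<close>

definition edges :: "nat \<Rightarrow> nat set \<Rightarrow> nat \<Rightarrow> nat" where
  "edges x I y = (\<Sum>a\<in>I. of_bool (\<delta> x a = y))"

text \<open>Parallel edges count separately, in accordance with a removal letter by letter.\<close>

definition indegree :: "nat set \<Rightarrow> nat \<Rightarrow> nat" where
  "indegree L y = (\<Sum>x\<in>L. edges x {..<b} y)"

lemma indegree_empty: "indegree {} = (\<lambda>_. 0)"
  by (simp add: indegree_def fun_eq_iff)

lemma indegree_0_iff: "finite L \<Longrightarrow> indegree L y = 0 \<longleftrightarrow> (\<forall>x\<in>L. \<forall>a<b. \<delta> x a \<noteq> y)"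
  by (auto simp: indegree_def edges_def)

lemma wp_count_edges:
  assumes M: "loaded M" "M xV 0 < N"
  shows "wp count_edges (\<lambda>M' _ _. \<forall>y. M' degA y = M degA y + edges (M xV 0) {..<b} y)
     M xs (4 * b + 2)"
  unfolding count_edges_def
proof (rule wp_For[where K = b and C = 2 and
      I = "\<lambda>i M' xs'. \<forall>y. M' degA y = M degA y + edges (M xV 0) {..<i} y"])
qed (use loaded_delta[OF M] loaded_simps[OF M(1)] in
    \<open>auto simp: edges_def fun_upd_apply lessThan_Suc\<close>)

lemma wp_degrees:
  assumes M: "loaded M" "support (M accA) = reachable" "M degA = (\<lambda>_. 0)" "M liveA = (\<lambda>_. 0)"
  shows "wp degrees (\<lambda>M' _ _. support (M' liveA) = reachable \<and> M' degA = indegree reachable)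
     M xs (20 * b * N)"
  unfolding degrees_def
proof (rule wp_For[where K = N and C = "4 * b + 4" and
      I = "\<lambda>i M' xs'. support (M' liveA) = reachable \<inter> {..<i} \<and>
         M' degA = indegree (reachable \<inter> {..<i})"])
  let ?I = "\<lambda>i M'. support (M' liveA) = reachable \<inter> {..<i} \<and> M' degA = indegree (reachable \<inter> {..<i})"
  let ?body = "Cond (Arr accA (Var xV)) (Put liveA (Var xV) (Num 1) ;; count_edges) Skip"
  fix i M' xs'
  assume i: "i < N" "M' xV 0 = i"
    and I: "?I i M'"
    and un: "unchanged (insert xV (writes ?body)) M M'"
  have M': "loaded M'"
    by (rule loaded_cong[OF M(1) un]) (simp add: count_edges_def)
  have acc: "support (M' accA) = reachable"
    using M(2) un by (simp add: count_edges_def)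
  show "wp ?body (\<lambda>M'' xs'' _. ?I (Suc i) (upd M'' xV 0 (Suc i))) M' xs' (4 * b + 4)"
  proof (cases "i \<in> reachable")
    case False
    then have "reachable \<inter> {..<Suc i} = reachable \<inter> {..<i}"
      by (auto simp: less_Suc_eq)
    then show ?thesis
      using False acc i I by simp
  next
    case True
    then have R: "reachable \<inter> {..<Suc i} = insert i (reachable \<inter> {..<i})"
      by (auto simp: less_Suc_eq)
    define M1 where "M1 = upd M' liveA i 1"
    have "loaded M1"
      using loaded_cong[OF M', of "{liveA}" M1] by (simp add: M1_def)
    then have wp: "wp count_edges (\<lambda>M' _ _. \<forall>y. M' degA y = M1 degA y +
        edges (M1 xV 0) {..<b} y) M1 xs' (4 * b + 2)"
      by (rule wp_count_edges) (simp add: M1_def i)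
    have "wp count_edges (\<lambda>M'' xs'' _. ?I (Suc i) M'') M1 xs' (4 * b + 2)"
      by (rule wp_weaken[OF wp]) (use I i in \<open>auto simp: M1_def R count_edges_def indegree_def\<close>)
    then show ?thesis
      using True acc i by (simp add: M1_def)
  qed
next
  have "reachable \<inter> {..<N} = reachable"
    using reachable_less by auto
  then show "support (M' liveA) = reachable \<and> M' degA = indegree reachable"
    if "support (M' liveA) = reachable \<inter> {..<N} \<and> M' degA = indegree (reachable \<inter> {..<N})" for M'
    using that by simp
next
  obtain c d where "b = Suc (Suc c)" "N = Suc d"
    by (rule sizes_cases)
  then show "N * (4 * b + 4 + 2) + 2 \<le> 20 * b * N"
    by (simp add: algebra_simps)
qed (use M loaded_simps[OF M(1)] in \<open>auto simp: indegree_empty count_edges_def\<close>)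

definition attracting :: "nat set \<Rightarrow> bool" where
  "attracting L \<longleftrightarrow> (\<forall>Z. (\<forall>q\<in>reachable. (\<forall>a<b. \<delta> q a \<in> Z) \<longrightarrow> q \<in> Z) \<longrightarrow> L \<subseteq> Z \<longrightarrow> reachable \<subseteq> Z)"

text \<open>The stack consists of precisely the live states of degree 0. Removed states keep degree
  0, so degrees alone suffice to decide what is pushed.\<close>

definition peeling :: "nat set \<Rightarrow> nat list \<Rightarrow> (nat \<Rightarrow> nat) \<Rightarrow> bool" where
  "peeling L s d \<longleftrightarrow> L \<subseteq> reachable \<and> attracting L \<and> distinct s \<and> set s \<subseteq> L \<and>
     (\<forall>y\<in>reachable. d y = indegree L y \<and> (d y = 0 \<longleftrightarrow> y \<in> set s \<or> y \<notin> L))"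

text \<open>The intermediate state in which \<open>x\<close> has already left \<open>L\<close>,
  while its edges with letters from \<open>i\<close> on are still counted.\<close>

definition removing :: "nat \<Rightarrow> nat \<Rightarrow> nat set \<Rightarrow> nat list \<Rightarrow> (nat \<Rightarrow> nat) \<Rightarrow> bool" where
  "removing x i L s d \<longleftrightarrow> L \<subseteq> reachable \<and> attracting L \<and> distinct s \<and> set s \<subseteq> L \<and>
     (\<forall>y\<in>reachable. d y = indegree L y + edges x {i..<b} y \<and>
        (d y = 0 \<longleftrightarrow> y \<in> set s \<or> y \<notin> L))"

text \<open>A state of degree 0 has no loop, and its successors have positive degree. Hence they all
  stay in \<open>L - {x}\<close>, and a property inherited from all successors reaches
  \<open>x\<close> from there.\<close>

lemma peeling_removing:
  assumes "peeling L (s @ [x]) d"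
  shows "removing x 0 (L - {x}) s d"
proof -
  have L: "L \<subseteq> reachable" "finite L" "x \<in> L" "x \<notin> set s"
    using assms finite_reachable finite_subset unfolding peeling_def by auto
  have "indegree L x = 0"
    using assms L unfolding peeling_def by auto
  then have x: "\<delta> q a \<noteq> x" if "q \<in> L" "a < b" for q a
    using indegree_0_iff[OF L(2)] that by blast
  have succ: "\<delta> x a \<in> L - {x}" if "a < b" for a
  proof -
    have "\<delta> x a \<in> reachable"
      using L that reachable_step by blast
    moreover have "indegree L (\<delta> x a) \<noteq> 0"
      using indegree_0_iff[OF L(2)] L(3) that by blast
    ultimately show ?thesis
      using assms x[OF L(3) that] unfolding peeling_def by auto
  qed
  have "attracting (L - {x})"
    unfolding attracting_def
  proof (intro allI impI)
    fix Z assume Z: "\<forall>q\<in>reachable. (\<forall>a<b. \<delta> q a \<in> Z) \<longrightarrow> q \<in> Z" "L - {x} \<subseteq> Z"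
    then have "x \<in> Z"
      using succ L by blast
    then show "reachable \<subseteq> Z"
      using Z assms unfolding peeling_def attracting_def by blast
  qed
  moreover have ind: "indegree L y = indegree (L - {x}) y + edges x {0..<b} y" for y
    unfolding indegree_def using sum.remove[OF L(2,3), of "\<lambda>x. edges x {..<b} y"]
    by (simp only: lessThan_atLeast0 add.commute)
  moreover have "distinct s" "set s \<subseteq> L - {x}"
    using assms unfolding peeling_def by auto
  moreover have "d y = indegree (L - {x}) y + edges x {0..<b} y"
      "d y = 0 \<longleftrightarrow> y \<in> set s \<or> y \<notin> L - {x}" if "y \<in> reachable" for y
  proof -
    have "d y = indegree L y" "d y = 0 \<longleftrightarrow> y \<in> set s \<or> y \<notin> L - {x}"
      using assms that unfolding peeling_def by auto
    then show "d y = indegree (L - {x}) y + edges x {0..<b} y"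
        "d y = 0 \<longleftrightarrow> y \<in> set s \<or> y \<notin> L - {x}"
      by (simp_all only: ind[of y])
  qed
  moreover have "L - {x} \<subseteq> reachable"
    using L(1) by blast
  ultimately show ?thesis
    unfolding removing_def by (intro conjI ballI) auto
qed

text \<open>The pending edge makes \<open>d y\<close> positive, so the decrement is a true
  subtraction, \<open>y\<close> is live, and it is not yet on the stack.\<close>

lemma removing_step:
  assumes r: "removing x i L s d" and x: "x \<in> reachable" and i: "i < b"
  defines "y \<equiv> \<delta> x i"
  shows "d y - 1 \<noteq> 0 \<Longrightarrow> removing x (Suc i) L s (d(y := d y - 1))"
    and "d y - 1 = 0 \<Longrightarrow> removing x (Suc i) L (s @ [y]) (d(y := d y - 1))"
proof -
  have y: "y \<in> reachable"
    using x i reachable_step by (simp add: y_def)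
  have sum: "edges x {i..<b} z = of_bool (y = z) + edges x {Suc i..<b} z" for z
    using i unfolding edges_def by (subst sum.atLeast_Suc_lessThan) (simp_all only: y_def)
  have d: "d z = indegree L z + (of_bool (y = z) + edges x {Suc i..<b} z)"
      "d z = 0 \<longleftrightarrow> z \<in> set s \<or> z \<notin> L" if "z \<in> reachable" for z
    using r that unfolding removing_def sum by blast+
  have dy: "d y > 0" "y \<notin> set s" "y \<in> L"
    using d[OF y] by auto
  define d' where "d' = d(y := d y - 1)"
  have d': "d' z = (if z = y then d y - 1 else d z)" for z
    by (simp add: d'_def fun_upd_apply)
  have eq: "d' z = indegree L z + edges x {Suc i..<b} z" if "z \<in> reachable" for z
    using d(1)[OF that] dy(1) d' by (cases "z = y") auto
  have r': "L \<subseteq> reachable" "attracting L" "distinct s" "set s \<subseteq> L"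
    using r unfolding removing_def by auto
  show "removing x (Suc i) L s d'" if "d y - 1 \<noteq> 0"
  proof -
    have "d' z = 0 \<longleftrightarrow> z \<in> set s \<or> z \<notin> L" if "z \<in> reachable" for z
      using d(2)[OF that] dy d' \<open>d y - 1 \<noteq> 0\<close> by (cases "z = y") auto
    then show ?thesis
      using eq r' unfolding removing_def by blast
  qed
  show "removing x (Suc i) L (s @ [y]) d'" if "d y - 1 = 0"
  proof -
    have "d' z = 0 \<longleftrightarrow> z \<in> set (s @ [y]) \<or> z \<notin> L" if "z \<in> reachable" for z
      using d(2)[OF that] dy d' \<open>d y - 1 = 0\<close> by (cases "z = y") auto
    moreover have "distinct (s @ [y])" "set (s @ [y]) \<subseteq> L"
      using r' dy by auto
    ultimately show ?thesis
      using eq r'(1,2) unfolding removing_def by blast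
  qed
qed

lemma removing_peeling: "removing x b L s d \<Longrightarrow> peeling L s d"
  unfolding removing_def peeling_def by (simp add: edges_def) metis

lemma wp_remove_edges:
  assumes M: "loaded M" and x: "M xV 0 = x" "x \<in> reachable"
    and r: "removing x 0 L (stack M) (M degA)"
  shows "wp (For aV (Var bV) remove_edge) (\<lambda>M' xs' _. removing x b L (stack M') (M' degA)) M xs (7 * b + 2)"
proof (rule wp_For[where K = b and C = 5 and
      I = "\<lambda>i M' xs'. removing x i L (stack M') (M' degA)"])
  fix i M' xs'
  assume i: "i < b" "M' aV 0 = i" and I: "removing x i L (stack M') (M' degA)"
    and un: "unchanged (insert aV (writes remove_edge)) M M'"
  have y: "M deltaA (M rowA x + i) = \<delta> x i"
    using loaded_delta[OF M reachable_less[OF x(2)] i(1)] .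
  show "wp remove_edge (\<lambda>M'' xs'' _. removing x (Suc i) L
      (stack (upd M'' aV 0 (Suc i))) (upd M'' aV 0 (Suc i) degA)) M' xs' 5"
    using un i x y removing_step[OF I x(2) i(1)]
    by (auto simp: remove_edge_def)
qed (use assms in \<open>auto simp: remove_edge_def loaded_simps\<close>)

text \<open>The last letter of a nonempty word leading to a state gives an incoming edge from a
  reachable state; only the initial state may have no such word.\<close>

lemma peeling_init:
  "peeling reachable (if indegree reachable i0 > 0 then [] else [i0]) (indegree reachable)"
proof -
  have "\<exists>x\<in>reachable. \<exists>a<b. \<delta> x a = y" if y: "y \<in> reachable" "y \<noteq> i0" for y
  proof -
    obtain w where w: "y = foldl \<delta> i0 w" "w \<in> lists {..<b}"
      using y(1) unfolding reachable_def by blast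
    then have "w \<noteq> []"
      using y(2) by auto
    then obtain v a where v: "w = v @ [a]"
      by (metis rev_exhaust)
    then have "foldl \<delta> i0 v \<in> reachable" "a < b" "\<delta> (foldl \<delta> i0 v) a = y"
      using w by (auto simp: reachable_def)
    then show ?thesis by blast
  qed
  then have "y = i0" if "y \<in> reachable" "indegree reachable y = 0" for y
    using indegree_0_iff[OF finite_reachable] that by blast
  then show ?thesis
    using i0_reachable unfolding peeling_def attracting_def by auto
qed

text \<open>With an empty stack every live state has a live predecessor. Going back \<open>l\<close>
  times and then to the initial state yields words of any length; successors are live because their
  degree is positive.\<close>

lemma peeling_recurrent:
  assumes "peeling L [] d"
  shows "recurrent_states b N \<delta> i0 L"
proof unfold_locales
  have L: "L \<subseteq> reachable" "finite L"
    using assms finite_reachable finite_subset unfolding peeling_def by auto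
  then show "L \<subseteq> reachable" by blast
  have ind: "indegree L y = 0 \<longleftrightarrow> y \<notin> L" if "y \<in> reachable" for y
    using assms that unfolding peeling_def by auto
  have pred: "\<exists>q'\<in>L. \<exists>a<b. \<delta> q' a = q" if "q \<in> L" for q
    using ind[of q] indegree_0_iff[OF L(2), of q] L(1) that by auto
  show "\<delta> q a \<in> L" if "q \<in> L" "a < b" for q a
    using ind[of "\<delta> q a"] indegree_0_iff[OF L(2)] that reachable_step L(1) by blast
  show "\<exists>w\<in>lists {..<b}. l \<le> length w \<and> foldl \<delta> i0 w = q" if "q \<in> L" for q l
    using that
  proof (induction l arbitrary: q)
    case 0
    then show ?case
      using L(1) unfolding reachable_def by auto
  next
    case (Suc l)
    obtain q' a where q': "q' \<in> L" "a < b" "\<delta> q' a = q"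
      using pred[OF Suc.prems] by blast
    obtain w where "w \<in> lists {..<b}" "l \<le> length w" "foldl \<delta> i0 w = q'"
      using Suc.IH[OF q'(1)] by blast
    then have "w @ [a] \<in> lists {..<b}" "Suc l \<le> length (w @ [a])" "foldl \<delta> i0 (w @ [a]) = q"
      using q' by auto
    then show ?case by blast
  qed
  show "reachable \<subseteq> Z" if "\<And>q. q \<in> reachable \<Longrightarrow> (\<And>a. a < b \<Longrightarrow> \<delta> q a \<in> Z) \<Longrightarrow> q \<in> Z" "L \<subseteq> Z" for Z
    using assms that unfolding peeling_def attracting_def by blast
qed

lemma wp_peel:
  assumes M: "loaded M" "support (M liveA) = reachable" "M degA = indegree reachable" "M spV 0 = 0"
  shows "wp peel (\<lambda>M' _ _. loaded M' \<and> recurrent_states b N \<delta> i0 (support (M' liveA)) \<and> M' spV 0 = 0)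
     M xs (20 * b * N)"
proof -
  let ?body = "spV ::= Minus (Var spV) (Num 1) ;; xV ::= Arr stackA (Var spV) ;;
        Put liveA (Var xV) (Num 0) ;; For aV (Var bV) remove_edge"
  \<comment> \<open>Each live state carries the credits for its own removal.\<close>
  let ?I = "\<lambda>M' xs' T'. peeling (support (M' liveA)) (stack M') (M' degA) \<and>
     card (support (M' liveA)) * (7 * b + 6) + 1 \<le> T'"
  let ?Q = "\<lambda>M' _ _. loaded M' \<and> recurrent_states b N \<delta> i0 (support (M' liveA)) \<and> M' spV 0 = 0"
  define M1 where "M1 = (if indegree reachable i0 > 0 then M else upd (upd M stackA 0 i0) spV 0 1)"
  have M1: "loaded M1"
    using loaded_cong[OF M(1), of "{stackA, spV}" M1] by (simp add: M1_def)
  have T: "3 + (N * (7 * b + 6) + 1) \<le> 20 * b * N"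
  proof -
    obtain c d where "b = Suc (Suc c)" "N = Suc d"
        by (rule sizes_cases)
    then show ?thesis
      by (simp add: algebra_simps)
  qed
  have loop: "wp (Loop (Var spV) ?body) ?Q M1 xs T" if T': "N * (7 * b + 6) + 1 \<le> T" for T
  proof (rule wp_Loop[where I = ?I])
    have "card reachable \<le> N"
      using reachable_less card_mono[of "{..<N}" reachable] by auto
    then have "card reachable * (7 * b + 6) + 1 \<le> N * (7 * b + 6) + 1"
      by (intro add_mono mult_le_mono1) auto
    with T' have "card reachable * (7 * b + 6) + 1 \<le> T"
      by linarith
    moreover have "stack M1 = (if indegree reachable i0 > 0 then [] else [i0])"
        "support (M1 liveA) = reachable" "M1 degA = indegree reachable"
      using M stack_of_push[of "M stackA" 0 i0] by (simp_all add: M1_def)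
    ultimately show "?I M1 xs T"
      using peeling_init T' by simp
  next
    fix M' xs' T'
    assume I: "?I M' xs' T'" and un: "unchanged (writes ?body) M1 M'" and "0 < aval M' (Var spV)"
    then have sp: "M' spV 0 > 0"
      by simp
    have M': "loaded M'"
      by (rule loaded_cong[OF M1 un]) (simp add: remove_edge_def)
    define x where "x = M' stackA (M' spV 0 - 1)"
    define L where "L = support (M' liveA)"
    define s where "s = stack_of (M' stackA) (M' spV 0 - 1)"
    have s: "stack M' = s @ [x]"
      using stack_of_pop[OF sp] by (simp add: s_def x_def)
    have peel: "peeling L (s @ [x]) (M' degA)"
      using I by (simp add: s L_def)
    then have x: "x \<in> L" "x \<in> reachable" "finite L"
      using finite_reachable finite_subset unfolding peeling_def by auto
    define M2 where "M2 = upd (upd (upd M' spV 0 (M' spV 0 - 1)) xV 0 x) liveA x 0"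
    have M2: "loaded M2"
      using loaded_cong[OF M', of "{spV, xV, liveA}" M2] by (simp add: M2_def)
    have L2: "support (M2 liveA) = L - {x}"
      by (simp add: M2_def L_def)
    have "removing x 0 (L - {x}) (stack M2) (M2 degA)"
      using peeling_removing[OF peel] by (simp add: M2_def s_def)
    then have wp: "wp (For aV (Var bV) remove_edge)
        (\<lambda>M' xs' _. removing x b (L - {x}) (stack M') (M' degA)) M2 xs' (7 * b + 2)"
      using M2 x by (intro wp_remove_edges) (simp_all add: M2_def)
    have "card L = Suc (card (L - {x}))"
      using x by (metis card_Suc_Diff1)
    then have T: "card (L - {x}) * (7 * b + 6) + 1 + (7 * b + 6) \<le> T'"
      using I by (simp add: L_def)
    have "wp (For aV (Var bV) remove_edge) ?I M2 xs' (T' - Suc (Suc (Suc (Suc 0))))"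
    proof (rule wp_weaken[OF wp])
      fix M3 xs3 T3
      assume r: "removing x b (L - {x}) (stack M3) (M3 degA)" and T3: "T' - Suc (Suc (Suc (Suc 0))) - (7 * b + 2) \<le> T3"
        and un: "unchanged (writes (For aV (Var bV) remove_edge)) M2 M3"
      have "support (M3 liveA) = L - {x}"
        using un L2 by (simp add: remove_edge_def)
      then show "?I M3 xs3 T3"
        using T T3 removing_peeling[OF r] by simp
    qed (use T in simp)
    then show "0 < T' \<and> wp ?body ?I M' xs' (T' - 1)"
      using T by (simp add: M2_def x_def)
  next
    fix M' xs' T'
    assume I: "?I M' xs' T'" and un: "unchanged (writes ?body) M1 M'" and "aval M' (Var spV) = 0"
    then have sp: "M' spV 0 = 0"
      by simp
    have "loaded M'"
      by (rule loaded_cong[OF M1 un]) (simp add: remove_edge_def)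
    then show "0 < T' \<and> ?Q M' xs' (T' - 1)"
      using I sp peeling_recurrent by auto
  qed
  have "wp (Cond (Arr degA (Var iV)) Skip (Put stackA (Num 0) (Var iV) ;; spV ::= Num 1))
      (wp (Loop (Var spV) ?body) ?Q) M xs (20 * b * N)"
  proof (cases "indegree reachable i0 > 0")
    case True
    then show ?thesis
      using loop[of "20 * b * N - 1"] T loaded_simps[OF M(1)] M(3) b i0 by (simp add: M1_def)
  next
    case False
    have "N * (7 * b + 6) + 1 \<le> 20 * b * N - Suc (Suc (Suc 0))"
      using T by linarith
    then show ?thesis
      using loop[of "20 * b * N - Suc (Suc (Suc 0))"] False loaded_simps[OF M(1)] M(3) T b i0
      by (simp add: M1_def)
  qed
  then show ?thesis
    by (simp only: peel_def wp_Seq)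
qed

end

section \<open>Closing an equivalence with a union-find structure\<close>

text \<open>There is no path compression: linking by size alone keeps the paths logarithmic.\<close>

definition find_root :: "nat \<Rightarrow> com" where
  "find_root w = Loop (distE (Arr parA (Var w)) (Var w)) (w ::= Arr parA (Var w))"

abbreviation push_pair :: "exp \<Rightarrow> exp \<Rightarrow> com" where
  "push_pair e f \<equiv> Put leftA (Var spV) e ;; Put rightA (Var spV) f ;; spV ::= Plus (Var spV) (Num 1)"

text \<open>The effect of a merge for one letter. The successors of both roots must be identified,
  and so must the recorded predecessors; if only the absorbed root has one, it is handed over.
  Entries of \<open>inA\<close> are increased by 1, leaving 0 for a missing predecessor.\<close>

definition transfer :: com where
  "transfer = push_pair (deltaE (Var uV) (Var aV)) (deltaE (Var vV) (Var aV)) ;;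
     pV ::= Plus (Arr rowA (Var uV)) (Var aV) ;; qV ::= Plus (Arr rowA (Var vV)) (Var aV) ;;
     Cond (Arr inA (Var pV))
       (Cond (Arr inA (Var qV))
         (push_pair (Minus (Arr inA (Var pV)) (Num 1)) (Minus (Arr inA (Var qV)) (Num 1)))
         (Put inA (Var qV) (Arr inA (Var pV))))
       Skip"

definition order_roots :: com where
  "order_roots = Cond (Minus (Arr sizeA (Var uV)) (Arr sizeA (Var vV)))
     (yV ::= Var uV ;; uV ::= Var vV ;; vV ::= Var yV) Skip"

definition merge :: com where
  "merge = order_roots ;; Put parA (Var uV) (Var vV) ;;
     Put sizeA (Var vV) (Plus (Arr sizeA (Var uV)) (Arr sizeA (Var vV))) ;;
     For aV (Var bV) transfer"

definition close_pairs :: com where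
  "close_pairs = Loop (Var spV)
     (spV ::= Minus (Var spV) (Num 1) ;; uV ::= Arr leftA (Var spV) ;; vV ::= Arr rightA (Var spV) ;;
      find_root uV ;; find_root vV ;; Cond (distE (Var uV) (Var vV)) merge Skip)"

definition mirror :: com where
  "mirror = For xV (Var NV)
     (Cond (Arr liveA (Var xV)) (Put liveA (Plus (Var NV) (Var xV)) (Num 1)) Skip)"

definition singletons :: com where
  "singletons = For xV (Var DV) (Put parA (Var xV) (Var xV) ;; Put sizeA (Var xV) (Num 1))"

text \<open>The first edge with a given letter into a state is recorded; any further one yields a
  pair, because two states with equivalent successors must be equivalent.\<close>

definition link :: com where
  "link = yV ::= deltaE (Var xV) (Var aV) ;; pV ::= Plus (Arr rowA (Var yV)) (Var aV) ;;
     Cond (Arr inA (Var pV))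
       (push_pair (Var xV) (Minus (Arr inA (Var pV)) (Num 1)))
       (Put inA (Var pV) (Plus (Var xV) (Num 1)))"

definition link_all :: com where
  "link_all = For xV (Var DV) (Cond (Arr liveA (Var xV)) (For aV (Var bV) link) Skip)"

section \<open>Union-find with linking by size\<close>

definition pairs_of :: "(nat \<Rightarrow> nat) \<Rightarrow> (nat \<Rightarrow> nat) \<Rightarrow> nat \<Rightarrow> (nat \<times> nat) set" where
  "pairs_of f g n = (\<lambda>i. (f i, g i)) ` {..<n}"

lemma pairs_of_0 [simp]: "pairs_of f g 0 = {}"
  by (simp add: pairs_of_def)

lemma pairs_of_Suc: "pairs_of f g (Suc n) = insert (f n, g n) (pairs_of f g n)"
  by (simp add: pairs_of_def lessThan_Suc)

lemma pairs_of_push [simp]: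
  "pairs_of (f(n := x)) (g(n := y)) (Suc n) = insert (x, y) (pairs_of f g n)"
  by (auto simp: pairs_of_def lessThan_Suc)

abbreviation pairs :: "mem \<Rightarrow> (nat \<times> nat) set" where
  "pairs M \<equiv> pairs_of (M leftA) (M rightA) (M spV 0)"

text \<open>The root function \<open>r\<close> is not stored; it describes what
  \<open>find_root\<close> computes. The size of a state is frozen once it is linked. The sizes at
  least double at each step upwards, which bounds the depth.\<close>

definition union_find :: "nat \<Rightarrow> (nat \<Rightarrow> nat) \<Rightarrow> (nat \<Rightarrow> nat) \<Rightarrow> (nat \<Rightarrow> nat) \<Rightarrow> bool" where
  "union_find D r par sz \<longleftrightarrow> (\<forall>x<D. r x < D \<and> r (r x) = r x \<and> par x < D \<and> r (par x) = r x \<and>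
     (par x = x \<longleftrightarrow> r x = x) \<and> 1 \<le> sz x \<and> sz x \<le> D \<and> (par x \<noteq> x \<longrightarrow> 2 * sz x \<le> sz (par x)) \<and>
     (r x = x \<longrightarrow> sz x = card {y. y < D \<and> r y = x}))"

definition merged :: "(nat \<Rightarrow> nat) \<Rightarrow> nat \<Rightarrow> nat \<Rightarrow> nat \<Rightarrow> nat" where
  "merged r u v x = (if r x = u then v else r x)"

lemma union_findD:
  assumes "union_find D r par sz" "x < D"
  shows "r x < D" "r (r x) = r x" "par x < D" "r (par x) = r x" "par x = x \<longleftrightarrow> r x = x"
    "1 \<le> sz x" "sz x \<le> D" "par x \<noteq> x \<Longrightarrow> 2 * sz x \<le> sz (par x)"
    "r x = x \<Longrightarrow> sz x = card {y. y < D \<and> r y = x}"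
  using assms unfolding union_find_def by blast+

lemma union_find_singletons:
  assumes "\<And>x. x < D \<Longrightarrow> par x = x" "\<And>x. x < D \<Longrightarrow> sz x = 1"
  shows "union_find D (\<lambda>x. x) par sz"
proof -
  have "{y. y < D \<and> y = x} = {x}" if "x < D" for x
    using that by auto
  then show ?thesis
    using assms by (auto simp: union_find_def)
qed

text \<open>The smaller root goes below the larger one, so the new size is at least twice that of
  \<open>u\<close>. For the other states the doubling persists because the size of a parent can only
  grow.\<close>

lemma union_find_merge:
  assumes uf: "union_find D r par sz" and u: "u < D" "r u = u" and v: "v < D" "r v = v"
    and "u \<noteq> v" and sz: "sz u \<le> sz v"
  shows "union_find D (merged r u v) (par(u := v)) (sz(v := sz u + sz v))"
  (is "union_find D ?r ?par ?sz")
  unfolding union_find_def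
proof (intro allI impI)
  fix x assume x: "x < D"
  note X = union_findD[OF uf x]
  have card_v: "card {y. y < D \<and> merged r u v y = v} = sz u + sz v"
  proof -
    have "{y. y < D \<and> merged r u v y = v} = {y. y < D \<and> r y = u} \<union> {y. y < D \<and> r y = v}"
      by (auto simp: merged_def)
    moreover have "{y. y < D \<and> r y = u} \<inter> {y. y < D \<and> r y = v} = {}"
      using \<open>u \<noteq> v\<close> by auto
    ultimately have "card {y. y < D \<and> merged r u v y = v} =
        card {y. y < D \<and> r y = u} + card {y. y < D \<and> r y = v}"
      by (simp add: card_Un_disjoint)
    then show ?thesis
      using union_findD(9)[OF uf] u v by simp
  qed
  moreover have "card {y. y < D \<and> merged r u v y = v} \<le> card {..<D}"
    by (rule card_mono) auto
  ultimately have le: "sz u + sz v \<le> D"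
    by simp
  have other: "{y. y < D \<and> merged r u v y = x} = {y. y < D \<and> r y = x}" if "x \<noteq> u" "x \<noteq> v"
    using that by (auto simp: merged_def)
  consider "x = u" | "x = v" | "x \<noteq> u" "x \<noteq> v"
    by blast
  then show "?r x < D \<and> ?r (?r x) = ?r x \<and>
      ?par x < D \<and> ?r (?par x) = ?r x \<and>
      (?par x = x \<longleftrightarrow> ?r x = x) \<and> 1 \<le> ?sz x \<and>
      ?sz x \<le> D \<and>
      (?par x \<noteq> x \<longrightarrow> 2 * ?sz x \<le> ?sz (?par x)) \<and>
      (?r x = x \<longrightarrow> ?sz x = card {y. y < D \<and> ?r y = x})"
  proof cases
    case 1
    then show ?thesis
      using X u v \<open>u \<noteq> v\<close> sz by (simp add: merged_def)
  next
    case 2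
    then show ?thesis
      using X u v \<open>u \<noteq> v\<close> sz le card_v by (simp add: merged_def)
  next
    case 3
    have "merged r u v x = x \<longleftrightarrow> r x = x"
      using 3 by (auto simp: merged_def)
    moreover have "2 * sz x \<le> (sz(v := sz u + sz v)) (par x)" if "par x \<noteq> x"
      using X(8) that by (auto simp: fun_upd_apply)
    moreover have "merged r u v (merged r u v x) = merged r u v x"
      using X(2) v \<open>u \<noteq> v\<close> by (auto simp: merged_def)
    ultimately show ?thesis
      using 3 X other v(1) by (auto simp: merged_def)
  qed
qed

lemma wp_find:
  assumes uf: "union_find D r (M parA) (M sizeA)" and w: "M w 0 < D" "w \<noteq> parA" "w \<noteq> sizeA"
    and L: "D < 2 ^ L"
  shows "wp (find_root w) (\<lambda>M' xs' _. xs' = xs \<and> M' w 0 = r (M w 0)) M xs (2 * L + 1)"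
  unfolding find_root_def
\<comment> \<open>\<open>k\<close> counts the doublings of the size so far. As sizes are at most
  \<open>D < 2 ^ L\<close>, at most \<open>L\<close> of them fit in, each with 2 credits.\<close>
proof (rule wp_Loop[where I = "\<lambda>M' xs' T. xs' = xs \<and> M' w 0 < D \<and> r (M' w 0) = r (M w 0) \<and>
      (\<exists>k. 2 ^ k \<le> M sizeA (M' w 0) \<and> 2 * (L - k) + 1 \<le> T)"])
  show "xs = xs \<and> M w 0 < D \<and> r (M w 0) = r (M w 0) \<and>
      (\<exists>k. 2 ^ k \<le> M sizeA (M w 0) \<and> 2 * (L - k) + 1 \<le> 2 * L + 1)"
    using union_findD(6)[OF uf w(1)] w by (intro conjI exI[of _ 0]) auto
next
  fix M' xs' T
  assume I: "xs' = xs \<and> M' w 0 < D \<and> r (M' w 0) = r (M w 0) \<and>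
      (\<exists>k. 2 ^ k \<le> M sizeA (M' w 0) \<and> 2 * (L - k) + 1 \<le> T)"
    and un: "unchanged (writes (w ::= Arr parA (Var w))) M M'"
    and pos: "0 < aval M' (distE (Arr parA (Var w)) (Var w))"
  define x where "x = M' w 0"
  obtain k where k: "2 ^ k \<le> M sizeA x" "2 * (L - k) + 1 \<le> T"
    using I unfolding x_def by blast
  have "M' parA = M parA"
    using un w(2) by simp
  then have par: "M parA x \<noteq> x"
    using pos unfolding x_def by auto
  have x: "x < D"
    using I by (simp add: x_def)
  note X = union_findD[OF uf x]
  have *: "2 * M sizeA x \<le> M sizeA (M parA x)" "M sizeA (M parA x) \<le> D"
    using X(8)[OF par] union_findD(7)[OF uf X(3)] by auto
  then have "2 ^ Suc k \<le> M sizeA (M parA x)"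
    using k(1) by simp
  moreover from this have "(2::nat) ^ Suc k < 2 ^ L"
    using *(2) L by linarith
  then have "Suc k < L"
    by (rule power_less_imp_less_exp[rotated]) simp
  ultimately have "2 ^ Suc k \<le> M sizeA (M parA x) \<and> 2 * (L - Suc k) + 1 \<le> T - 1 - 1" "0 < T - 1"
    using k(2) by auto
  then have "0 < T - 1" "\<exists>k. 2 ^ k \<le> M sizeA (M parA x) \<and> 2 * (L - k) + 1 \<le> T - 1 - 1"
    by blast+
  then show "0 < T \<and> wp (w ::= Arr parA (Var w)) (\<lambda>M' xs' T. xs' = xs \<and> M' w 0 < D \<and>
      r (M' w 0) = r (M w 0) \<and> (\<exists>k. 2 ^ k \<le> M sizeA (M' w 0) \<and> 2 * (L - k) + 1 \<le> T)) M' xs' (T - 1)"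
    using X(3,4) I un w(2,3) by (simp add: x_def)
next
  fix M' xs' T
  assume I: "xs' = xs \<and> M' w 0 < D \<and> r (M' w 0) = r (M w 0) \<and>
      (\<exists>k. 2 ^ k \<le> M sizeA (M' w 0) \<and> 2 * (L - k) + 1 \<le> T)"
    and un: "unchanged (writes (w ::= Arr parA (Var w))) M M'"
    and zero: "aval M' (distE (Arr parA (Var w)) (Var w)) = 0"
  have "M' parA = M parA"
    using un w(2) by simp
  then have "M parA (M' w 0) = M' w 0"
    using zero by simp
  then have "r (M' w 0) = M' w 0"
    using union_findD(5)[OF uf] I by blast
  then show "0 < T \<and> xs' = xs \<and> M' w 0 = r (M w 0)"
    using I by auto
qed

definition compat :: "(nat \<Rightarrow> nat) \<Rightarrow> (nat \<times> nat) set \<Rightarrow> (nat \<Rightarrow> nat) \<Rightarrow> bool" where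
  "compat r W f \<longleftrightarrow> (\<forall>x y. r x = r y \<longrightarrow> f x = f y) \<and> (\<forall>(x, y)\<in>W. f x = f y)"

lemma compat_insert [simp]: "compat r (insert (x, y) W) f \<longleftrightarrow> f x = f y \<and> compat r W f"
  unfolding compat_def by blast

lemma compat_class: "compat r W f \<Longrightarrow> r x = r y \<Longrightarrow> f x = f y"
  unfolding compat_def by blast

section \<open>The two-sided closure and its invariant\<close>

context recurrent_states
begin

text \<open>
  The equivalence under construction is generated by the kernel of \<open>r\<close> and the pending pairs
  \<open>W\<close>; that two states are equivalent is expressed by saying that all functions that respect \<open>r\<close>
  and \<open>W\<close> agree on them. The entry \<open>e (y * b + a)\<close> is the successor of a state with an edge labelled
  \<open>a\<close> into the class of the root \<open>y\<close>, or \<open>0\<close> if there is none. The letters are treated one after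
  another when two classes are merged, so the roots \<open>\<rho> a\<close> that are already taken into account depend
  on the letter. The last conjunct says that only unavoidable identifications are made.
\<close>

definition sound :: "(nat \<Rightarrow> nat) \<Rightarrow> (nat \<times> nat) set \<Rightarrow> (nat \<Rightarrow> nat) \<Rightarrow> bool" where
  "sound r W e \<longleftrightarrow> (\<forall>x\<in>active. r x \<in> active) \<and> W \<subseteq> active \<times> active \<and>
     (\<forall>y\<in>active. \<forall>a<b. \<forall>z. e (y * b + a) = Suc z \<longrightarrow> z \<in> active) \<and>
     (\<forall>V :: sets. bicompatible V \<longrightarrow>
        (\<forall>x\<in>active. V (r x) = V x) \<and> (\<forall>(x, y)\<in>W. V x = V y) \<and>
        (\<forall>y\<in>active. \<forall>a<b. \<forall>z. e (y * b + a) = Suc z \<longrightarrow> V (doubled z a) = V y))"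

definition closing ::
    "(nat \<Rightarrow> nat \<Rightarrow> nat) \<Rightarrow> (nat \<Rightarrow> nat) \<Rightarrow> (nat \<times> nat) set \<Rightarrow> (nat \<Rightarrow> nat) \<Rightarrow> bool" where
  "closing \<rho> r W e \<longleftrightarrow> sound r W e \<and> (\<forall>x\<in>active. \<forall>a<b.
     (\<forall>f. compat r W f \<longrightarrow> f (doubled x a) = f (doubled (\<rho> a x) a)) \<and>
     (\<exists>z. e (\<rho> a (doubled x a) * b + a) = Suc z \<and> (\<forall>f. compat r W f \<longrightarrow> f x = f z)))"

abbreviation merging where
  "merging r u v i \<equiv> closing (\<lambda>a. if a < i then merged r u v else r) (merged r u v)"

lemma soundD:
  fixes V :: sets
  assumes "sound r W e"
  shows "x \<in> active \<Longrightarrow> r x \<in> active" "W \<subseteq> active \<times> active"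
    "y \<in> active \<Longrightarrow> a < b \<Longrightarrow> e (y * b + a) = Suc z \<Longrightarrow> z \<in> active"
    "bicompatible V \<Longrightarrow> x \<in> active \<Longrightarrow> V (r x) = V x"
    "bicompatible V \<Longrightarrow> (x, y) \<in> W \<Longrightarrow> V x = V y"
    "bicompatible V \<Longrightarrow> y \<in> active \<Longrightarrow> a < b \<Longrightarrow> e (y * b + a) = Suc z \<Longrightarrow> V (doubled z a) = V y"
  using assms unfolding sound_def by (auto 0 3)

lemma soundI:
  assumes "\<And>x. x \<in> active \<Longrightarrow> r x \<in> active" "W \<subseteq> active \<times> active"
    "\<And>y a z. y \<in> active \<Longrightarrow> a < b \<Longrightarrow> e (y * b + a) = Suc z \<Longrightarrow> z \<in> active"
    "\<And>V :: sets. \<And>x. bicompatible V \<Longrightarrow> x \<in> active \<Longrightarrow> V (r x) = V x"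
    "\<And>V :: sets. \<And>x y. bicompatible V \<Longrightarrow> (x, y) \<in> W \<Longrightarrow> V x = V y"
    "\<And>V :: sets. \<And>y a z. bicompatible V \<Longrightarrow> y \<in> active \<Longrightarrow> a < b \<Longrightarrow>
       e (y * b + a) = Suc z \<Longrightarrow> V (doubled z a) = V y"
  shows "sound r W e"
  unfolding sound_def
  by (intro conjI allI impI ballI; (elim conjE)?; (rule assms | (clarify, rule assms)); assumption)

lemma closingD:
  assumes "closing \<rho> r W e"
  shows "sound r W e"
    "x \<in> active \<Longrightarrow> a < b \<Longrightarrow> compat r W f \<Longrightarrow> f (doubled x a) = f (doubled (\<rho> a x) a)"
    "x \<in> active \<Longrightarrow> a < b \<Longrightarrow>
       \<exists>z. e (\<rho> a (doubled x a) * b + a) = Suc z \<and> (\<forall>f. compat r W f \<longrightarrow> f x = f z)"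
  using assms unfolding closing_def by blast+

lemma closingI:
  assumes "sound r W e"
    "\<And>x a f. x \<in> active \<Longrightarrow> a < b \<Longrightarrow> compat r W f \<Longrightarrow> f (doubled x a) = f (doubled (\<rho> a x) a)"
    "\<And>x a. x \<in> active \<Longrightarrow> a < b \<Longrightarrow>
       \<exists>z. e (\<rho> a (doubled x a) * b + a) = Suc z \<and> (\<forall>f. compat r W f \<longrightarrow> f x = f z)"
  shows "closing \<rho> r W e"
  using assms unfolding closing_def by blast

lemma sound_insert:
  assumes "sound r W e" "x \<in> active" "y \<in> active"
    "\<And>V :: sets. bicompatible V \<Longrightarrow> V x = V y"
  shows "sound r (insert (x, y) W) e"
  by (rule soundI) (use soundD[OF assms(1)] assms(2-) in auto)

lemma sound_subset:
  assumes "sound r W e" "W' \<subseteq> W"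
  shows "sound r W' e"
  by (rule soundI) (use soundD[OF assms(1)] assms(2) in auto)

text \<open>A pair inside one class adds nothing to the generated equivalence.\<close>

lemma closing_drop:
  assumes c: "closing \<rho> r (insert (x, y) W) e" and eq: "r x = r y"
  shows "closing \<rho> r W e"
proof -
  have *: "compat r (insert (x, y) W) f \<longleftrightarrow> compat r W f" for f
    using compat_class[of r W f x y] eq by auto
  have "sound r W e"
    using sound_subset[OF closingD(1)[OF c]] by blast
  then show ?thesis
    using closingD(2,3)[OF c] unfolding * by (rule closingI)
qed

text \<open>Functions that respect the merged roots identify \<open>x\<close> and \<open>y\<close>,
  so the pair is used up. No letter has been transferred yet: successors and predecessors are still
  looked up at the old roots. Both directions of linking occur, as the sizes decide.\<close>

lemma closing_merge:
  assumes c: "closing (\<lambda>_. r) r (insert (x, y) W) e"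
    and uv: "u = r x \<and> v = r y \<or> u = r y \<and> v = r x"
  shows "merging r u v 0 W e"
proof -
  note s = closingD(1)[OF c]
  have W: "x \<in> active" "y \<in> active" "r x \<in> active" "r y \<in> active"
    using soundD(1,2)[OF s] by auto
  have *: "compat r (insert (x, y) W) f" if f: "compat (merged r u v) W f" for f
  proof -
    have "merged r u v x = merged r u v y"
      using uv by (auto simp: merged_def)
    then have "f x = f y"
      by (rule compat_class[OF f])
    moreover have "merged r u v z = merged r u v w" if "r z = r w" for z w
      using that by (simp add: merged_def)
    then have "compat r W f"
      using f unfolding compat_def by blast
    ultimately show ?thesis by simp
  qed
  have V: "V (merged r u v z) = V z" if V: "bicompatible V" and z: "z \<in> active"
    for V :: sets and z
  proof -
    have "V (r x) = V (r y)" "V (r z) = V z"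
      using soundD(4)[OF s V] soundD(5)[OF s V, of x y] W z by auto
    then show ?thesis
      using uv by (auto simp: merged_def)
  qed
  have active: "merged r u v z \<in> active" if "z \<in> active" for z
    using soundD(1)[OF s that] uv W by (auto simp: merged_def)
  have "sound (merged r u v) W e"
    by (rule soundI) (use soundD[OF s] V active in auto)
  then show ?thesis
    by (rule closingI) (use closingD(2,3)[OF c] * in \<open>simp del: compat_insert; meson\<close>)+
qed

lemma closing_merged:
  "merging r u v b W e \<Longrightarrow>
    closing (\<lambda>_. merged r u v) (merged r u v) W e"
  unfolding closing_def by simp

text \<open>For the letter \<open>i\<close>, the edges into the class of \<open>u\<close> must now
  be found at \<open>v\<close>. If \<open>u\<close> has no entry, there are none; if only
  \<open>u\<close> has one, it moves; if both have one, the new pair makes the entry of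
  \<open>v\<close> serve both classes. These pairs are unavoidable: \<open>V u = V v\<close> holds
  for every bicompatible \<open>V\<close>, which forces the successors together in forward and the
  predecessors in backward direction.\<close>

lemma closing_transfer:
  fixes e :: "nat \<Rightarrow> nat"
  assumes c: "merging r u v i W e"
    and i: "i < b" and uv: "u \<in> active" "v \<in> active" "r u = u" "r v = v" "u \<noteq> v"
  defines "W1 \<equiv> insert (doubled u i, doubled v i) W"
  defines "\<rho> \<equiv> \<lambda>a. if a < Suc i then merged r u v else r"
  shows "e (u * b + i) = 0 \<Longrightarrow> closing \<rho> (merged r u v) W1 e"
    and "e (u * b + i) = Suc z \<Longrightarrow> e (v * b + i) = 0 \<Longrightarrow>
      closing \<rho> (merged r u v) W1 (e(v * b + i := Suc z))"
    and "e (u * b + i) = Suc z \<Longrightarrow> e (v * b + i) = Suc z' \<Longrightarrow>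
      closing \<rho> (merged r u v) (insert (z, z') W1) e"
proof -
  let ?r = "merged r u v"
  let ?old = "\<lambda>a. if a < i then ?r else r"
  note s = closingD(1)[OF c]
  note D = soundD[OF s]
  have V_uv: "V u = V v" "V (doubled u i) = V (doubled v i)" if V: "bicompatible V"
    for V :: sets
  proof -
    show "V u = V v"
      using D(4)[OF V uv(1)] uv by (simp add: merged_def)
    then show "V (doubled u i) = V (doubled v i)"
      using V uv i unfolding bicompatible_def by blast
  qed
  have s1: "sound ?r W1 e"
    unfolding W1_def using s doubled_active uv i V_uv(2) by (intro sound_insert) auto
  have forward: "f (doubled x a) = f (doubled (\<rho> a x) a)"
    if x: "x \<in> active" and a: "a < b" and f: "compat ?r W1 f" for x a f
  proof -
    have f': "compat ?r W f" "f (doubled u i) = f (doubled v i)"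
      using f by (simp_all add: W1_def)
    have "f (doubled x a) = f (doubled (?old a x) a)"
      using closingD(2)[OF c x a f'(1)] .
    also have "\<dots> = f (doubled (\<rho> a x) a)"
      using f'(2) by (auto simp: \<rho>_def merged_def less_Suc_eq)
    finally show ?thesis .
  qed
  note old = closingD(3)[OF c]
  have same: "\<rho> a (doubled x a) = ?old a (doubled x a)" if "a \<noteq> i \<or> r (doubled x a) \<noteq> u" for a x
    using that by (auto simp: \<rho>_def merged_def less_Suc_eq)
  have moved: "\<rho> i (doubled x i) = v" "?old i (doubled x i) = u" if "r (doubled x i) = u" for x
    using that by (auto simp: \<rho>_def merged_def)
  have mono: "compat ?r W1 f \<Longrightarrow> compat ?r W f" for f
    by (simp add: W1_def)
  have incoming: "\<exists>w. e (\<rho> a (doubled x a) * b + a) = Suc w \<and> (\<forall>f. compat ?r W1 f \<longrightarrow> f x = f w)"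
    if x: "x \<in> active" "a < b" and "a \<noteq> i \<or> r (doubled x a) \<noteq> u" for x a
    unfolding same[OF that(3)] using old[OF x] mono by meson
  have incoming_u: "compat ?r W1 f \<Longrightarrow> f x = f z"
    if x: "x \<in> active" "r (doubled x i) = u" and u: "e (u * b + i) = Suc z" for x f z
    using old[OF x(1) i] mono unfolding moved(2)[OF x(2)] by (metis Suc_inject u)
  show "closing \<rho> ?r W1 e" if 0: "e (u * b + i) = 0"
  proof (rule closingI)
    show "sound ?r W1 e"
      using s1 .
    show "f (doubled x a) = f (doubled (\<rho> a x) a)"
      if "x \<in> active" "a < b" "compat ?r W1 f" for x a f
      using forward[OF that] .
    fix x a assume x: "x \<in> active" "a < b"
    \<comment> \<open>An edge into the class of \<open>u\<close> would have required an entry there,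
      by the old invariant.\<close>
    have "a \<noteq> i \<or> r (doubled x a) \<noteq> u"
      using old[OF x] moved[of x] 0 by auto
    then show "\<exists>w. e (\<rho> a (doubled x a) * b + a) = Suc w \<and> (\<forall>f. compat ?r W1 f \<longrightarrow> f x = f w)"
      by (rule incoming[OF x])
  qed
  show "closing \<rho> ?r W1 (e(v * b + i := Suc z))" if u: "e (u * b + i) = Suc z" and v: "e (v * b + i) = 0"
  proof -
    let ?e = "e(v * b + i := Suc z)"
    have e: "?e (y * b + a) = (if y = v \<and> a = i then Suc z else e (y * b + a))" if "a < b" for y a
      using index_eq_iff[OF that i, of y v] by (simp add: fun_upd_apply)
    have z: "z \<in> active"
      using D(3)[OF uv(1) i u] .
    have Vz: "V (doubled z i) = V v" if V: "bicompatible V" for V :: sets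
      using D(6)[OF V uv(1) i u] V_uv(1)[OF V] by simp
    have "sound ?r W1 ?e"
    proof (rule soundI)
      show "w \<in> active" if "y \<in> active" "a < b" "?e (y * b + a) = Suc w" for y a w
        using that z D(3)[of y a w] unfolding e[OF that(2)] by (auto split: if_splits)
      show "V (doubled w a) = V y" if "bicompatible V" "y \<in> active" "a < b" "?e (y * b + a) = Suc w"
        for V :: sets and y a w
        using that Vz[OF that(1)] D(6)[OF that(1), of y a w] unfolding e[OF that(3)]
        by (auto split: if_splits)
    qed (use soundD[OF s1] in auto)
    then show ?thesis
    proof (rule closingI)
      show "f (doubled x a) = f (doubled (\<rho> a x) a)"
        if "x \<in> active" "a < b" "compat ?r W1 f" for x a f
        using forward[OF that] .
      fix x a assume x: "x \<in> active" "a < b"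
      show "\<exists>w. ?e (\<rho> a (doubled x a) * b + a) = Suc w \<and> (\<forall>f. compat ?r W1 f \<longrightarrow> f x = f w)"
      proof (cases "a = i \<and> r (doubled x a) = u")
        case True
        then have "?e (\<rho> a (doubled x a) * b + a) = Suc z"
          using moved(1)[of x] by auto
        then show ?thesis
          using incoming_u[OF x(1) _ u] True by blast
      next
        case False
        then obtain w where w: "e (\<rho> a (doubled x a) * b + a) = Suc w"
            "\<forall>f. compat ?r W1 f \<longrightarrow> f x = f w"
          using incoming[OF x] by blast
        then have "\<not> (\<rho> a (doubled x a) = v \<and> a = i)"
          using v by auto
        then show ?thesis
          using w e[OF x(2)] by auto
      qed
    qed
  qed
  show "closing \<rho> ?r (insert (z, z') W1) e" if u: "e (u * b + i) = Suc z" and v: "e (v * b + i) = Suc z'"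
  proof -
    let ?W = "insert (z, z') W1"
    have z: "z \<in> active" "z' \<in> active"
      using D(3)[OF uv(1) i u] D(3)[OF uv(2) i v] by auto
    have "V z = V z'" if V: "bicompatible V" for V :: sets
    proof -
      have "V (doubled z i) = V (doubled z' i)"
        using D(6)[OF V uv(1) i u] D(6)[OF V uv(2) i v] V_uv(1)[OF V] by simp
      then show ?thesis
        using V z i unfolding bicompatible_def by blast
    qed
    then have "sound ?r ?W e"
      using s1 z by (intro sound_insert) auto
    then show ?thesis
    proof (rule closingI)
      fix x a assume x: "x \<in> active" "a < b"
      show "f (doubled x a) = f (doubled (\<rho> a x) a)" if "compat ?r ?W f" for f
        using forward[OF x] that by simp
      show "\<exists>w. e (\<rho> a (doubled x a) * b + a) = Suc w \<and> (\<forall>f. compat ?r ?W f \<longrightarrow> f x = f w)"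
      proof (cases "a = i \<and> r (doubled x a) = u")
        case True
        then have "e (\<rho> a (doubled x a) * b + a) = Suc z'"
          using moved(1)[of x] v by auto
        moreover have "f x = f z'" if f: "compat ?r ?W f" for f
        proof -
          have "compat ?r W1 f" "f z = f z'" "r (doubled x i) = u"
            using f True by auto
          then show ?thesis
            using incoming_u[OF x(1) _ u, of f] by simp
        qed
        ultimately show ?thesis by blast
      next
        case False
        then obtain w where w: "e (\<rho> a (doubled x a) * b + a) = Suc w"
            "\<forall>f. compat ?r W1 f \<longrightarrow> f x = f w"
          using incoming[OF x] by blast
        then show ?thesis by auto
      qed
    qed
  qed
qed

text \<open>Without pending pairs \<open>r\<close> itself is among the functions quantified over. If
  two states have successors in one class, both are equivalent to the single predecessor recorded
  there.\<close>

lemma closing_complete: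
  assumes c: "closing (\<lambda>_. r) r {} e"
  shows "bicompatible r"
    "\<And>V :: sets. bicompatible V \<Longrightarrow> x \<in> active \<Longrightarrow> V (r x) = V x"
proof -
  have r: "compat r {} r"
    by (simp add: compat_def)
  have F: "r (doubled x a) = r (doubled (r x) a)" if "x \<in> active" "a < b" for x a
    using closingD(2)[OF c that r] .
  have B: "\<exists>z. e (r (doubled x a) * b + a) = Suc z \<and> r x = r z" if "x \<in> active" "a < b" for x a
    using closingD(3)[OF c that] r by blast
  show "bicompatible r"
    unfolding bicompatible_def
  proof (intro ballI allI impI iffI)
    fix x y a assume xy: "x \<in> active" "y \<in> active" "a < b"
    show "r (doubled x a) = r (doubled y a)" if "r x = r y"
      using F[OF xy(1,3)] F[OF xy(2,3)] that by simp
    show "r x = r y" if eq: "r (doubled x a) = r (doubled y a)"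
    proof -
      obtain z where "e (r (doubled x a) * b + a) = Suc z" "r x = r z"
        using B[OF xy(1,3)] by blast
      moreover obtain z' where "e (r (doubled x a) * b + a) = Suc z'" "r y = r z'"
        using B[OF xy(2,3)] unfolding eq by blast
      ultimately show ?thesis by simp
    qed
  qed
  show "\<And>V :: sets. bicompatible V \<Longrightarrow> x \<in> active \<Longrightarrow> V (r x) = V x"
    using soundD(4)[OF closingD(1)[OF c]] .
qed

end

section \<open>Correctness and time of the closure program\<close>

context recurrent_states
begin

lemma row_simps:
  assumes "loaded M" "x < 2 * N"
  shows "M rowA x = x * b" "a < b \<Longrightarrow> M deltaA (x * b + a) = doubled x a"
  using assms by (simp_all add: loaded_def)

lemma wp_mirror:
  assumes M: "loaded M" "support (M liveA) = R"
  shows "wp mirror (\<lambda>M' _ _. support (M' liveA) = active) M xs (4 * N + 2)"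
  unfolding mirror_def
proof (rule wp_For[where K = N and C = 2 and
      I = "\<lambda>i M' xs'. support (M' liveA) = R \<union> {N + q | q. q \<in> R \<and> q < i}"])
  let ?body = "Cond (Arr liveA (Var xV)) (Put liveA (Plus (Var NV) (Var xV)) (Num 1)) Skip"
  fix i M' xs'
  assume i: "i < N" "M' xV 0 = i" and I: "support (M' liveA) = R \<union> {N + q | q. q \<in> R \<and> q < i}"
    and un: "unchanged (insert xV (writes ?body)) M M'"
  have i_live: "i \<in> support (M' liveA) \<longleftrightarrow> i \<in> R"
    using I i by auto
  have "R \<union> {N + q | q. q \<in> R \<and> q < Suc i} =
      (if i \<in> R then insert (N + i) (R \<union> {N + q | q. q \<in> R \<and> q < i}) else R \<union> {N + q | q. q \<in> R \<and> q < i})"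
    by (auto simp: less_Suc_eq)
  then show "wp ?body (\<lambda>M'' xs'' _. support (upd M'' xV 0 (Suc i) liveA) =
      R \<union> {N + q | q. q \<in> R \<and> q < Suc i}) M' xs' 2"
    using i_live i I un M(1) by (simp add: loaded_simps)
next
  fix M' assume "support (M' liveA) = R \<union> {N + q | q. q \<in> R \<and> q < N}"
  then show "support (M' liveA) = active"
    using R_less by (auto simp: active_def)
qed (use M in \<open>auto simp: loaded_simps\<close>)

lemma wp_singletons:
  assumes M: "loaded M"
  shows "wp singletons (\<lambda>M' _ _. union_find (2 * N) (\<lambda>x. x) (M' parA) (M' sizeA)) M xs (8 * N + 2)"
  unfolding singletons_def
proof (rule wp_For[where K = "2 * N" and C = 2 and
      I = "\<lambda>i M' xs'. \<forall>x<i. M' parA x = x \<and> M' sizeA x = 1"])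
  fix M' assume "\<forall>x<2 * N. M' parA x = x \<and> M' sizeA x = 1"
  then show "union_find (2 * N) (\<lambda>x. x) (M' parA) (M' sizeA)"
    by (intro union_find_singletons) auto
qed (use M in \<open>auto simp: loaded_simps less_Suc_eq fun_upd_apply\<close>)

text \<open>The invariant while edges are entered. For the identity as root function the forward
  half of \<open>closing\<close> is trivial, so only the recorded predecessors matter;
  \<open>P\<close> collects the edges treated so far.\<close>

definition linked :: "(nat \<times> nat) set \<Rightarrow> (nat \<times> nat) set \<Rightarrow> (nat \<Rightarrow> nat) \<Rightarrow> bool" where
  "linked P W e \<longleftrightarrow> sound (\<lambda>x. x) W e \<and> (\<forall>(x, a)\<in>P.
     \<exists>z. e (doubled x a * b + a) = Suc z \<and> (\<forall>f. compat (\<lambda>x. x) W f \<longrightarrow> f x = f z))"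

lemma linked_empty: "linked {} {} (\<lambda>_. 0)"
  unfolding linked_def sound_def by simp

lemma linked_closing:
  assumes "linked (active \<times> {..<b}) W e"
  shows "closing (\<lambda>_ x. x) (\<lambda>x. x) W e"
  using assms unfolding linked_def by (intro closingI) auto

lemma linked_step:
  assumes l: "linked P W e" and x: "x \<in> active" "i < b"
  shows "e (doubled x i * b + i) = 0 \<Longrightarrow> P \<subseteq> UNIV \<times> {..<b} \<Longrightarrow>
      linked (insert (x, i) P) W (e(doubled x i * b + i := Suc x))"
    and "e (doubled x i * b + i) = Suc z \<Longrightarrow> linked (insert (x, i) P) (insert (x, z) W) e"
proof -
  let ?y = "doubled x i"
  have s: "sound (\<lambda>x. x) W e"
    and old: "\<And>x a. (x, a) \<in> P \<Longrightarrow>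
      \<exists>z. e (doubled x a * b + a) = Suc z \<and> (\<forall>f. compat (\<lambda>x. x) W f \<longrightarrow> f x = f z)"
    using l unfolding linked_def by auto
  note D = soundD[OF s]
  show "linked (insert (x, i) P) W (e(?y * b + i := Suc x))"
    if 0: "e (?y * b + i) = 0" and P: "P \<subseteq> UNIV \<times> {..<b}"
  proof -
    let ?e = "e(?y * b + i := Suc x)"
    have e: "?e (y * b + a) = (if y = ?y \<and> a = i then Suc x else e (y * b + a))" if "a < b" for y a
      using index_eq_iff[OF that x(2), of y ?y] by (simp add: fun_upd_apply)
    have "sound (\<lambda>x. x) W ?e"
    proof (rule soundI)
      show "w \<in> active" if "y \<in> active" "a < b" "?e (y * b + a) = Suc w" for y a w
        using that x D(3)[of y a w] unfolding e[OF that(2)] by (auto split: if_splits)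
      show "V (doubled w a) = V y" if "bicompatible V" "y \<in> active" "a < b" "?e (y * b + a) = Suc w"
        for V :: sets and y a w
        using that D(6)[OF that(1), of y a w] unfolding e[OF that(3)] by (auto split: if_splits)
    qed (use D in auto)
    moreover have "\<exists>z. ?e (doubled w a * b + a) = Suc z \<and> (\<forall>f. compat (\<lambda>x. x) W f \<longrightarrow> f w = f z)"
      if wa: "(w, a) \<in> insert (x, i) P" for w a
    proof (cases "(w, a) = (x, i)")
      case True
      then show ?thesis by auto
    next
      case False
      then obtain z where z: "e (doubled w a * b + a) = Suc z" "\<forall>f. compat (\<lambda>x. x) W f \<longrightarrow> f w = f z"
        using old wa by blast
      moreover have "a < b"
        using False wa P by auto
      ultimately show ?thesis
        using e[of a "doubled w a"] 0 by auto
    qed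
    ultimately show ?thesis
      unfolding linked_def by blast
  qed
  show "linked (insert (x, i) P) (insert (x, z) W) e" if z: "e (?y * b + i) = Suc z"
  proof -
    have y: "?y \<in> active" and "z \<in> active"
      using doubled_active x D(3)[OF _ x(2) z] by auto
    have "V x = V z" if V: "bicompatible V" for V :: sets
      using D(6)[OF V y x(2) z] V x \<open>z \<in> active\<close> unfolding bicompatible_def by metis
    then have "sound (\<lambda>x. x) (insert (x, z) W) e"
      using s x \<open>z \<in> active\<close> by (intro sound_insert)
    moreover have "\<exists>z'. e (doubled w a * b + a) = Suc z' \<and>
        (\<forall>f. compat (\<lambda>x. x) (insert (x, z) W) f \<longrightarrow> f w = f z')"
      if wa: "(w, a) \<in> insert (x, i) P" for w a
    proof (cases "(w, a) = (x, i)")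
      case True
      then show ?thesis using z by auto
    next
      case False
      then show ?thesis using old[of w a] wa by auto
    qed
    ultimately show ?thesis
      unfolding linked_def by blast
  qed
qed

lemma wp_links:
  assumes M: "loaded M" and x: "M xV 0 = x" "x \<in> active"
    and l: "linked P (pairs M) (M inA)" and P: "P \<subseteq> UNIV \<times> {..<b}"
  shows "wp (For aV (Var bV) link) (\<lambda>M' xs' _. linked (P \<union> {x} \<times> {..<b}) (pairs M') (M' inA) \<and>
     M' spV 0 \<le> M spV 0 + b) M xs (8 * b + 2)"
proof (rule wp_For[where K = b and C = 6 and
      I = "\<lambda>i M' xs'. linked (P \<union> {x} \<times> {..<i}) (pairs M') (M' inA) \<and> M' spV 0 \<le> M spV 0 + i"])
  let ?I = "\<lambda>i M'. linked (P \<union> {x} \<times> {..<i}) (pairs M') (M' inA) \<and> M' spV 0 \<le> M spV 0 + i"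
  fix i M' xs'
  assume i: "i < b" "M' aV 0 = i"
    and I: "?I i M'"
    and un: "unchanged (insert aV (writes link)) M M'"
  have xD: "x < 2 * N" "doubled x i < 2 * N"
    using active_less doubled_active x i by auto
  have rows: "M rowA x = x * b" "M deltaA (x * b + i) = doubled x i" "M rowA (doubled x i) = doubled x i * b"
    using row_simps[OF M] xD i by simp_all
  have "P \<union> {x} \<times> {..<Suc i} = insert (x, i) (P \<union> {x} \<times> {..<i})"
    by (auto simp: lessThan_Suc)
  moreover have "P \<union> {x} \<times> {..<i} \<subseteq> UNIV \<times> {..<b}"
    using P i by auto
  moreover obtain c where c: "M' inA (doubled x i * b + i) = c"
    by blast
  ultimately show "wp link (\<lambda>M'' xs'' _. ?I (Suc i) (upd M'' aV 0 (Suc i))) M' xs' 6"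
    using un i x I rows linked_step[OF I[THEN conjunct1] x(2) i(1)]
    by (cases c) (simp_all add: link_def)
qed (use assms in \<open>auto simp: loaded_simps link_def\<close>)

lemma wp_link_all:
  assumes M: "loaded M" "support (M liveA) = active" "M inA = (\<lambda>_. 0)" "M spV 0 = 0"
  shows "wp link_all (\<lambda>M' _ _. closing (\<lambda>_ x. x) (\<lambda>x. x) (pairs M') (M' inA) \<and> M' spV 0 \<le> 2 * N * b)
     M xs (2 * N * (8 * b + 5) + 2)"
  unfolding link_all_def
proof (rule wp_For[where K = "2 * N" and C = "8 * b + 3" and
      I = "\<lambda>i M' xs'. linked ((active \<inter> {..<i}) \<times> {..<b}) (pairs M') (M' inA) \<and> M' spV 0 \<le> i * b"])
  let ?I = "\<lambda>i M'. linked ((active \<inter> {..<i}) \<times> {..<b}) (pairs M') (M' inA) \<and> M' spV 0 \<le> i * b"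
  let ?body = "Cond (Arr liveA (Var xV)) (For aV (Var bV) link) Skip"
  fix i M' xs'
  assume i: "i < 2 * N" "M' xV 0 = i"
    and I: "?I i M'"
    and un: "unchanged (insert xV (writes ?body)) M M'"
  have M': "loaded M'"
    by (rule loaded_cong[OF M(1) un]) (simp add: link_def)
  have live: "support (M' liveA) = active"
    using un M(2) by (simp add: link_def)
  show "wp ?body (\<lambda>M'' xs'' _. ?I (Suc i) (upd M'' xV 0 (Suc i))) M' xs' (8 * b + 3)"
  proof (cases "i \<in> active")
    case True
    then have "(active \<inter> {..<Suc i}) \<times> {..<b} = (active \<inter> {..<i}) \<times> {..<b} \<union> {i} \<times> {..<b}"
      by (auto simp: less_Suc_eq)
    moreover have "wp (For aV (Var bV) link) (\<lambda>M'' xs' _.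
        linked ((active \<inter> {..<i}) \<times> {..<b} \<union> {i} \<times> {..<b}) (pairs M'') (M'' inA) \<and>
        M'' spV 0 \<le> M' spV 0 + b) M' xs' (8 * b + 2)"
      using M' i True I by (intro wp_links) auto
    then have "wp (For aV (Var bV) link) (\<lambda>M'' xs' _.
        linked ((active \<inter> {..<i}) \<times> {..<b} \<union> {i} \<times> {..<b}) (pairs M'') (M'' inA) \<and>
        M'' spV 0 \<le> Suc i * b) M' xs' (8 * b + 2)"
      by (rule wp_mono) (use I in auto)
    ultimately show ?thesis
      using True live i by simp
  next
    case False
    then have "active \<inter> {..<Suc i} = active \<inter> {..<i}"
      by (auto simp: less_Suc_eq)
    then show ?thesis
      using False live i I by simp
  qed
next
  fix M' assume I: "linked ((active \<inter> {..<2 * N}) \<times> {..<b}) (pairs M') (M' inA) \<and> M' spV 0 \<le> 2 * N * b"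
  have "active \<inter> {..<2 * N} = active"
    using active_less by auto
  then show "closing (\<lambda>_ x. x) (\<lambda>x. x) (pairs M') (M' inA) \<and> M' spV 0 \<le> 2 * N * b"
    using I linked_closing by simp
qed (use M linked_empty in \<open>auto simp: loaded_simps link_def\<close>)

lemma wp_transfers:
  assumes M: "loaded M" and uv: "M uV 0 = u" "M vV 0 = v" "u \<in> active" "v \<in> active" "r u = u" "r v = v" "u \<noteq> v"
    and c: "merging r u v 0 (pairs M) (M inA)"
  shows "wp (For aV (Var bV) transfer) (\<lambda>M' xs' _.
       merging r u v b (pairs M') (M' inA) \<and>
       M' spV 0 \<le> M spV 0 + 2 * b) M xs (12 * b + 2)"
proof (rule wp_For[where K = b and C = 10 and
      I = "\<lambda>i M' xs'. merging r u v i (pairs M') (M' inA) \<and>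
       M' spV 0 \<le> M spV 0 + 2 * i"])
  fix i M' xs'
  assume i: "i < b" "M' aV 0 = i"
    and I: "merging r u v i (pairs M') (M' inA) \<and>
       M' spV 0 \<le> M spV 0 + 2 * i"
    and un: "unchanged (insert aV (writes transfer)) M M'"
  have rows: "M rowA u = u * b" "M deltaA (u * b + i) = doubled u i"
     "M rowA v = v * b" "M deltaA (v * b + i) = doubled v i"
    using row_simps[OF M] active_less uv i by simp_all
  obtain c d where cd: "M' inA (u * b + i) = c" "M' inA (v * b + i) = d"
    by blast
  show "wp transfer (\<lambda>M'' xs'' _. merging r u v (Suc i)
      (pairs (upd M'' aV 0 (Suc i))) (upd M'' aV 0 (Suc i) inA) \<and>
      upd M'' aV 0 (Suc i) spV 0 \<le> M spV 0 + 2 * Suc i) M' xs' 10"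
    using un i uv I rows cd closing_transfer[OF I[THEN conjunct1] i(1) uv(3-7)]
    by (cases c; cases d) (simp_all add: transfer_def)
qed (use assms in \<open>auto simp: loaded_simps transfer_def\<close>)

definition roots :: "(nat \<Rightarrow> nat) \<Rightarrow> nat set" where
  "roots r = {x. x < 2 * N \<and> r x = x}"

text \<open>The loss of one root pays for the merge and for the at most \<open>2 * b\<close> pairs
  it adds.\<close>

lemma wp_merge:
  assumes M: "loaded M" and xy: "M uV 0 = r x" "M vV 0 = r y" "r x \<noteq> r y"
    and uf: "union_find (2 * N) r (M parA) (M sizeA)"
    and c: "closing (\<lambda>_. r) r (insert (x, y) (pairs M)) (M inA)"
  shows "wp merge (\<lambda>M' xs' _. \<exists>r'. union_find (2 * N) r' (M' parA) (M' sizeA) \<and>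
      closing (\<lambda>_. r') r' (pairs M') (M' inA) \<and> M' spV 0 \<le> M spV 0 + 2 * b \<and>
      Suc (card (roots r')) = card (roots r)) M xs (12 * b + 8)"
  (is "wp merge ?Q M xs _")
proof -
  have xyD: "x \<in> active" "y \<in> active"
    using soundD(2)[OF closingD(1)[OF c]] by auto
  then have rD: "r x \<in> active" "r y \<in> active" "r x < 2 * N" "r y < 2 * N"
    using soundD(1)[OF closingD(1)[OF c]] active_less by auto
  have rr: "r (r x) = r x" "r (r y) = r y"
    using union_findD(2)[OF uf] active_less xyD by auto
  have "wp order_roots (\<lambda>M' _ _. (M' uV 0 = r x \<and> M' vV 0 = r y \<or> M' uV 0 = r y \<and> M' vV 0 = r x) \<and>
      M sizeA (M' uV 0) \<le> M sizeA (M' vV 0)) M xs 4"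
    using xy by (auto simp: order_roots_def)
  then have "wp order_roots (wp (Put parA (Var uV) (Var vV) ;;
     Put sizeA (Var vV) (Plus (Arr sizeA (Var uV)) (Arr sizeA (Var vV))) ;;
     For aV (Var bV) transfer) ?Q) M xs (12 * b + 8)"
  proof (rule wp_weaken)
    fix M1 xs1 T1
    assume 1: "(M1 uV 0 = r x \<and> M1 vV 0 = r y \<or> M1 uV 0 = r y \<and> M1 vV 0 = r x) \<and>
        M sizeA (M1 uV 0) \<le> M sizeA (M1 vV 0)"
      and un: "unchanged (writes order_roots) M M1" and T: "12 * b + 8 - 4 \<le> T1"
    define u where "u = M1 uV 0"
    define v where "v = M1 vV 0"
    have uv: "u = r x \<and> v = r y \<or> u = r y \<and> v = r x" "M sizeA u \<le> M sizeA v"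
      using 1 by (auto simp: u_def v_def)
    have uv': "u \<in> active" "v \<in> active" "r u = u" "r v = v" "u \<noteq> v" "u < 2 * N" "v < 2 * N"
      using uv(1) rD rr xy(3) by auto
    define M2 where "M2 = upd (upd M1 parA u v) sizeA v (M sizeA u + M sizeA v)"
    have "loaded M1"
      by (rule loaded_cong[OF M un]) (simp add: order_roots_def)
    then have M2: "loaded M2"
      using loaded_cong[of M1 "{parA, sizeA}" M2] by (simp add: M2_def)
    have uf2: "union_find (2 * N) (merged r u v) (M2 parA) (M2 sizeA)"
      using union_find_merge[OF uf uv'(6,3,7,4,5) uv(2)] un by (simp add: M2_def order_roots_def)
    have c2: "merging r u v 0 (pairs M2) (M2 inA)"
      using closing_merge[OF c uv(1)] un by (simp add: M2_def order_roots_def)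
    have "roots (merged r u v) = roots r - {u}" "u \<in> roots r" "finite (roots r)"
      using uv' by (auto simp: roots_def merged_def)
    then have card: "Suc (card (roots (merged r u v))) = card (roots r)"
      by (metis card_Suc_Diff1)
    have M2_simps: "M2 uV 0 = u" "M2 vV 0 = v" "M2 spV 0 = M spV 0"
      using un by (simp_all add: M2_def u_def v_def order_roots_def)
    have "wp (For aV (Var bV) transfer) ?Q M2 xs1 (T1 - 1 - 1)"
    proof (rule wp_weaken[OF wp_transfers[OF M2 M2_simps(1,2) uv'(1-5) c2]])
      fix M3 xs3 T3
      assume 3: "merging r u v b (pairs M3) (M3 inA) \<and>
         M3 spV 0 \<le> M2 spV 0 + 2 * b"
        and un3: "unchanged (writes (For aV (Var bV) transfer)) M2 M3"
      have "union_find (2 * N) (merged r u v) (M3 parA) (M3 sizeA)"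
        using uf2 un3 by (simp add: transfer_def)
      then show "?Q M3 xs3 T3"
        using 3 closing_merged M2_simps(3) card by (intro exI[of _ "merged r u v"]) auto
    qed (use T in simp)
    then show "wp (Put parA (Var uV) (Var vV) ;;
       Put sizeA (Var vV) (Plus (Arr sizeA (Var uV)) (Arr sizeA (Var vV))) ;;
       For aV (Var bV) transfer) ?Q M1 xs1 T1"
      using T un by (simp add: M2_def u_def v_def order_roots_def)
  qed simp
  then show ?thesis
    by (simp only: merge_def wp_Seq)
qed

text \<open>Amortised cost for \<open>m\<close> pending pairs and \<open>k\<close> roots. Handling a
  pair, including both searches, takes \<open>4 * L + 8\<close>. Each root may be absorbed once, at
  a price that prepays the pairs created by that merge.\<close>

definition closing_time :: "nat \<Rightarrow> nat \<Rightarrow> nat \<Rightarrow> nat" where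
  "closing_time L m k = m * (4 * L + 8) + k * (2 * b * (4 * L + 8) + 12 * b + 10) + 1"

lemma wp_close_pairs:
  assumes M: "loaded M" and uf: "union_find (2 * N) r0 (M parA) (M sizeA)"
    and c: "closing (\<lambda>_. r0) r0 (pairs M) (M inA)" and L: "2 * N < 2 ^ L"
  shows "wp close_pairs (\<lambda>M' _ _. \<exists>r. union_find (2 * N) r (M' parA) (M' sizeA) \<and> bicompatible r \<and>
      (\<forall>V :: sets. \<forall>x\<in>active. bicompatible V \<longrightarrow> V (r x) = V x)) M xs
      (closing_time L (M spV 0) (2 * N))"
  unfolding close_pairs_def
proof (rule wp_Loop[where I = "\<lambda>M' xs' T. \<exists>r. union_find (2 * N) r (M' parA) (M' sizeA) \<and>
      closing (\<lambda>_. r) r (pairs M') (M' inA) \<and> closing_time L (M' spV 0) (card (roots r)) \<le> T"])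
  let ?I = "\<lambda>M' xs' T. \<exists>r. union_find (2 * N) r (M' parA) (M' sizeA) \<and>
      closing (\<lambda>_. r) r (pairs M') (M' inA) \<and> closing_time L (M' spV 0) (card (roots r)) \<le> T"
  have "card (roots r0) \<le> card {..<2 * N}"
    by (rule card_mono) (auto simp: roots_def)
  then have "closing_time L (M spV 0) (card (roots r0)) \<le> closing_time L (M spV 0) (2 * N)"
    unfolding closing_time_def by (intro add_mono mult_le_mono1) auto
  then show "?I M xs (closing_time L (M spV 0) (2 * N))"
    using uf c by blast
  let ?tail = "Cond (distE (Var uV) (Var vV)) merge Skip"
  let ?body = "spV ::= Minus (Var spV) (Num 1) ;; uV ::= Arr leftA (Var spV) ;;
      vV ::= Arr rightA (Var spV) ;; find_root uV ;; find_root vV ;; ?tail"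
  fix M' xs' T'
  assume "?I M' xs' T'" and un: "unchanged (writes ?body) M M'" and pos: "0 < aval M' (Var spV)"
  then obtain r where uf: "union_find (2 * N) r (M' parA) (M' sizeA)"
    and c: "closing (\<lambda>_. r) r (pairs M') (M' inA)" and T: "closing_time L (M' spV 0) (card (roots r)) \<le> T'"
    by blast
  have M': "loaded M'"
    by (rule loaded_cong[OF M un])
      (simp add: find_root_def merge_def order_roots_def transfer_def)
  obtain m where m: "M' spV 0 = Suc m"
    using pos gr0_conv_Suc by auto
  define x where "x = M' leftA m"
  define y where "y = M' rightA m"
  define W where "W = pairs_of (M' leftA) (M' rightA) m"
  have c: "closing (\<lambda>_. r) r (insert (x, y) W) (M' inA)"
    using c by (simp add: m pairs_of_Suc x_def y_def W_def)
  then have xy: "x < 2 * N" "y < 2 * N"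
    using soundD(2)[OF closingD(1)[OF c]] active_less by auto
  define M2 where "M2 = upd (upd (upd M' spV 0 m) uV 0 x) vV 0 y"
  have time: "closing_time L (Suc m) k = closing_time L m k + (4 * L + 8)"
      "closing_time L m (Suc k) = closing_time L m k + (2 * b * (4 * L + 8) + 12 * b + 10)" for m k
    unfolding closing_time_def by simp_all
  have T: "closing_time L m (card (roots r)) + (4 * L + 8) \<le> T'"
    using T by (simp add: m time)
  have tail: "wp ?tail ?I M4 xs4 T4"
    if un4: "unchanged {uV, vV} M2 M4" and uv: "M4 uV 0 = r x" "M4 vV 0 = r y"
      and T4: "closing_time L m (card (roots r)) + 2 \<le> T4" for M4 xs4 T4
  proof -
    have eqs: "M4 parA = M' parA" "M4 sizeA = M' sizeA" "M4 inA = M' inA" "M4 spV 0 = m"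
        "pairs_of (M4 leftA) (M4 rightA) m = W"
      using un4 by (simp_all add: M2_def W_def)
    show ?thesis
    proof (cases "r x = r y")
      case True
      have "?I M4 xs4 (T4 - 1)"
        using closing_drop[OF c True] uf T4 unfolding eqs by (intro exI[of _ r]) auto
      then show ?thesis
        using True uv T4 by simp
    next
      case False
      have "loaded M2"
        using loaded_cong[OF M', of "{spV, uV, vV}" M2] by (simp add: M2_def)
      then have M4: "loaded M4"
        using loaded_cong[OF _ un4] by simp
      have "wp merge ?I M4 xs4 (T4 - 1)"
      proof (rule wp_weaken[OF wp_merge[of M4 r x y, OF M4 uv False]])
        show "union_find (2 * N) r (M4 parA) (M4 sizeA)"
          "closing (\<lambda>_. r) r (insert (x, y) (pairs M4)) (M4 inA)"
          using uf c unfolding eqs by auto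
        \<comment> \<open>A root is present, so its credits can be spent on this merge.\<close>
        have "card (roots r) \<noteq> 0"
        proof -
          have "r x \<in> roots r" "finite (roots r)"
            using union_findD[OF uf xy(1)] by (auto simp: roots_def)
          then show ?thesis by auto
        qed
        then obtain k where k: "card (roots r) = Suc k"
          using not0_implies_Suc by blast
        show "12 * b + 8 \<le> T4 - 1"
          using T4 by (simp add: k time)
        fix M5 xs5 T5
        assume "\<exists>r'. union_find (2 * N) r' (M5 parA) (M5 sizeA) \<and>
          closing (\<lambda>_. r') r' (pairs M5) (M5 inA) \<and> M5 spV 0 \<le> M4 spV 0 + 2 * b \<and>
          Suc (card (roots r')) = card (roots r)"
          and T5: "T4 - 1 - (12 * b + 8) \<le> T5"
        then obtain r' where r': "union_find (2 * N) r' (M5 parA) (M5 sizeA)"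
          "closing (\<lambda>_. r') r' (pairs M5) (M5 inA)" "M5 spV 0 \<le> m + 2 * b" "card (roots r') = k"
          unfolding eqs k by auto
        have "closing_time L (M5 spV 0) k \<le> closing_time L (m + 2 * b) k"
          using r'(3) unfolding closing_time_def by (intro add_mono mult_le_mono1) auto
        also have "\<dots> = closing_time L m k + 2 * b * (4 * L + 8)"
          unfolding closing_time_def by (simp add: add_mult_distrib)
        also have "\<dots> \<le> T5"
          using T4 T5 by (simp add: k time)
        finally show "?I M5 xs5 T5"
          using r' by blast
      qed
      moreover have "0 < r x - r y + (r y - r x)"
        using False by arith
      ultimately show ?thesis
        using uv T4 by simp
    qed
  qed
  have "wp (find_root uV) (wp (find_root vV) (wp ?tail ?I)) M2 xs' (T' - Suc (Suc (Suc (Suc 0))))"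
  proof (rule wp_weaken[OF wp_find[where r = r and L = L and D = "2 * N"]])
    fix M3 xs3 T3
    assume 3: "xs3 = xs' \<and> M3 uV 0 = r (M2 uV 0)" and un3: "unchanged (writes (find_root uV)) M2 M3"
      and T3: "T' - Suc (Suc (Suc (Suc 0))) - (2 * L + 1) \<le> T3"
    show "wp (find_root vV) (wp ?tail ?I) M3 xs3 T3"
    proof (rule wp_weaken[OF wp_find[where r = r and L = L and D = "2 * N"]])
      fix M4 xs4 T4
      assume 4: "xs4 = xs3 \<and> M4 vV 0 = r (M3 vV 0)" and un4: "unchanged (writes (find_root vV)) M3 M4"
        and T4: "T3 - (2 * L + 1) \<le> T4"
      show "wp ?tail ?I M4 xs4 T4"
        by (rule tail) (use 3 4 un3 un4 T T3 T4 in \<open>auto simp: find_root_def M2_def\<close>)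
    qed (use uf xy L T T3 un3 in \<open>auto simp: find_root_def M2_def\<close>)
  qed (use uf xy L T in \<open>auto simp: M2_def\<close>)
  then show "0 < T' \<and> wp ?body ?I M' xs' (T' - 1)"
    using T m by (simp add: M2_def x_def y_def wp_Seq_fun)
next
  fix M' xs' T'
  assume "\<exists>r. union_find (2 * N) r (M' parA) (M' sizeA) \<and>
      closing (\<lambda>_. r) r (pairs M') (M' inA) \<and> closing_time L (M' spV 0) (card (roots r)) \<le> T'"
    and zero: "aval M' (Var spV) = 0"
  then obtain r where r: "union_find (2 * N) r (M' parA) (M' sizeA)"
      "closing (\<lambda>_. r) r {} (M' inA)" "closing_time L 0 (card (roots r)) \<le> T'"
    by auto
  then show "0 < T' \<and> (\<exists>r. union_find (2 * N) r (M' parA) (M' sizeA) \<and> bicompatible r \<and>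
      (\<forall>V :: sets. \<forall>x\<in>active. bicompatible V \<longrightarrow> V (r x) = V x))"
    using closing_complete[OF r(2)] by (auto simp: closing_time_def)
qed

end

section \<open>The decision procedure\<close>

definition mark_edge :: com where
  "mark_edge = Cond (Var aV)
     (yV ::= deltaE (Var xV) (Var aV) ;; Put markA (Var yV) (Num 1) ;;
      Put markA (deltaE (Var yV) (Num 0)) (Num 1))
     Skip"

definition mark_all :: com where
  "mark_all = For xV (Var NV) (Cond (Arr liveA (Var xV)) (For aV (Var bV) mark_edge) Skip)"

text \<open>Labels are increased by 1, so that 0 means that no mark of the class has been seen. The
  first mark sets the label; a later contradiction raises the flag.\<close>

definition label_root :: com where
  "label_root = Cond (Arr labA (Var uV))
     (Cond (distE (Arr labA (Var uV)) (Plus (Arr finA (Var xV)) (Num 1))) (resV ::= Num 1) Skip)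
     (Put labA (Var uV) (Plus (Arr finA (Var xV)) (Num 1)))"

definition label_all :: com where
  "label_all = For xV (Var NV)
     (Cond (Arr markA (Var xV)) (uV ::= Var xV ;; find_root uV ;; label_root) Skip)"

text \<open>Until the last assignment \<open>resV\<close> is a failure flag. If zero closure fails,
  the remaining phases still run and stay within their bounds, and the flag remains raised.\<close>

definition program :: com where
  "program = load ;; search ;; check_zeros ;; degrees ;; peel ;; mirror ;; singletons ;; link_all ;;
     close_pairs ;; mark_all ;; label_all ;; resV ::= Minus (Num 1) (Var resV)"

lemmas program_defs = load_def load_rows_def load_sink_def load_shifted_def load_carry_def
  search_def visit_def check_zeros_def degrees_def count_edges_def peel_def remove_edge_def
  mirror_def singletons_def link_all_def link_def close_pairs_def find_root_def merge_def
  order_roots_def transfer_def mark_all_def mark_edge_def label_all_def label_root_def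

section \<open>Marks, labels and the verdict\<close>

context recurrent_states
begin

definition marks_of :: "(nat \<times> nat) set \<Rightarrow> nat set" where
  "marks_of E = (\<lambda>(q, a). \<delta> q a) ` E \<union> (\<lambda>(q, a). \<delta> (\<delta> q a) 0) ` E"

lemma marks_of_insert: "marks_of (insert (q, a) E) = insert (\<delta> (\<delta> q a) 0) (insert (\<delta> q a) (marks_of E))"
  by (auto simp: marks_of_def)

lemma marks_eq: "marks = marks_of (R \<times> {0<..<b})"
  unfolding marks_def marks_of_def by force

lemma wp_mark_edges:
  assumes M: "loaded M" and x: "M xV 0 = x" "x \<in> R" and m: "support (M markA) = marks_of E"
  shows "wp (For aV (Var bV) mark_edge)
    (\<lambda>M' _ _. support (M' markA) = marks_of (E \<union> {x} \<times> {0<..<b})) M xs (6 * b + 2)"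
proof (rule wp_For[where K = b and C = 4 and
      I = "\<lambda>i M' xs'. support (M' markA) = marks_of (E \<union> {x} \<times> {0<..<i})"])
  fix i M' xs'
  assume i: "i < b" "M' aV 0 = i" and I: "support (M' markA) = marks_of (E \<union> {x} \<times> {0<..<i})"
    and un: "unchanged (insert aV (writes mark_edge)) M M'"
  have "x < N" "\<delta> x i < N"
    using R_less x(2) \<delta> i(1) by auto
  then have rows: "M deltaA (M rowA x + i) = \<delta> x i" "M deltaA (M rowA (\<delta> x i)) = \<delta> (\<delta> x i) 0"
    using loaded_delta[OF M] i loaded_delta[OF M, of "\<delta> x i" 0] by auto
  have "E \<union> {x} \<times> {0<..<Suc i} = (if i = 0 then E \<union> {x} \<times> {0<..<i} else insert (x, i) (E \<union> {x} \<times> {0<..<i}))"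
    by (auto simp: less_Suc_eq)
  then show "wp mark_edge (\<lambda>M'' xs'' _. support (upd M'' aV 0 (Suc i) markA) =
      marks_of (E \<union> {x} \<times> {0<..<Suc i})) M' xs' 4"
    using un i x I rows by (auto simp: mark_edge_def marks_of_insert)
qed (use assms in \<open>auto simp: loaded_simps mark_edge_def\<close>)

lemma wp_mark_all:
  assumes M: "loaded M" "support (M liveA) = active" "M markA = (\<lambda>_. 0)"
  shows "wp mark_all (\<lambda>M' _ _. support (M' markA) = marks) M xs (N * (6 * b + 5) + 2)"
  unfolding mark_all_def
proof (rule wp_For[where K = N and C = "6 * b + 3" and
      I = "\<lambda>i M' xs'. support (M' markA) = marks_of ((R \<inter> {..<i}) \<times> {0<..<b})"])
  let ?body = "Cond (Arr liveA (Var xV)) (For aV (Var bV) mark_edge) Skip"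
  fix i M' xs'
  assume i: "i < N" "M' xV 0 = i" and I: "support (M' markA) = marks_of ((R \<inter> {..<i}) \<times> {0<..<b})"
    and un: "unchanged (insert xV (writes ?body)) M M'"
  have M': "loaded M'"
    by (rule loaded_cong[OF M(1) un]) (simp add: mark_edge_def)
  have live: "support (M' liveA) = active"
    using un M(2) by (simp add: mark_edge_def)
  have active: "i \<in> active \<longleftrightarrow> i \<in> R"
    using i by (auto simp: active_def)
  show "wp ?body (\<lambda>M'' xs'' _. support (upd M'' xV 0 (Suc i) markA) =
      marks_of ((R \<inter> {..<Suc i}) \<times> {0<..<b})) M' xs' (6 * b + 3)"
  proof (cases "i \<in> R")
    case True
    then have "(R \<inter> {..<Suc i}) \<times> {0<..<b} = (R \<inter> {..<i}) \<times> {0<..<b} \<union> {i} \<times> {0<..<b}"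
      by (auto simp: less_Suc_eq)
    then show ?thesis
      using True live active i wp_mark_edges[OF M' i(2) True I] by simp
  next
    case False
    then have "R \<inter> {..<Suc i} = R \<inter> {..<i}"
      by (auto simp: less_Suc_eq)
    then show ?thesis
      using False live active i I by simp
  qed
next
  fix M' assume "support (M' markA) = marks_of ((R \<inter> {..<N}) \<times> {0<..<b})"
  moreover have "R \<inter> {..<N} = R"
    using R_less by auto
  ultimately show "support (M' markA) = marks"
    by (simp add: marks_eq)
qed (use M in \<open>auto simp: loaded_simps mark_edge_def marks_of_def\<close>)

text \<open>Holds for the array in every case, as a label stems from some mark of its class. Freedom
  from conflicts is kept apart in \<open>agree\<close>, since it is what the flag records.\<close>

definition labelled :: "(nat \<Rightarrow> nat) \<Rightarrow> nat \<Rightarrow> (nat \<Rightarrow> nat) \<Rightarrow> bool" where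
  "labelled r i lab \<longleftrightarrow>
     (\<forall>u. lab u \<noteq> 0 \<longrightarrow> (\<exists>y\<in>marks. r y = u \<and> lab u = Suc (of_bool (fin y)))) \<and>
     (\<forall>y\<in>marks. y < i \<longrightarrow> lab (r y) \<noteq> 0)"

definition agree :: "(nat \<Rightarrow> nat) \<Rightarrow> nat \<Rightarrow> (nat \<Rightarrow> nat) \<Rightarrow> bool" where
  "agree r i lab \<longleftrightarrow> (\<forall>y\<in>marks. y < i \<longrightarrow> lab (r y) = Suc (of_bool (fin y)))"

lemma labelled_skip:
  assumes "labelled r i lab" "lab (r i) \<noteq> 0" "i \<in> marks"
  shows "labelled r (Suc i) lab"
    "agree r (Suc i) lab \<longleftrightarrow> agree r i lab \<and> lab (r i) = Suc (of_bool (fin i))"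
  using assms unfolding labelled_def agree_def by (auto simp: less_Suc_eq)

lemma labelled_new:
  assumes "labelled r i lab" "lab (r i) = 0" "i \<in> marks"
  shows "labelled r (Suc i) (lab(r i := Suc (of_bool (fin i))))"
    "agree r (Suc i) (lab(r i := Suc (of_bool (fin i)))) \<longleftrightarrow> agree r i lab"
proof -
  let ?lab = "lab(r i := Suc (of_bool (fin i)))"
  have lab: "?lab u = (if u = r i then Suc (of_bool (fin i)) else lab u)" for u
    by (simp add: fun_upd_apply)
  have ne: "r y \<noteq> r i" if "y \<in> marks" "y < i" for y
    using assms that unfolding labelled_def by metis
  show "labelled r (Suc i) ?lab"
    using assms unfolding labelled_def lab by (auto simp: less_Suc_eq)
  show "agree r (Suc i) ?lab \<longleftrightarrow> agree r i lab"
    unfolding agree_def lab using ne assms(3) by (auto simp: less_Suc_eq)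
qed

lemma labelled_other:
  assumes "i \<notin> marks"
  shows "labelled r (Suc i) lab \<longleftrightarrow> labelled r i lab" "agree r (Suc i) lab \<longleftrightarrow> agree r i lab"
  using assms unfolding labelled_def agree_def by (auto simp: less_Suc_eq)

lemma labelled_complete:
  assumes "labelled r N lab"
  shows "agree r N lab \<longleftrightarrow> (\<forall>y\<in>marks. \<forall>y'\<in>marks. r y = r y' \<longrightarrow> fin y = fin y')"
proof
  assume agree: "agree r N lab"
  show "\<forall>y\<in>marks. \<forall>y'\<in>marks. r y = r y' \<longrightarrow> fin y = fin y'"
  proof (intro ballI impI)
    fix y y' assume "y \<in> marks" "y' \<in> marks" "r y = r y'"
    then have "(of_bool (fin y) :: nat) = of_bool (fin y')"
      using agree R_less marks_R unfolding agree_def by (metis Suc_inject)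
    then show "fin y = fin y'"
      by (simp only: of_bool_eq_iff)
  qed
next
  assume eq: "\<forall>y\<in>marks. \<forall>y'\<in>marks. r y = r y' \<longrightarrow> fin y = fin y'"
  show "agree r N lab"
    unfolding agree_def
  proof (intro ballI impI)
    fix y assume y: "y \<in> marks" "y < N"
    then have "lab (r y) \<noteq> 0"
      using assms unfolding labelled_def by blast
    then obtain y' where y': "y' \<in> marks" "r y' = r y" "lab (r y) = Suc (of_bool (fin y'))"
      using assms unfolding labelled_def by blast
    then have "fin y' = fin y"
      using eq y(1) by blast
    then show "lab (r y) = Suc (of_bool (fin y))"
      using y'(3) by simp
  qed
qed

lemma wp_label_all:
  assumes M: "loaded M" "support (M markA) = marks" "M labA = (\<lambda>_. 0)"
    and uf: "union_find (2 * N) r (M parA) (M sizeA)" and L: "2 * N < 2 ^ L"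
  shows "wp label_all (\<lambda>M' _ _. M' resV 0 = 0 \<longleftrightarrow> M resV 0 = 0 \<and>
     (\<forall>y\<in>marks. \<forall>y'\<in>marks. r y = r y' \<longrightarrow> fin y = fin y')) M xs (N * (2 * L + 8) + 2)"
  unfolding label_all_def
proof (rule wp_For[where K = N and C = "2 * L + 6" and
      I = "\<lambda>i M' xs'. labelled r i (M' labA) \<and> (M' resV 0 = 0 \<longleftrightarrow> M resV 0 = 0 \<and> agree r i (M' labA))"])
  let ?body = "Cond (Arr markA (Var xV)) (uV ::= Var xV ;; find_root uV ;; label_root) Skip"
  fix i M' xs'
  assume i: "i < N" "M' xV 0 = i"
    and I: "labelled r i (M' labA) \<and> (M' resV 0 = 0 \<longleftrightarrow> M resV 0 = 0 \<and> agree r i (M' labA))"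
    and un: "unchanged (insert xV (writes ?body)) M M'"
  let ?Q = "\<lambda>M'' xs'' _. labelled r (Suc i) (upd M'' xV 0 (Suc i) labA) \<and>
      (upd M'' xV 0 (Suc i) resV 0 = 0 \<longleftrightarrow> M resV 0 = 0 \<and> agree r (Suc i) (upd M'' xV 0 (Suc i) labA))"
  have mark: "support (M' markA) = marks"
    using un M(2) by (simp add: label_root_def find_root_def)
  show "wp ?body ?Q M' xs' (2 * L + 6)"
  proof (cases "i \<in> marks")
    case False
    then show ?thesis
      using mark i I labelled_other[OF False] by simp
  next
    case True
    define M1 where "M1 = upd M' uV 0 i"
    have "wp (find_root uV) (wp label_root ?Q) M1 xs' (2 * L + 4)"
    proof (rule wp_weaken[OF wp_find[where r = r and L = L and D = "2 * N"]])
      fix M2 xs2 T2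
      assume 2: "xs2 = xs' \<and> M2 uV 0 = r (M1 uV 0)" and un2: "unchanged (writes (find_root uV)) M1 M2"
        and T2: "2 * L + 4 - (2 * L + 1) \<le> T2"
      have eqs: "M2 uV 0 = r i" "M2 xV 0 = i" "M2 finA i = of_bool (fin i)" "M2 labA = M' labA" "M2 resV = M' resV"
        using 2 un un2 i M(1) by (simp_all add: M1_def find_root_def label_root_def loaded_simps)
      show "wp label_root ?Q M2 xs2 T2"
      proof (cases "M' labA (r i) = 0")
        case 0: True
        then show ?thesis
          using I T2 eqs labelled_new[OF I[THEN conjunct1] 0 True] by (simp add: label_root_def)
      next
        case False
        have "0 < (k::nat) - l + (l - k) \<longleftrightarrow> k \<noteq> l" for k l
          by arith
        then show ?thesis
          using False I T2 eqs labelled_skip[OF I[THEN conjunct1] False True] by (simp add: label_root_def)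
      qed
    qed (use uf L un i in \<open>auto simp: M1_def label_root_def find_root_def\<close>)
    then show ?thesis
      using True mark i by (simp add: M1_def wp_Seq_fun add.commute)
  qed
next
  fix M' assume "labelled r N (M' labA) \<and> (M' resV 0 = 0 \<longleftrightarrow> M resV 0 = 0 \<and> agree r N (M' labA))"
  then show "M' resV 0 = 0 \<longleftrightarrow> M resV 0 = 0 \<and>
     (\<forall>y\<in>marks. \<forall>y'\<in>marks. r y = r y' \<longrightarrow> fin y = fin y')"
    using labelled_complete by blast
qed (use M in \<open>auto simp: loaded_simps label_root_def find_root_def labelled_def agree_def\<close>)

text \<open>By \<open>V (r x) = V x\<close> every bicompatible family is constant on the classes of
  \<open>r\<close>, in particular the corrected sets; these give acceptance at the marks, so a
  conflict refutes periodicity. Conversely \<open>r\<close> itself is bicompatible.\<close>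

lemma ultimately_periodic_iff_agree:
  fixes r :: "nat \<Rightarrow> nat"
  assumes zc: zero_closed and r: "bicompatible r"
    and V: "\<And>V :: sets. \<And>x. x \<in> active \<Longrightarrow> bicompatible V \<Longrightarrow> V (r x) = V x"
  shows "ultimately_periodic {m. acc i0 m} \<longleftrightarrow>
     (\<forall>y\<in>marks. \<forall>y'\<in>marks. r y = r y' \<longrightarrow> fin y = fin y')"
proof
  assume "ultimately_periodic {m. acc i0 m}"
  then obtain W :: sets where W: "bicompatible W" "\<forall>y\<in>marks. W y 0 = fin y"
    using recurrent_necessary[OF zc] by blast
  have "W y = W y'" if "y \<in> marks" "y' \<in> marks" "r y = r y'" for y y'
    using V[OF R_active(1)[OF marks_R[OF that(1)]] W(1)] V[OF R_active(1)[OF marks_R[OF that(2)]] W(1)] that(3)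
    by simp
  then show "\<forall>y\<in>marks. \<forall>y'\<in>marks. r y = r y' \<longrightarrow> fin y = fin y'"
    using W(2) by metis
next
  assume "\<forall>y\<in>marks. \<forall>y'\<in>marks. r y = r y' \<longrightarrow> fin y = fin y'"
  then show "ultimately_periodic {m. acc i0 m}"
    using recurrent_sufficient[OF zc r] by blast
qed

end

section \<open>The phases put together, with the total time\<close>

lemma (in digit_automaton) wp_program:
  assumes xs: "xs = [b, n, i0] @ concat (map (\<lambda>q. map (\<delta> q) [0..<b]) [0..<n]) @
      map (\<lambda>q. if fin q then 1 else 0) [0..<n]"
    and n: "N = Suc n" and sink: "\<And>a. a < b \<Longrightarrow> \<delta> n a = n" "\<not> fin n"
    and L: "2 * N < 2 ^ L"
  shows "wp program
     (\<lambda>M' _ _. M' 0 0 = (if zero_closed \<and> ultimately_periodic {m. acc i0 m} then 1 else 0))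
     (\<lambda>_ _. 0) xs (400 * (b * N * L))"
proof -
  have load: "wp load (\<lambda>M' _ _. loaded M' \<and> (\<forall>j. j = resV \<or> j = spV \<or> j \<ge> accA \<longrightarrow> M' j = (\<lambda>_. 0)))
      (\<lambda>_ _. 0) xs (30 * b * N)"
    using sink by (intro wp_load[OF xs n])
  obtain M1 xs1 where r1: "runs load (30 * b * N) (\<lambda>_ _. 0) xs M1 xs1"
    and *: "loaded M1 \<and> (\<forall>j. j = resV \<or> j = spV \<or> j \<ge> accA \<longrightarrow> M1 j = (\<lambda>_. 0))"
    by (rule wpE[OF load]) (rule that)
  then have p1: "loaded M1" "\<forall>j. j = resV \<or> j = spV \<or> j \<ge> accA \<longrightarrow> M1 j = (\<lambda>_. 0)"
    by auto
  have z1: "M1 accA = (\<lambda>_. 0)" "M1 degA = (\<lambda>_. 0)" "M1 liveA = (\<lambda>_. 0)" "M1 resV = (\<lambda>_. 0)"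
      "M1 inA = (\<lambda>_. 0)" "M1 markA = (\<lambda>_. 0)" "M1 labA = (\<lambda>_. 0)"
    using p1(2) by simp_all
  obtain M2 xs2 where r2: "runs search (20 * b * N) M1 xs1 M2 xs2"
    and p2: "loaded M2" "support (M2 accA) = reachable" "M2 spV 0 = 0"
    and u2: "unchanged (writes search) M1 M2"
    by (rule wpE[where xs = xs1, OF wp_search[OF p1(1) z1(1)]]) ((elim conjE)?, rule that)
  have z2: "M2 degA = (\<lambda>_. 0)" "M2 liveA = (\<lambda>_. 0)" "M2 resV 0 = 0"
      "M2 inA = (\<lambda>_. 0)" "M2 markA = (\<lambda>_. 0)" "M2 labA = (\<lambda>_. 0)"
    using z1 u2 by (simp_all add: program_defs)
  obtain M3 xs3 where r3: "runs check_zeros (5 * N + 2) M2 xs2 M3 xs3"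
    and p3: "M3 resV 0 = 0 \<longleftrightarrow> zero_closed"
    and u3: "unchanged (writes check_zeros) M2 M3"
    by (rule wpE[where xs = xs2, OF wp_check_zeros[OF p2(1,2) z2(3)]]) ((elim conjE)?, rule that)
  have l3: "loaded M3"
    by (rule loaded_cong[OF p2(1) u3]) (simp add: program_defs)
  have z3: "support (M3 accA) = reachable" "M3 degA = (\<lambda>_. 0)" "M3 liveA = (\<lambda>_. 0)" "M3 spV 0 = 0"
      "M3 inA = (\<lambda>_. 0)" "M3 markA = (\<lambda>_. 0)" "M3 labA = (\<lambda>_. 0)"
    using p2 z2 u3 by (simp_all add: program_defs)
  obtain M4 xs4 where r4: "runs degrees (20 * b * N) M3 xs3 M4 xs4"
    and p4: "support (M4 liveA) = reachable" "M4 degA = indegree reachable"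
    and u4: "unchanged (writes degrees) M3 M4"
    by (rule wpE[where xs = xs3, OF wp_degrees[OF l3 z3(1-3)]]) ((elim conjE)?, rule that)
  have l4: "loaded M4"
    by (rule loaded_cong[OF l3 u4]) (simp add: program_defs)
  have z4: "M4 spV 0 = 0" "M4 resV = M3 resV" "M4 inA = (\<lambda>_. 0)" "M4 markA = (\<lambda>_. 0)" "M4 labA = (\<lambda>_. 0)"
    using z3 u4 by (simp_all add: program_defs)
  obtain M5 xs5 where r5: "runs peel (20 * b * N) M4 xs4 M5 xs5"
    and p5: "loaded M5" "recurrent_states b N \<delta> i0 (support (M5 liveA))" "M5 spV 0 = 0"
    and u5: "unchanged (writes peel) M4 M5"
    by (rule wpE[where xs = xs4, OF wp_peel[OF l4 p4 z4(1)]]) ((elim conjE)?, rule that)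
  have z5: "M5 resV = M3 resV" "M5 inA = (\<lambda>_. 0)" "M5 markA = (\<lambda>_. 0)" "M5 labA = (\<lambda>_. 0)"
    using z4 u5 by (simp_all add: program_defs)
  interpret R: recurrent_states b N \<delta> fin i0 "support (M5 liveA)"
    by (rule p5(2))
  obtain M6 xs6 where r6: "runs mirror (4 * N + 2) M5 xs5 M6 xs6"
    and p6: "support (M6 liveA) = R.active"
    and u6: "unchanged (writes mirror) M5 M6"
    by (rule wpE[where xs = xs5, OF R.wp_mirror[OF p5(1) refl]]) ((elim conjE)?, rule that)
  have l6: "loaded M6"
    by (rule loaded_cong[OF p5(1) u6]) (simp add: program_defs)
  obtain M7 xs7 where r7: "runs singletons (8 * N + 2) M6 xs6 M7 xs7"
    and p7: "union_find (2 * N) (\<lambda>x. x) (M7 parA) (M7 sizeA)"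
    and u7: "unchanged (writes singletons) M6 M7"
    by (rule wpE[where xs = xs6, OF R.wp_singletons[OF l6]]) ((elim conjE)?, rule that)
  have l7: "loaded M7"
    by (rule loaded_cong[OF l6 u7]) (simp add: program_defs)
  have z7: "support (M7 liveA) = R.active" "M7 inA = (\<lambda>_. 0)" "M7 spV 0 = 0"
      "M7 resV = M3 resV" "M7 markA = (\<lambda>_. 0)" "M7 labA = (\<lambda>_. 0)"
    using p5 p6 z5 u6 u7 by (simp_all add: program_defs)
  obtain M8 xs8 where r8: "runs link_all (2 * N * (8 * b + 5) + 2) M7 xs7 M8 xs8"
    and p8: "R.closing (\<lambda>_ x. x) (\<lambda>x. x) (pairs M8) (M8 inA)" "M8 spV 0 \<le> 2 * N * b"
    and u8: "unchanged (writes link_all) M7 M8"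
    by (rule wpE[where xs = xs7, OF R.wp_link_all[OF l7 z7(1-3)]]) ((elim conjE)?, rule that)
  have l8: "loaded M8"
    by (rule loaded_cong[OF l7 u8]) (simp add: program_defs)
  have z8: "union_find (2 * N) (\<lambda>x. x) (M8 parA) (M8 sizeA)" "support (M8 liveA) = R.active"
      "M8 resV = M3 resV" "M8 markA = (\<lambda>_. 0)" "M8 labA = (\<lambda>_. 0)"
    using p7 z7 u8 by (simp_all add: program_defs)
  obtain M9 xs9 where r9: "runs close_pairs (R.closing_time L (M8 spV 0) (2 * N)) M8 xs8 M9 xs9"
    and p9: "\<exists>r. union_find (2 * N) r (M9 parA) (M9 sizeA) \<and> R.bicompatible r \<and>
      (\<forall>V :: sets. \<forall>x\<in>R.active. R.bicompatible V \<longrightarrow> V (r x) = V x)"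
    and u9: "unchanged (writes close_pairs) M8 M9"
    by (rule wpE[where xs = xs8, OF R.wp_close_pairs[OF l8 z8(1) p8(1) L]]) ((elim conjE)?, rule that)
  obtain r where r: "union_find (2 * N) r (M9 parA) (M9 sizeA)" "R.bicompatible r"
      "\<And>V :: sets. \<And>x. x \<in> R.active \<Longrightarrow> R.bicompatible V \<Longrightarrow> V (r x) = V x"
    using p9 by blast
  have l9: "loaded M9"
    by (rule loaded_cong[OF l8 u9]) (simp add: program_defs)
  have z9: "support (M9 liveA) = R.active" "M9 markA = (\<lambda>_. 0)" "M9 resV = M3 resV" "M9 labA = (\<lambda>_. 0)"
    using z8 u9 by (simp_all add: program_defs)
  obtain M10 xs10 where r10: "runs mark_all (N * (6 * b + 5) + 2) M9 xs9 M10 xs10"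
    and p10: "support (M10 markA) = R.marks"
    and u10: "unchanged (writes mark_all) M9 M10"
    by (rule wpE[where xs = xs9, OF R.wp_mark_all[OF l9 z9(1,2)]]) ((elim conjE)?, rule that)
  have l10: "loaded M10"
    by (rule loaded_cong[OF l9 u10]) (simp add: program_defs)
  have z10: "M10 labA = (\<lambda>_. 0)" "union_find (2 * N) r (M10 parA) (M10 sizeA)" "M10 resV = M3 resV"
    using r(1) z9 u10 by (simp_all add: program_defs)
  obtain M11 xs11 where r11: "runs label_all (N * (2 * L + 8) + 2) M10 xs10 M11 xs11"
    and p11: "M11 resV 0 = 0 \<longleftrightarrow> M10 resV 0 = 0 \<and>
      (\<forall>y\<in>R.marks. \<forall>y'\<in>R.marks. r y = r y' \<longrightarrow> fin y = fin y')"
    by (rule wpE[where xs = xs10, OF R.wp_label_all[OF l10 p10 z10(1,2) L]]) ((elim conjE)?, rule that)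
  have result: "M11 resV 0 = 0 \<longleftrightarrow> zero_closed \<and> ultimately_periodic {m. acc i0 m}"
    using p11 p3 R.ultimately_periodic_iff_agree[OF _ r(2,3)] unfolding z10(3) by blast
  obtain M12 xs12 where r12: "runs (resV ::= Minus (Num 1) (Var resV)) 1 M11 xs11 M12 xs12"
    and p12: "M12 resV 0 = 1 - M11 resV 0"
    by (rule wpE[of "resV ::= Minus (Num 1) (Var resV)" "\<lambda>M' _. M' resV 0 = 1 - M11 resV 0" M11 xs11 1]) auto
  \<comment> \<open>The number of pairs left by \<open>link_all\<close> is only known up to a bound,
    so the budget is made uniform here.\<close>
  have "R.closing_time L (M8 spV 0) (2 * N) \<le> R.closing_time L (2 * N * b) (2 * N)"
    using p8(2) unfolding R.closing_time_def by (intro add_mono mult_le_mono1) auto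
  note r9' = runs_mono[OF r9 this]
  let ?T = "30 * b * N + (20 * b * N + ((5 * N + 2) + (20 * b * N + (20 * b * N + ((4 * N + 2) +
     ((8 * N + 2) + ((2 * N * (8 * b + 5) + 2) + (R.closing_time L (2 * N * b) (2 * N) +
     ((N * (6 * b + 5) + 2) + ((N * (2 * L + 8) + 2) + 1))))))))))"
  have "runs program ?T (\<lambda>_ _. 0) xs M12 xs12"
    unfolding program_def
    by (intro runs_Seq[OF r1] runs_Seq[OF r2] runs_Seq[OF r3] runs_Seq[OF r4] runs_Seq[OF r5]
        runs_Seq[OF r6] runs_Seq[OF r7] runs_Seq[OF r8] runs_Seq[OF r9'] runs_Seq[OF r10]
        runs_Seq[OF r11] r12)
  moreover have "?T \<le> 400 * (b * N * L)"
  proof -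
    have pos: "1 \<le> b" "1 \<le> N" "1 \<le> L"
      using b n L by (auto simp: Suc_le_eq intro: Nat.gr0I)
    have "1 * N * 1 \<le> b * N * L" "b * N * 1 \<le> b * N * L" "1 * N * L \<le> b * N * L" "1 * 1 * 1 \<le> b * N * L"
      using pos by (intro mult_le_mono; simp)+
    \<comment> \<open>The product terms of \<open>closing_time\<close> account for
      \<open>24 * (b * N * L)\<close>; all lower terms must fit into the remaining 376.\<close>
    then have "14 + (2 * (N * L) + 60 * N + 184 * (b * N)) \<le> 376 * (b * N * L)"
      by linarith
    then show ?thesis
      unfolding R.closing_time_def by (simp add: algebra_simps)
  qed
  ultimately have "runs program (400 * (b * N * L)) (\<lambda>_ _. 0) xs M12 xs12"
    by (rule runs_mono)
  moreover have "M12 0 0 = (if zero_closed \<and> ultimately_periodic {m. acc i0 m} then 1 else 0)"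
    using p12 result by auto
  ultimately show ?thesis
    by (rule wpI[where R = "\<lambda>M _. M 0 0 =
      (if zero_closed \<and> ultimately_periodic {m. acc i0 m} then 1 else 0)"])
qed

lemma wf_program: "wf_com program"
  by (simp add: program_def program_defs For_def)

section \<open>Completion by a sink and the final bound\<close>

definition totalised :: "dfa \<Rightarrow> nat \<Rightarrow> nat \<Rightarrow> nat" where
  "totalised A q a = (if q < nstates A
     then case trans A q a of None \<Rightarrow> nstates A | Some q' \<Rightarrow> q' else nstates A)"

lemma totalised_automaton:
  assumes "is_dfa b A" "b > 1"
  shows "digit_automaton b (Suc (nstates A)) (totalised A) (initial A)"
proof
  show "totalised A q a < Suc (nstates A)" if "q < Suc (nstates A)" "a < b" for q a
    using assms(1) that unfolding is_dfa_def totalised_def by (auto split: option.split simp: less_SucI)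
qed (use assms in \<open>auto simp: is_dfa_def\<close>)

lemma totalised_sink: "foldl (totalised A) (nstates A) u = nstates A"
  by (induction u) (simp_all add: totalised_def)

lemma trans_word_totalised:
  assumes "is_dfa b A" "u \<in> lists {..<b}" "q < nstates A"
  shows "trans_word A q u = Some q' \<longleftrightarrow> foldl (totalised A) q u = q' \<and> q' < nstates A"
  using assms(2,3)
proof (induction u arbitrary: q rule: list.induct)
  case Nil
  then show ?case by auto
next
  case (Cons a u)
  show ?case
  proof (cases "trans A q a")
    case None
    then have "totalised A q a = nstates A"
      by (simp add: totalised_def)
    then show ?thesis
      using None totalised_sink[of A u] by simp
  next
    case (Some p)
    have "a < b"
      using Cons.prems by simp
    then have "p < nstates A"
      using assms(1)[unfolded is_dfa_def, THEN conjunct2, THEN conjunct2, rule_format]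
        Cons.prems(2) Some by metis
    moreover have "totalised A q a = p"
      using Some Cons.prems by (simp add: totalised_def)
    ultimately show ?thesis
      using Cons.IH[of p] Cons.prems Some by simp
  qed
qed

lemma language_totalised:
  assumes "is_dfa b A"
  shows "u \<in> language b A \<longleftrightarrow> u \<in> lists {..<b} \<and> foldl (totalised A) (initial A) u \<in> final A"
proof (cases "u \<in> lists {..<b}")
  case True
  have A: "initial A < nstates A" "final A \<subseteq> {..<nstates A}"
    using assms by (simp_all add: is_dfa_def)
  have "u \<in> language b A \<longleftrightarrow> (\<exists>q\<in>final A. trans_word A (initial A) u = Some q)"
    using True by (simp only: language_def mem_Collect_eq simp_thms)
  also have "\<dots> \<longleftrightarrow> foldl (totalised A) (initial A) u \<in> final A"
    unfolding trans_word_totalised[OF assms True A(1)] using A(2) by auto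
  finally show ?thesis
    using True by blast
qed (simp add: language_def)

text \<open>Since the sink is numbered like a missing transition, the encoding is literally the
  table of the completed automaton without the row of the sink.\<close>

lemma encode_dfa_totalised:
  "encode_dfa b A = [b, nstates A, initial A] @
     concat (map (\<lambda>q. map (totalised A q) [0..<b]) [0..<nstates A]) @
     map (\<lambda>q. if q \<in> final A then 1 else 0) [0..<nstates A]"
proof -
  have "map (\<lambda>q. map (\<lambda>a. case trans A q a of None \<Rightarrow> nstates A | Some q' \<Rightarrow> q') [0..<b]) [0..<nstates A] =
      map (\<lambda>q. map (totalised A q) [0..<b]) [0..<nstates A]"
    by (intro map_cong refl) (simp add: totalised_def)
  then show ?thesis
    by (simp only: encode_dfa_def)
qed

text \<open>Take \<open>L = l + 1\<close> for the integer part \<open>l\<close> of the logarithm of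
  \<open>2 * Suc n\<close>. As \<open>2 * Suc n \<le> 4 * n\<close>, it is at most 3 plus the
  logarithm of \<open>n\<close>, and 4 times the maximum with 1 covers both.\<close>

lemma ex_log_bound:
  fixes n :: nat
  assumes "n > 0"
  shows "\<exists>L. 2 * Suc n < 2 ^ L \<and> real L \<le> 4 * max 1 (log 2 (real n))"
proof -
  obtain l where l: "2 ^ l \<le> 2 * Suc n" "2 * Suc n < 2 ^ (l + 1)"
    using ex_power_ivl1[of 2 "2 * Suc n"] by auto
  have "real l = log 2 (2 ^ l)"
    by simp
  also have "\<dots> \<le> log 2 (4 * real n)"
  proof -
    have "2 * Suc n \<le> 4 * n"
      using assms by simp
    with l(1) have "2 ^ l \<le> 4 * n"
      by (rule order_trans)
    then have "(2::real) ^ l \<le> 4 * real n"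
      by (metis of_nat_le_iff of_nat_mult of_nat_numeral of_nat_power)
    then show ?thesis
      using assms by (subst log_le_cancel_iff) auto
  qed
  also have "\<dots> = 2 + log 2 (real n)"
    using assms log_pow_cancel[of 2 2] by (simp add: log_mult)
  finally have "real (l + 1) \<le> 4 * max 1 (log 2 (real n))"
    by linarith
  then show ?thesis
    using l(2) by blast
qed

text \<open>Program and constant come before \<open>b\<close>, \<open>n\<close> and the automaton,
  so the bound is uniform. The maximum with 1 is there for \<open>n = 1\<close>, where the logarithm
  vanishes.\<close>

theorem corollary1p2:
  "\<exists>(P :: instr list) (C :: real). C > 0 \<and>
     (\<forall>(b :: nat) (n :: nat) (A :: dfa). b > 1 \<and> is_dfa b A \<and> nstates A = n \<longrightarrow>
        outputs_within P (encode_dfa b A)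
          (C * (real (b * n) * max 1 (log 2 (real n))))
          (if \<exists>S. accepts_set b A S \<and> ultimately_periodic S then 1 else 0))"
proof (intro exI conjI allI impI)
  let ?K = "real (tick_cost program)"
  \<comment> \<open>3200 is 400 times 2, for \<open>Suc n \<le> 2 * n\<close>, times 4 from
    \<open>ex_log_bound\<close>. The added 1 makes the constant positive without evaluating
    \<open>tick_cost program\<close>.\<close>
  show "0 < ?K * 3200 + 1"
    by (simp add: add_nonneg_pos)
  fix b n :: nat and A :: dfa
  assume A: "b > 1 \<and> is_dfa b A \<and> nstates A = n"
  then have n: "n > 0"
    unfolding is_dfa_def by auto
  interpret digit_automaton b "Suc n" "totalised A" "\<lambda>q. q \<in> final A" "initial A"
    using totalised_automaton[of b A] A by simp
  obtain L where L: "2 * Suc n < 2 ^ L" "real L \<le> 4 * max 1 (log 2 (real n))"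
    using ex_log_bound[OF n] by blast
  have "wp program
     (\<lambda>M' _ _. M' 0 0 = (if zero_closed \<and> ultimately_periodic {m. acc (initial A) m} then 1 else 0))
     (\<lambda>_ _. 0) (encode_dfa b A) (400 * (b * Suc n * L))"
  proof (rule wp_program)
    show "encode_dfa b A = [b, n, initial A] @
      concat (map (\<lambda>q. map (totalised A q) [0..<b]) [0..<n]) @
      map (\<lambda>q. if q \<in> final A then 1 else 0) [0..<n]"
      using A encode_dfa_totalised[of b A] by simp
    show "totalised A n a = n" for a
      using A by (auto simp: totalised_def)
    show "n \<notin> final A"
      using A unfolding is_dfa_def by auto
  qed (use L in auto)
  then obtain k M' xs' where k: "big program (\<lambda>_ _. 0) (encode_dfa b A) k M' xs'"
      "k \<le> 400 * (b * Suc n * L)"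
      "M' 0 0 = (if zero_closed \<and> ultimately_periodic {m. acc (initial A) m} then 1 else 0)"
    unfolding wp_def by blast
  have "accepts_set b A S \<longleftrightarrow> zero_closed \<and> S = {m. acc (initial A) m}" for S
    unfolding accepts_set_def
    by (rule acceptance_by_value_iff) (use A language_totalised in auto)
  then have y: "M' 0 0 = (if \<exists>S. accepts_set b A S \<and> ultimately_periodic S then 1 else 0)"
    using k(3) by auto
  have "real k \<le> real (400 * (b * Suc n * L))"
    using k(2) by linarith
  also have "\<dots> \<le> 400 * (real b * (2 * real n) * (4 * max 1 (log 2 (real n))))"
    unfolding of_nat_mult using n L(2) by (intro mult_mono) auto
  finally have "real k \<le> 3200 * (real (b * n) * max 1 (log 2 (real n)))"
    by simp
  then have "?K * real k \<le> ?K * (3200 * (real (b * n) * max 1 (log 2 (real n))))"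
    by (rule mult_left_mono) simp
  also have "\<dots> \<le> (?K * 3200 + 1) * (real (b * n) * max 1 (log 2 (real n)))"
    by (simp add: distrib_right mult.assoc)
  finally have "real (tick_cost program * k) \<le> (?K * 3200 + 1) * (real (b * n) * max 1 (log 2 (real n)))"
    by simp
  then show "outputs_within (com_code program 0) (encode_dfa b A)
      ((?K * 3200 + 1) * (real (b * n) * max 1 (log 2 (real n))))
      (if \<exists>S. accepts_set b A S \<and> ultimately_periodic S then 1 else 0)"
    using outputs_within_com_code[OF k(1) wf_program _ y] by blast
qed

end
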